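(* Let $h_1,h_2,h_3>0$, $\Omega=(-\frac{h_1}2,\frac{h_1}2)\times(-\frac{h_2}2,\frac{h_2}2)\times(-\frac{h_3}2,\frac{h_3}2)\subset\mathbb{R}^3$ and $\Gamma=\partial\Omega$. Then the exact constant $C_1(\Omega,\Gamma)$ is equal to $\frac1\pi\max\{h_1;h_2;h_3\}$.
   Context: For a bounded connected Lipschitz domain $\Omega\subset\mathbb{R}^d$ and a measurable part $\Gamma\subset\partial\Omega$ of positive $(d-1)$-dimensional measure, let $\widetilde H^1(\Omega,\Gamma)=\{w\in H^1(\Omega): \text{the mean value of (the trace of) } w \text{ on } \Gamma \text{ is zero}\}$. The norm in $L^2(\omega)$ is denoted $\|\cdot\|_{2,\omega}$. The exact (sharp) constant $C_1(\Omega,\Gamma)$ is the smallest constant $C$ such that $\|w\|_{2,\Omega}\le C\|\nabla w\|_{2,\Omega}$ for all $w\in\widetilde H^1(\Omega,\Gamma)$. *)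

theory Defs
  imports "HOL-Analysis.Analysis"
begin

subsection \<open>Surface measure\<close>

text \<open>
  The \<open>k\<close>-dimensional Hausdorff measure with the usual normalisation, for which it is
  \<open>k\<close>-dimensional Lebesgue measure on \<open>k\<close>-dimensional planes. The covering sets have to be
  \<^const>\<open>bounded\<close> because \<^const>\<open>diameter\<close> is meaningless on unbounded sets; empty covering sets
  contribute nothing, also for \<open>k = 0\<close>.
\<close>

definition hausdorff_pre :: "nat \<Rightarrow> real \<Rightarrow> 'a::euclidean_space set \<Rightarrow> ennreal" where
  "hausdorff_pre k \<delta> A =
     (INF C \<in> {C :: nat \<Rightarrow> 'a set.
                 A \<subseteq> (\<Union>n. C n) \<and> (\<forall>n. bounded (C n) \<and> diameter (C n) \<le> \<delta>)}.
        \<Sum>n. if C n = {} then 0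
             else ennreal (unit_ball_vol (real k) * (diameter (C n) / 2) ^ k))"

definition hausdorff_outer :: "nat \<Rightarrow> 'a::euclidean_space set \<Rightarrow> ennreal" where
  "hausdorff_outer k A = (SUP \<delta> \<in> {0<..}. hausdorff_pre k \<delta> A)"

text \<open>
  The outer measure is a metric outer measure, hence countably additive on the Borel sets, so
  \<^const>\<open>measure_of\<close> does not degenerate to the zero measure here.
\<close>

definition hausdorff_measure :: "nat \<Rightarrow> 'a::euclidean_space measure" where
  "hausdorff_measure k = measure_of UNIV (sets borel) (hausdorff_outer k)"

definition surface_measure :: "'a::euclidean_space set \<Rightarrow> 'a measure" where
  "surface_measure \<Omega> =
     restrict_space (hausdorff_measure (DIM('a) - 1)) (frontier \<Omega>)"

definition mean_value :: "'a measure \<Rightarrow> 'a set \<Rightarrow> ('a \<Rightarrow> real) \<Rightarrow> real" where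
  "mean_value M \<Gamma> g = (LINT x:\<Gamma>|M. g x) / measure M \<Gamma>"


subsection \<open>Square-integrable functions\<close>

definition square_integrable :: "'a measure \<Rightarrow> ('a \<Rightarrow> 'b::euclidean_space) \<Rightarrow> bool" where
  "square_integrable M f \<longleftrightarrow>
     f \<in> borel_measurable M \<and> integrable M (\<lambda>x. (norm (f x))\<^sup>2)"

definition l2norm :: "'a measure \<Rightarrow> ('a \<Rightarrow> 'b::euclidean_space) \<Rightarrow> real" where
  "l2norm M f = sqrt (LINT x|M. (norm (f x))\<^sup>2)"


subsection \<open>Smooth functions, weak gradients and the Sobolev space\<close>

primrec Ck :: "nat \<Rightarrow> ('a::euclidean_space \<Rightarrow> real) \<Rightarrow> bool" where
  "Ck 0 f \<longleftrightarrow> continuous_on UNIV f"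
| "Ck (Suc k) f \<longleftrightarrow>
     (\<forall>x. f differentiable (at x)) \<and>
     (\<forall>i\<in>Basis. Ck k (\<lambda>x. frechet_derivative f (at x) i))"

definition smooth :: "('a::euclidean_space \<Rightarrow> real) \<Rightarrow> bool" where
  "smooth f \<longleftrightarrow> (\<forall>k. Ck k f)"

definition test_function :: "'a::euclidean_space set \<Rightarrow> ('a \<Rightarrow> real) \<Rightarrow> bool" where
  "test_function \<Omega> \<phi> \<longleftrightarrow>
     smooth \<phi> \<and> compact (closure {x. \<phi> x \<noteq> 0}) \<and> closure {x. \<phi> x \<noteq> 0} \<subseteq> \<Omega>"

definition classical_grad :: "('a::euclidean_space \<Rightarrow> real) \<Rightarrow> 'a \<Rightarrow> 'a" where
  "classical_grad u x = (\<Sum>i\<in>Basis. frechet_derivative u (at x) i *\<^sub>R i)"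

definition has_L2_weak_grad ::
    "'a::euclidean_space set \<Rightarrow> ('a \<Rightarrow> real) \<Rightarrow> ('a \<Rightarrow> 'a) \<Rightarrow> bool" where
  "has_L2_weak_grad \<Omega> w G \<longleftrightarrow>
     square_integrable (lebesgue_on \<Omega>) G \<and>
     (\<forall>\<phi>. test_function \<Omega> \<phi> \<longrightarrow> (\<forall>i\<in>Basis.
        (LINT x|lebesgue_on \<Omega>. w x * frechet_derivative \<phi> (at x) i) =
        - (LINT x|lebesgue_on \<Omega>. (G x \<bullet> i) * \<phi> x)))"

text \<open>
  Elements of Lebesgue and Sobolev spaces are represented by functions on the whole space of which
  only the values in \<open>\<Omega>\<close> matter. The weak gradient is unique up to null sets.
\<close>

definition H1 :: "'a::euclidean_space set \<Rightarrow> ('a \<Rightarrow> real) set" where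
  "H1 \<Omega> = {w. square_integrable (lebesgue_on \<Omega>) w \<and> (\<exists>G. has_L2_weak_grad \<Omega> w G)}"

definition weak_grad :: "'a::euclidean_space set \<Rightarrow> ('a \<Rightarrow> real) \<Rightarrow> 'a \<Rightarrow> 'a" where
  "weak_grad \<Omega> w = (SOME G. has_L2_weak_grad \<Omega> w G)"


subsection \<open>Traces and the sharp constant\<close>

text \<open>
  The trace operator is the continuous extension of the restriction map, from smooth functions up
  to the boundary to \<open>H1 \<Omega>\<close>. On a bounded Lipschitz domain the trace \<open>g\<close> of \<open>w \<in> H1 \<Omega>\<close> exists
  and is unique up to null sets of the boundary.
\<close>

definition has_trace ::
    "'a::euclidean_space set \<Rightarrow> ('a \<Rightarrow> real) \<Rightarrow> ('a \<Rightarrow> real) \<Rightarrow> bool" where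
  "has_trace \<Omega> w g \<longleftrightarrow>
     square_integrable (surface_measure \<Omega>) g \<and>
     (\<exists>u :: nat \<Rightarrow> 'a \<Rightarrow> real.
        (\<forall>n. smooth (u n)) \<and>
        (\<lambda>n. l2norm (lebesgue_on \<Omega>) (\<lambda>x. u n x - w x)) \<longlonglongrightarrow> 0 \<and>
        (\<lambda>n. l2norm (lebesgue_on \<Omega>) (\<lambda>x. classical_grad (u n) x - weak_grad \<Omega> w x)) \<longlonglongrightarrow> 0 \<and>
        (\<lambda>n. l2norm (surface_measure \<Omega>) (\<lambda>x. u n x - g x)) \<longlonglongrightarrow> 0)"

definition H1_mean_zero :: "'a::euclidean_space set \<Rightarrow> 'a set \<Rightarrow> ('a \<Rightarrow> real) set" where
  "H1_mean_zero \<Omega> \<Gamma> =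
     {w \<in> H1 \<Omega>. \<exists>g. has_trace \<Omega> w g \<and> mean_value (surface_measure \<Omega>) \<Gamma> g = 0}"

definition poincare_bound :: "'a::euclidean_space set \<Rightarrow> 'a set \<Rightarrow> real \<Rightarrow> bool" where
  "poincare_bound \<Omega> \<Gamma> C \<longleftrightarrow>
     (\<forall>w \<in> H1_mean_zero \<Omega> \<Gamma>.
        l2norm (lebesgue_on \<Omega>) w \<le> C * l2norm (lebesgue_on \<Omega>) (weak_grad \<Omega> w))"

definition C1 :: "'a::euclidean_space set \<Rightarrow> 'a set \<Rightarrow> real" where
  "C1 \<Omega> \<Gamma> = (LEAST C. poincare_bound \<Omega> \<Gamma> C)"

end

theory Submission
  imports Defs "HOL-Probability.Probability_Measure"
begin

text \<open>
  Let \<open>a\<close>, \<open>b\<close>, \<open>c\<close> be the halves of the edge lengths, \<open>L\<close> the largest of them, and let \<open>E\<close> denote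
  averages over the box. The claim is that the sharp constant equals \<open>2 L / \<pi>\<close>.

  The lower bound comes from \<open>sin (\<pi> x / (2 L))\<close>, where \<open>x\<close> is the coordinate along a longest
  edge. It is odd, and the surface is symmetric about the origin, so the surface mean vanishes; the
  squares of sine and cosine have equal averages over the box, so the quotient of the two norms is
  exactly \<open>2 L / \<pi>\<close>.

  The upper bound rests on one fact about an interval. If \<open>G a + G (- a) = 0\<close>, then \<open>G\<close> extends to an
  antiperiodic function of period \<open>4 a\<close>, which has mean zero, and the Wirtinger inequality for that
  period gives \<open>\<integral> G\<^sup>2 \<le> (2 a / \<pi>)\<^sup>2 \<integral> G'\<^sup>2\<close> on \<open>[- a, a]\<close> (\<open>wirtinger_antiperiodic\<close>). Take a line through
  the box parallel to an axis and let \<open>G\<close> be \<open>u\<close> minus the mean of its two end values on that line.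
  The left-hand side is then the variance of \<open>u\<close> on the line plus the squared difference between the
  average and the mean of the end values. Summing over the three directions, with subadditivity of
  the variance on products (\<open>variance_pair_le\<close>) and Jensen's inequality, gives
  (\<open>box_trace_inequality\<close>)

    \<open>E u\<^sup>2 - (E u)\<^sup>2 + (E u - S1)\<^sup>2 + (E u - S2)\<^sup>2 + (E u - S3)\<^sup>2 \<le> (2 L / \<pi>)\<^sup>2 E \<bar>\<nabla>u\<bar>\<^sup>2\<close>,

  where \<open>S1\<close>, \<open>S2\<close>, \<open>S3\<close> are the means of \<open>u\<close> over the three pairs of opposite faces. If \<open>u\<close> has
  surface mean zero, then a convex combination of \<open>S1\<close>, \<open>S2\<close>, \<open>S3\<close> vanishes, so \<open>E u\<close> is a convex
  combination of the differences \<open>E u - Si\<close>. Hence \<open>(E u)\<^sup>2\<close> is at most the sum of their squares, and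
  what is left is the Poincare inequality for smooth \<open>u\<close>. The approximating sequence in the
  definition of the trace carries it over to the Sobolev space, once the surface means of its
  members, which tend to zero, have been subtracted.

  Two facts connect this with the definitions. On a plane, the Hausdorff measure is a positive finite
  multiple of area (\<open>hausdorff_plane_eq_lborel\<close>), a factor that cancels in every mean value. And
  weak gradients are unique up to null sets (\<open>weak_grad_unique\<close>), so that the weak gradient of the
  sine is the classical one.
\<close>

section \<open>A sharp inequality on an interval\<close>

text \<open>
  Picone's identity: with \<open>f x = - k tan (k (x - m))\<close>, which satisfies \<open>f' = - k\<^sup>2 - f\<^sup>2\<close>, the expression
  \<open>G'\<^sup>2 - k\<^sup>2 G\<^sup>2 - (f G\<^sup>2)'\<close> is the square \<open>(G' - f G)\<^sup>2\<close>. Only the boundary values of \<open>f G\<^sup>2\<close> remain.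
\<close>

lemma picone_interval:
  fixes G G' :: "real \<Rightarrow> real"
  assumes "p \<le> q"
    and G: "\<And>x. (G has_real_derivative G' x) (at x)" and G': "continuous_on UNIV G'"
    and r: "\<And>x. p \<le> x \<Longrightarrow> x \<le> q \<Longrightarrow> \<bar>k * (x - m)\<bar> < pi / 2"
  shows "integral {p..q} (\<lambda>x. (G' x)\<^sup>2 - k\<^sup>2 * (G x)\<^sup>2)
    \<ge> k * tan (k * (p - m)) * (G p)\<^sup>2 - k * tan (k * (q - m)) * (G q)\<^sup>2"
proof -
  define f where "f x = - k * tan (k * (x - m))" for x
  have cG: "continuous_on S G" for S
    by (meson G DERIV_isCont continuous_at_imp_continuous_on)
  have cG': "continuous_on S G'" for S
    using G' continuous_on_subset by blast
  have cosp: "cos (k * (x - m)) > 0" if "p \<le> x" "x \<le> q" for x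
    using r[OF that] by (intro cos_gt_zero_pi) auto
  have df: "(f has_real_derivative - k\<^sup>2 - (f x)\<^sup>2) (at x)" if "p \<le> x" "x \<le> q" for x
  proof -
    have c: "cos (k * (x - m)) \<noteq> 0"
      using cosp[OF that] by simp
    have "((\<lambda>x. tan (k * (x - m))) has_real_derivative inverse ((cos (k * (x - m)))\<^sup>2) * k) (at x)"
      using c by (auto intro!: derivative_eq_intros)
    also have "inverse ((cos (k * (x - m)))\<^sup>2) = 1 + (tan (k * (x - m)))\<^sup>2"
      using tan_sec[OF c] by (simp add: power_inverse)
    finally show ?thesis
      unfolding f_def by (rule DERIV_cmult[THEN DERIV_cong]) (simp add: algebra_simps power2_eq_square)
  qed
  have d: "((\<lambda>x. f x * (G x)\<^sup>2) has_vector_derivative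
      ((- k\<^sup>2 - (f x)\<^sup>2) * (G x)\<^sup>2 + f x * (2 * G x * G' x))) (at x within {p..q})"
    if "p \<le> x" "x \<le> q" for x
    unfolding has_real_derivative_iff_has_vector_derivative[symmetric]
    by (rule derivative_eq_intros refl df[OF that, THEN DERIV_subset] G[THEN DERIV_subset] subset_UNIV
       | simp add: algebra_simps)+
  have I: "((\<lambda>x. (- k\<^sup>2 - (f x)\<^sup>2) * (G x)\<^sup>2 + f x * (2 * G x * G' x)) has_integral
      (f q * (G q)\<^sup>2 - f p * (G p)\<^sup>2)) {p..q}"
    by (rule fundamental_theorem_of_calculus[OF \<open>p \<le> q\<close>]) (use d in auto)
  have J: "((\<lambda>x. (G' x)\<^sup>2 - k\<^sup>2 * (G x)\<^sup>2) has_integral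
      integral {p..q} (\<lambda>x. (G' x)\<^sup>2 - k\<^sup>2 * (G x)\<^sup>2)) {p..q}"
    by (intro integrable_integral integrable_continuous_real continuous_intros cG cG')
  have "f q * (G q)\<^sup>2 - f p * (G p)\<^sup>2 \<le> integral {p..q} (\<lambda>x. (G' x)\<^sup>2 - k\<^sup>2 * (G x)\<^sup>2)"
  proof (rule has_integral_le[OF I J])
    fix x
    have "(G' x)\<^sup>2 - k\<^sup>2 * (G x)\<^sup>2 - ((- k\<^sup>2 - (f x)\<^sup>2) * (G x)\<^sup>2 + f x * (2 * G x * G' x))
       = (G' x - f x * G x)\<^sup>2"
      by (simp add: power2_eq_square algebra_simps)
    then show "(- k\<^sup>2 - (f x)\<^sup>2) * (G x)\<^sup>2 + f x * (2 * G x * G' x) \<le> (G' x)\<^sup>2 - k\<^sup>2 * (G x)\<^sup>2"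
      by (metis diff_ge_0_iff_ge zero_le_power2)
  qed
  then show ?thesis
    by (simp add: f_def)
qed

text \<open>
  By the intermediate value theorem \<open>G\<close> has a zero \<open>t\<close>. The antiperiodic extension vanishes at \<open>t\<close> and
  at \<open>t + 2 a\<close>, so this is the Dirichlet inequality on an interval of length \<open>2 a\<close>, read off on the two
  pieces \<open>[- a, t]\<close> and \<open>[t, a]\<close>. For \<open>k < \<pi> / (2 a)\<close> the comparison function \<open>tan\<close>, centred at
  \<open>t + a\<close> and at \<open>t - a\<close>, has no pole; its boundary terms vanish at \<open>t\<close> and cancel at the
  two ends. Finally \<open>k\<close> tends to \<open>\<pi> / (2 a)\<close>.
\<close>

lemma wirtinger_antiperiodic:
  fixes G G' :: "real \<Rightarrow> real"
  assumes "0 < a"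
    and G: "\<And>x. (G has_real_derivative G' x) (at x)" and G': "continuous_on UNIV G'"
    and anti: "G a + G (- a) = 0"
  shows "integral {-a..a} (\<lambda>x. (G x)\<^sup>2) \<le> (2 * a / pi)\<^sup>2 * integral {-a..a} (\<lambda>x. (G' x)\<^sup>2)"
proof -
  have cG: "continuous_on S G" for S
    by (meson G DERIV_isCont continuous_at_imp_continuous_on)
  have cG': "continuous_on S G'" for S
    using G' continuous_on_subset by blast
  \<comment> \<open>The end values have opposite signs.\<close>
  obtain t where t: "-a \<le> t" "t \<le> a" "G t = 0"
  proof (cases "G (-a) \<le> 0")
    case True
    then show ?thesis
      using IVT'[of G "-a" 0 a] anti cG \<open>0 < a\<close> that by fastforce
  next
    case False
    then show ?thesis
      using IVT2'[of G a 0 "-a"] anti cG \<open>0 < a\<close> that by fastforce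
  qed
  define A where "A = integral {-a..a} (\<lambda>x. (G x)\<^sup>2)"
  define B where "B = integral {-a..a} (\<lambda>x. (G' x)\<^sup>2)"
  have *: "k\<^sup>2 * A \<le> B" if k: "0 < k" "k < pi / (2 * a)" for k
  proof -
    have ka: "k * a < pi / 2"
      using k \<open>0 < a\<close> by (simp add: field_simps)
    have ang: "\<bar>k * s\<bar> < pi / 2" if "\<bar>s\<bar> \<le> a" for s
    proof -
      have "\<bar>k * s\<bar> \<le> k * a"
        using mult_left_mono[OF that, of k] k by (simp add: abs_mult)
      then show ?thesis using ka by linarith
    qed
    have i1: "integral {t..a} (\<lambda>x. (G' x)\<^sup>2 - k\<^sup>2 * (G x)\<^sup>2)
        \<ge> k * tan (k * (t - (t + a))) * (G t)\<^sup>2 - k * tan (k * (a - (t + a))) * (G a)\<^sup>2"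
      by (rule picone_interval[OF _ G G']) (rule t | rule ang, use t in linarith)+
    have i2: "integral {-a..t} (\<lambda>x. (G' x)\<^sup>2 - k\<^sup>2 * (G x)\<^sup>2)
        \<ge> k * tan (k * (-a - (t - a))) * (G (-a))\<^sup>2 - k * tan (k * (t - (t - a))) * (G t)\<^sup>2"
      by (rule picone_interval[OF _ G G']) (rule t | rule ang, use t in linarith)+
    have "(G a)\<^sup>2 = (G (-a))\<^sup>2"
      using anti by (metis add_eq_0_iff power2_minus)
    then have "0 \<le> integral {-a..t} (\<lambda>x. (G' x)\<^sup>2 - k\<^sup>2 * (G x)\<^sup>2)
        + integral {t..a} (\<lambda>x. (G' x)\<^sup>2 - k\<^sup>2 * (G x)\<^sup>2)"
      using add_mono[OF i1 i2] t by simp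
    also have "\<dots> = integral {-a..a} (\<lambda>x. (G' x)\<^sup>2 - k\<^sup>2 * (G x)\<^sup>2)"
      using t by (intro Henstock_Kurzweil_Integration.integral_combine integrable_continuous_real
        continuous_intros cG cG') auto
    also have "\<dots> = B - k\<^sup>2 * A"
      unfolding A_def B_def
      by (subst Henstock_Kurzweil_Integration.integral_diff)
         (auto intro!: integrable_continuous_real continuous_intros cG cG')
    finally show ?thesis by simp
  qed
  have "((\<lambda>k. k\<^sup>2 * A) \<longlongrightarrow> (pi / (2 * a))\<^sup>2 * A) (at_left (pi / (2 * a)))"
    by (intro tendsto_intros)
  moreover have "\<forall>\<^sub>F k in at_left (pi / (2 * a)). k\<^sup>2 * A \<le> B"
  proof -
    have "\<forall>\<^sub>F k in at_left (pi / (2 * a)). k \<in> {0<..<pi / (2 * a)}"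
      using \<open>0 < a\<close> by (intro eventually_at_left_real) simp
    then show ?thesis
      by eventually_elim (use * in auto)
  qed
  ultimately have "(pi / (2 * a))\<^sup>2 * A \<le> B"
    by (intro tendsto_upperbound) auto
  then show ?thesis
    using \<open>0 < a\<close> unfolding A_def[symmetric] B_def[symmetric]
    by (simp add: power_divide power_mult_distrib field_simps)
qed

section \<open>Variances on product spaces\<close>

text \<open>
  Boundedness on the whole type passes to iterated integrals: integration against a probability
  measure keeps the bound, and a non-integrable section has integral \<open>0\<close>. Together with
  measurability it gives all the integrability conditions below, by the shape of the integrand.
\<close>

definition bdd_fun :: "('a \<Rightarrow> real) \<Rightarrow> bool" where
  "bdd_fun f \<longleftrightarrow> (\<exists>B. \<forall>x. \<bar>f x\<bar> \<le> B)"

lemma bdd_fun_comp: "bdd_fun f \<Longrightarrow> bdd_fun (\<lambda>x. f (h x))"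
  by (auto simp: bdd_fun_def)

lemma bdd_fun_add: assumes "bdd_fun f" "bdd_fun g" shows "bdd_fun (\<lambda>x. f x + g x)"
proof -
  obtain A B where "\<And>x. \<bar>f x\<bar> \<le> A" "\<And>x. \<bar>g x\<bar> \<le> B" using assms by (auto simp: bdd_fun_def)
  then have "\<bar>f x + g x\<bar> \<le> A + B" for x
    by (meson abs_triangle_ineq add_mono order_trans)
  then show ?thesis by (auto simp: bdd_fun_def)
qed

lemma bdd_fun_mult: assumes "bdd_fun f" "bdd_fun g" shows "bdd_fun (\<lambda>x. f x * g x)"
proof -
  obtain A B where A: "\<And>x. \<bar>f x\<bar> \<le> A" and B: "\<And>x. \<bar>g x\<bar> \<le> B" using assms by (auto simp: bdd_fun_def)
  have "\<bar>f x * g x\<bar> \<le> A * B" for x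
    unfolding abs_mult using A[of x] B[of x] by (intro mult_mono) auto
  then show ?thesis by (auto simp: bdd_fun_def)
qed

lemma bdd_fun_const: "bdd_fun (\<lambda>_. k)"
  by (auto simp: bdd_fun_def)

lemma bdd_fun_diff: "bdd_fun f \<Longrightarrow> bdd_fun g \<Longrightarrow> bdd_fun (\<lambda>x. f x - g x)"
  using bdd_fun_add[of f "\<lambda>x. - 1 * g x"] bdd_fun_mult[OF bdd_fun_const, of g "- 1"] by simp

lemma bdd_fun_power2: "bdd_fun f \<Longrightarrow> bdd_fun (\<lambda>x. (f x)\<^sup>2)"
  unfolding power2_eq_square by (intro bdd_fun_mult)

lemma integrable_bdd_fun:
  assumes "prob_space M" "bdd_fun f" "f \<in> borel_measurable M"
  shows "integrable M f"
proof -
  interpret prob_space M by fact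
  obtain B where "\<And>x. \<bar>f x\<bar> \<le> B" using assms(2) by (auto simp: bdd_fun_def)
  then show ?thesis using assms(3) by (intro integrable_const_bound[of _ B]) auto
qed

lemma bdd_fun_integral:
  assumes N: "prob_space N" and "bdd_fun (\<lambda>p. f (fst p) (snd p))"
  shows "bdd_fun (\<lambda>x. LINT y|N. f x y)"
proof -
  interpret prob_space N by fact
  obtain B where B: "\<And>x y. \<bar>f x y\<bar> \<le> B" using assms(2) by (auto simp: bdd_fun_def)
  have "\<bar>LINT y|N. f x y\<bar> \<le> B" for x
  proof (cases "integrable N (f x)")
    case True
    have "\<bar>LINT y|N. f x y\<bar> \<le> (LINT y|N. \<bar>f x y\<bar>)" by (rule integral_abs_bound)
    also have "\<dots> \<le> (LINT y|N. B)" by (rule integral_mono) (use True B in auto)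
    finally show ?thesis by (simp add: prob_space)
  next
    case False
    then show ?thesis using B[of x undefined] by (simp add: not_integrable_integral_eq)
  qed
  then show ?thesis by (auto simp: bdd_fun_def)
qed

lemmas bdd_fun_intros = bdd_fun_const bdd_fun_add bdd_fun_diff bdd_fun_mult bdd_fun_power2 bdd_fun_integral

lemma (in prob_space) square_expectation_le:
  fixes f :: "'a \<Rightarrow> real"
  assumes "integrable M f" "integrable M (\<lambda>x. (f x)\<^sup>2)"
  shows "(expectation f)\<^sup>2 \<le> expectation (\<lambda>x. (f x)\<^sup>2)"
  using variance_eq[OF assms] variance_positive[of f] by simp

text \<open>
  Subadditivity of the variance (Efron and Stein). With the marginal means \<open>f x\<close> and \<open>g y\<close> and the
  total mean \<open>m\<close>, the claim is the expansion of \<open>0 \<le> E (u - f - g + m)\<^sup>2\<close>.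
\<close>

lemma variance_pair_le:
  fixes u :: "'a \<times> 'b \<Rightarrow> real"
  assumes M: "prob_space M" and N: "prob_space N"
    and u[measurable]: "u \<in> borel_measurable (M \<Otimes>\<^sub>M N)" and bu: "bdd_fun u"
  shows "(LINT x|M. LINT y|N. (u (x, y))\<^sup>2) - (LINT x|M. LINT y|N. u (x, y))\<^sup>2
    \<le> (LINT y|N. (LINT x|M. (u (x, y))\<^sup>2) - (LINT x|M. u (x, y))\<^sup>2)
      + (LINT x|M. (LINT y|N. (u (x, y))\<^sup>2) - (LINT y|N. u (x, y))\<^sup>2)"
proof -
  interpret M: prob_space M by fact
  interpret N: prob_space N by fact
  interpret P: pair_prob_space M N ..
  have P: "prob_space (M \<Otimes>\<^sub>M N)" by (rule P.prob_space_axioms)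
  note int = integrable_bdd_fun[OF M] integrable_bdd_fun[OF N] integrable_bdd_fun[OF P]
  define f where "f x = (LINT y|N. u (x, y))" for x
  define g where "g y = (LINT x|M. u (x, y))" for y
  define m where "m = (LINT x|M. f x)"
  have f[measurable]: "f \<in> borel_measurable M" unfolding f_def by measurable
  have g[measurable]: "g \<in> borel_measurable N" unfolding g_def by measurable
  have bf: "bdd_fun f" unfolding f_def by (intro bdd_fun_intros N bdd_fun_comp[OF bu])
  have bg: "bdd_fun g" unfolding g_def by (intro bdd_fun_intros M bdd_fun_comp[OF bu])
  note b = bdd_fun_intros bu bf bg bdd_fun_comp[OF bf] bdd_fun_comp[OF bg] bdd_fun_comp[OF bu] M N
  have if2: "integrable M (\<lambda>x. (f x)\<^sup>2)" and ig2: "integrable N (\<lambda>x. (g x)\<^sup>2)"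
    by (intro int b; measurable)+
  have iu: "integrable (M \<Otimes>\<^sub>M N) u" and iu2: "integrable (M \<Otimes>\<^sub>M N) (\<lambda>p. (u p)\<^sup>2)"
    and i1: "integrable (M \<Otimes>\<^sub>M N) (\<lambda>p. u p * f (fst p))"
    and i2: "integrable (M \<Otimes>\<^sub>M N) (\<lambda>p. u p * g (snd p))"
    and i3: "integrable (M \<Otimes>\<^sub>M N) (\<lambda>p. f (fst p) * g (snd p))"
    and i4: "integrable (M \<Otimes>\<^sub>M N) (\<lambda>p. (f (fst p))\<^sup>2)"
    and i5: "integrable (M \<Otimes>\<^sub>M N) (\<lambda>p. (g (snd p))\<^sup>2)"
    and i6: "integrable (M \<Otimes>\<^sub>M N) (\<lambda>p. f (fst p))"
    and i7: "integrable (M \<Otimes>\<^sub>M N) (\<lambda>p. g (snd p))"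
    by (intro int b; measurable)+
  note fub = P.integral_fst'[symmetric]
  have e0: "integral\<^sup>L (M \<Otimes>\<^sub>M N) u = m"
    by (subst fub[OF iu]) (simp add: m_def f_def)
  have gm: "integral\<^sup>L N g = m"
    unfolding g_def using P.integral_snd[of "\<lambda>x y. u (x, y)"] iu e0 by simp
  have e1: "integral\<^sup>L (M \<Otimes>\<^sub>M N) (\<lambda>p. u p * f (fst p)) = (LINT x|M. (f x)\<^sup>2)"
    by (subst fub[OF i1]) (simp add: f_def power2_eq_square)
  have e2: "integral\<^sup>L (M \<Otimes>\<^sub>M N) (\<lambda>p. u p * g (snd p)) = (LINT y|N. (g y)\<^sup>2)"
    using P.integral_snd[of "\<lambda>x y. u (x, y) * g y"] i2
    by (simp add: g_def power2_eq_square case_prod_unfold)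
  have e3: "integral\<^sup>L (M \<Otimes>\<^sub>M N) (\<lambda>p. f (fst p) * g (snd p)) = m\<^sup>2"
    by (subst fub[OF i3]) (simp add: gm m_def power2_eq_square)
  have e4: "integral\<^sup>L (M \<Otimes>\<^sub>M N) (\<lambda>p. (f (fst p))\<^sup>2) = (LINT x|M. (f x)\<^sup>2)"
    by (subst fub[OF i4]) (simp add: N.prob_space)
  have e5: "integral\<^sup>L (M \<Otimes>\<^sub>M N) (\<lambda>p. (g (snd p))\<^sup>2) = (LINT y|N. (g y)\<^sup>2)"
    by (subst fub[OF i5]) (simp add: M.prob_space)
  have e6: "integral\<^sup>L (M \<Otimes>\<^sub>M N) (\<lambda>p. f (fst p)) = m"
    by (subst fub[OF i6]) (simp add: m_def N.prob_space)
  have e7: "integral\<^sup>L (M \<Otimes>\<^sub>M N) (\<lambda>p. g (snd p)) = m"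
    by (subst fub[OF i7]) (simp add: gm M.prob_space)
  define S where "S = integral\<^sup>L (M \<Otimes>\<^sub>M N) (\<lambda>p. (u p)\<^sup>2)"
  have S1: "(LINT x|M. LINT y|N. (u (x, y))\<^sup>2) = S"
    unfolding S_def by (subst fub[OF iu2]) simp
  have S2: "(LINT y|N. LINT x|M. (u (x, y))\<^sup>2) = S"
    unfolding S_def using P.integral_snd[of "\<lambda>x y. (u (x, y))\<^sup>2"] iu2 by (simp add: case_prod_unfold)
  have "0 \<le> integral\<^sup>L (M \<Otimes>\<^sub>M N) (\<lambda>p. (u p - f (fst p) - g (snd p) + m)\<^sup>2)"
    by simp
  also have "(\<lambda>p. (u p - f (fst p) - g (snd p) + m)\<^sup>2) = (\<lambda>p. (u p)\<^sup>2 + (f (fst p))\<^sup>2 + (g (snd p))\<^sup>2 + m\<^sup>2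
      - 2 * (u p * f (fst p)) - 2 * (u p * g (snd p)) + 2 * (f (fst p) * g (snd p))
      + 2 * m * u p - 2 * m * f (fst p) - 2 * m * g (snd p))"
    by (simp add: power2_eq_square algebra_simps)
  also have "integral\<^sup>L (M \<Otimes>\<^sub>M N) \<dots> = S - (LINT x|M. (f x)\<^sup>2) - (LINT y|N. (g y)\<^sup>2) + m\<^sup>2"
    using iu iu2 i1 i2 i3 i4 i5 i6 i7
    by (simp add: e0 e1 e2 e3 e4 e5 e6 e7 S_def[symmetric] P.prob_space flip: power2_eq_square)
  finally have main: "(LINT x|M. (f x)\<^sup>2) + (LINT y|N. (g y)\<^sup>2) \<le> S + m\<^sup>2" by simp
  have j1: "integrable M (\<lambda>x. LINT y|N. (u (x, y))\<^sup>2)" and j2: "integrable N (\<lambda>y. LINT x|M. (u (x, y))\<^sup>2)"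
    by (intro int b; measurable)+
  show ?thesis
    unfolding f_def[symmetric] g_def[symmetric] S1
    using main by (simp add: Bochner_Integration.integral_diff[OF j1 if2]
        Bochner_Integration.integral_diff[OF j2 ig2] S1 S2 flip: m_def)
qed

text \<open>
  Here \<open>A y\<close> stands for the mean of the boundary values of \<open>u\<close> on the line \<open>y\<close>, and \<open>D\<close> for the energy
  density. Integrating the hypothesis on lines over \<open>N\<close>, Jensen's inequality moves the integral of
  \<open>A\<close> inside the square, and the variance along \<open>N\<close> stays on the right-hand side. There the
  lemma can be applied again.
\<close>

lemma variance_pair_trace_le:
  fixes u D :: "'a \<times> 'b \<Rightarrow> real"
  assumes M: "prob_space M" and N: "prob_space N"
    and u[measurable]: "u \<in> borel_measurable (M \<Otimes>\<^sub>M N)" and bu: "bdd_fun u"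
    and D[measurable]: "D \<in> borel_measurable (M \<Otimes>\<^sub>M N)" and bD: "bdd_fun D"
    and A[measurable]: "A \<in> borel_measurable N" and bA: "bdd_fun A"
    and line: "\<And>y. (LINT x|M. (u (x, y))\<^sup>2) - (LINT x|M. u (x, y))\<^sup>2
        + ((LINT x|M. u (x, y)) - A y)\<^sup>2 \<le> (LINT x|M. D (x, y))"
  shows "(LINT x|M. LINT y|N. (u (x, y))\<^sup>2) - (LINT x|M. LINT y|N. u (x, y))\<^sup>2
      + ((LINT x|M. LINT y|N. u (x, y)) - (LINT y|N. A y))\<^sup>2
    \<le> (LINT x|M. LINT y|N. D (x, y))
      + (LINT x|M. (LINT y|N. (u (x, y))\<^sup>2) - (LINT y|N. u (x, y))\<^sup>2)"
proof -
  interpret M: prob_space M by fact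
  interpret N: prob_space N by fact
  interpret P: pair_prob_space M N ..
  have P: "prob_space (M \<Otimes>\<^sub>M N)" by (rule P.prob_space_axioms)
  note [intro] = integrable_bdd_fun[OF M] integrable_bdd_fun[OF N] integrable_bdd_fun[OF P]
  note bi = bdd_fun_intros M N
  define g where "g y = (LINT x|M. u (x, y))" for y
  have g[measurable]: "g \<in> borel_measurable N" unfolding g_def by measurable
  have bg: "bdd_fun g" unfolding g_def by (intro bi M N bdd_fun_comp[OF bu])
  define s where "s y = (LINT x|M. (u (x, y))\<^sup>2)" for y
  have s[measurable]: "s \<in> borel_measurable N" unfolding s_def by measurable
  have bs: "bdd_fun s" unfolding s_def by (intro bi M N bdd_fun_comp[OF bu])
  have gm: "(LINT y|N. g y) = (LINT x|M. LINT y|N. u (x, y))"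
    unfolding g_def by (rule P.Fubini_integral) (auto simp: case_prod_unfold intro: bu)
  have Dm: "(LINT y|N. LINT x|M. D (x, y)) = (LINT x|M. LINT y|N. D (x, y))"
    by (rule P.Fubini_integral) (auto simp: case_prod_unfold intro: bD)
  have "((LINT y|N. g y) - (LINT y|N. A y))\<^sup>2 = (LINT y|N. g y - A y)\<^sup>2"
    by (subst Bochner_Integration.integral_diff) (auto intro: bg bA)
  also have "\<dots> \<le> (LINT y|N. (g y - A y)\<^sup>2)"
    by (rule N.square_expectation_le) (auto intro!: bi bg bA)
  finally have 1: "((LINT y|N. g y) - (LINT y|N. A y))\<^sup>2 \<le> (LINT y|N. (g y - A y)\<^sup>2)" .
  have "(LINT y|N. s y - (g y)\<^sup>2) + (LINT y|N. (g y - A y)\<^sup>2) = (LINT y|N. s y - (g y)\<^sup>2 + (g y - A y)\<^sup>2)"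
    by (subst Bochner_Integration.integral_add) (auto intro!: bi bg bA bs)
  also have "\<dots> \<le> (LINT y|N. LINT x|M. D (x, y))"
    by (rule integral_mono)
       (auto intro!: bi bg bA bs M bdd_fun_comp[OF bD] line[folded g_def s_def])
  finally have 2: "(LINT y|N. s y - (g y)\<^sup>2) + (LINT y|N. (g y - A y)\<^sup>2)
      \<le> (LINT x|M. LINT y|N. D (x, y))"
    by (simp add: Dm)
  show ?thesis
    using variance_pair_le[OF M N u bu, folded g_def s_def] 1 2 unfolding gm by simp
qed

text \<open>
  Iteration of the previous lemma over three factors: the variance over \<open>M2 \<Otimes> M3\<close> that the first
  step leaves is treated for each fixed \<open>x\<close>, and Jensen's inequality in \<open>x\<close> turns the boundary
  terms of the slices into those of \<open>u\<close>.
\<close>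

lemma variance_triple_trace_le:
  fixes u D1 D2 D3 :: "'a \<times> 'b \<times> 'c \<Rightarrow> real"
  assumes M1: "prob_space M1" and M2: "prob_space M2" and M3: "prob_space M3"
    and u[measurable]: "u \<in> borel_measurable (M1 \<Otimes>\<^sub>M M2 \<Otimes>\<^sub>M M3)" and bu: "bdd_fun u"
    and D[measurable]: "D1 \<in> borel_measurable (M1 \<Otimes>\<^sub>M M2 \<Otimes>\<^sub>M M3)"
      "D2 \<in> borel_measurable (M1 \<Otimes>\<^sub>M M2 \<Otimes>\<^sub>M M3)" "D3 \<in> borel_measurable (M1 \<Otimes>\<^sub>M M2 \<Otimes>\<^sub>M M3)"
    and bD: "bdd_fun D1" "bdd_fun D2" "bdd_fun D3"
    and A[measurable]: "A1 \<in> borel_measurable (M2 \<Otimes>\<^sub>M M3)" "A2 \<in> borel_measurable (M1 \<Otimes>\<^sub>M M3)"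
      "A3 \<in> borel_measurable (M1 \<Otimes>\<^sub>M M2)"
    and bA: "bdd_fun A1" "bdd_fun A2" "bdd_fun A3"
    and line1: "\<And>y z. (LINT x|M1. (u (x, y, z))\<^sup>2) - (LINT x|M1. u (x, y, z))\<^sup>2
        + ((LINT x|M1. u (x, y, z)) - A1 (y, z))\<^sup>2 \<le> (LINT x|M1. D1 (x, y, z))"
    and line2: "\<And>x z. (LINT y|M2. (u (x, y, z))\<^sup>2) - (LINT y|M2. u (x, y, z))\<^sup>2
        + ((LINT y|M2. u (x, y, z)) - A2 (x, z))\<^sup>2 \<le> (LINT y|M2. D2 (x, y, z))"
    and line3: "\<And>x y. (LINT z|M3. (u (x, y, z))\<^sup>2) - (LINT z|M3. u (x, y, z))\<^sup>2
        + ((LINT z|M3. u (x, y, z)) - A3 (x, y))\<^sup>2 \<le> (LINT z|M3. D3 (x, y, z))"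
  defines "E \<equiv> \<lambda>f. LINT x|M1. LINT y|M2. LINT z|M3. f (x, y, z)"
  shows "E (\<lambda>p. (u p)\<^sup>2) - (E u)\<^sup>2 + (E u - (LINT y|M2. LINT z|M3. A1 (y, z)))\<^sup>2
      + (E u - (LINT x|M1. LINT z|M3. A2 (x, z)))\<^sup>2 + (E u - (LINT x|M1. LINT y|M2. A3 (x, y)))\<^sup>2
    \<le> E D1 + E D2 + E D3"
proof -
  interpret M1: prob_space M1 by fact
  interpret M2: prob_space M2 by fact
  interpret M3: prob_space M3 by fact
  interpret P: pair_prob_space M2 M3 ..
  have P: "prob_space (M2 \<Otimes>\<^sub>M M3)" by (rule P.prob_space_axioms)
  note [intro] = integrable_bdd_fun[OF M1] integrable_bdd_fun[OF M2] integrable_bdd_fun[OF M3] integrable_bdd_fun[OF P]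
  note bi = bdd_fun_intros M1 M2 M3 P
  note cs = bdd_fun_comp[OF bu] bdd_fun_comp[OF bD(1)] bdd_fun_comp[OF bD(2)] bdd_fun_comp[OF bD(3)]
     bdd_fun_comp[OF bA(1)] bdd_fun_comp[OF bA(2)] bdd_fun_comp[OF bA(3)]
  have fub: "(LINT q|(M2 \<Otimes>\<^sub>M M3). f q) = (LINT y|M2. LINT z|M3. f (y, z))"
    if "f \<in> borel_measurable (M2 \<Otimes>\<^sub>M M3)" "bdd_fun f" for f :: "'b \<times> 'c \<Rightarrow> real"
    using that by (intro P.integral_fst'[symmetric]) auto
  have fubx: "(LINT q|(M2 \<Otimes>\<^sub>M M3). f (x, q)) = (LINT y|M2. LINT z|M3. f (x, y, z))"
    if [measurable]: "f \<in> borel_measurable (M1 \<Otimes>\<^sub>M M2 \<Otimes>\<^sub>M M3)" and "bdd_fun f" "x \<in> space M1"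
    for f :: "'a \<times> 'b \<times> 'c \<Rightarrow> real" and x
    using fub[of "\<lambda>q. f (x, q)", OF _ bdd_fun_comp[OF that(2)]] that(3) by simp
  have fubE: "(LINT x|M1. LINT q|(M2 \<Otimes>\<^sub>M M3). f (x, q)) = E f"
    if "f \<in> borel_measurable (M1 \<Otimes>\<^sub>M M2 \<Otimes>\<^sub>M M3)" and "bdd_fun f" for f :: "'a \<times> 'b \<times> 'c \<Rightarrow> real"
    unfolding E_def by (intro Bochner_Integration.integral_cong refl fubx that)
  have u2: "(\<lambda>p. (u p)\<^sup>2) \<in> borel_measurable (M1 \<Otimes>\<^sub>M M2 \<Otimes>\<^sub>M M3)" by measurable
  have bu2: "bdd_fun (\<lambda>p. (u p)\<^sup>2)" by (intro bi bu)
  have line1': "(LINT x|M1. (u (x, q))\<^sup>2) - (LINT x|M1. u (x, q))\<^sup>2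
      + ((LINT x|M1. u (x, q)) - A1 q)\<^sup>2 \<le> (LINT x|M1. D1 (x, q))" for q
    by (cases q) (simp only: line1)
  have 1: "E (\<lambda>p. (u p)\<^sup>2) - (E u)\<^sup>2 + (E u - (LINT y|M2. LINT z|M3. A1 (y, z)))\<^sup>2
    \<le> E D1 + (LINT x|M1. (LINT q|(M2 \<Otimes>\<^sub>M M3). (u (x, q))\<^sup>2) - (LINT q|(M2 \<Otimes>\<^sub>M M3). u (x, q))\<^sup>2)"
    using variance_pair_trace_le[OF M1 P u bu D(1) bD(1) A(1) bA(1) line1']
    by (simp add: fubE[OF u bu] fubE[OF _ bu2] fubE[OF D(1) bD(1)] fub[OF A(1) bA(1)])
  define V where "V x = (LINT y|M2. LINT z|M3. (u (x, y, z))\<^sup>2) - (LINT y|M2. LINT z|M3. u (x, y, z))\<^sup>2" for x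
  define W where "W x y = (LINT z|M3. (u (x, y, z))\<^sup>2) - (LINT z|M3. u (x, y, z))\<^sup>2" for x y
  have V: "(LINT x|M1. (LINT q|(M2 \<Otimes>\<^sub>M M3). (u (x, q))\<^sup>2) - (LINT q|(M2 \<Otimes>\<^sub>M M3). u (x, q))\<^sup>2) = (LINT x|M1. V x)"
    unfolding V_def by (intro Bochner_Integration.integral_cong refl) (simp add: fubx[OF u bu] fubx[OF u2 bu2])
  define m2 where "m2 x = (LINT y|M2. LINT z|M3. u (x, y, z))" for x
  define a2 where "a2 x = (LINT z|M3. A2 (x, z))" for x
  define m3 where "m3 x y = (LINT z|M3. u (x, y, z))" for x y
  have [measurable]: "V \<in> borel_measurable M1" "m2 \<in> borel_measurable M1" "a2 \<in> borel_measurable M1"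
    "(\<lambda>(x, y). W x y) \<in> borel_measurable (M1 \<Otimes>\<^sub>M M2)" "(\<lambda>(x, y). m3 x y) \<in> borel_measurable (M1 \<Otimes>\<^sub>M M2)"
    unfolding V_def m2_def a2_def W_def m3_def by measurable
  have b: "bdd_fun V" "bdd_fun m2" "bdd_fun a2" "bdd_fun (\<lambda>p. W (fst p) (snd p))" "bdd_fun (\<lambda>p. m3 (fst p) (snd p))"
    unfolding V_def m2_def a2_def W_def m3_def by (intro bi cs)+
  note cs = cs bdd_fun_comp[OF b(4)]
  have 2: "V x + (m2 x - a2 x)\<^sup>2 \<le> (LINT y|M2. LINT z|M3. D2 (x, y, z)) + (LINT y|M2. W x y)"
    if [measurable]: "x \<in> space M1" for x
    unfolding V_def m2_def a2_def W_def
    by (rule variance_pair_trace_le[OF M2 M3, where u = "\<lambda>q. u (x, q)" and D = "\<lambda>q. D2 (x, q)"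
          and A = "\<lambda>z. A2 (x, z)", simplified])
       (auto intro!: cs line2 that)
  have 3: "W x y + (m3 x y - A3 (x, y))\<^sup>2 \<le> (LINT z|M3. D3 (x, y, z))" for x y
    unfolding W_def m3_def by (rule line3)
  define d2 where "d2 x = (LINT y|M2. LINT z|M3. D2 (x, y, z))" for x
  define d3 where "d3 x y = (LINT z|M3. D3 (x, y, z))" for x y
  define w where "w x = (LINT y|M2. W x y)" for x
  define e where "e x y = m3 x y - A3 (x, y)" for x y
  have [measurable]: "d2 \<in> borel_measurable M1" "(\<lambda>(x, y). d3 x y) \<in> borel_measurable (M1 \<Otimes>\<^sub>M M2)"
    "w \<in> borel_measurable M1" "(\<lambda>(x, y). e x y) \<in> borel_measurable (M1 \<Otimes>\<^sub>M M2)"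
    unfolding d2_def d3_def w_def e_def by measurable
  have b': "bdd_fun d2" "bdd_fun (\<lambda>p. d3 (fst p) (snd p))" "bdd_fun w" "bdd_fun (\<lambda>p. e (fst p) (snd p))"
    unfolding d2_def d3_def w_def e_def by (intro bi cs b)+
  have bx: "bdd_fun (W x)" "bdd_fun (d3 x)" "bdd_fun (e x)" for x
    using bdd_fun_comp[OF b(4), of "\<lambda>y. (x, y)"] bdd_fun_comp[OF b'(2), of "\<lambda>y. (x, y)"]
      bdd_fun_comp[OF b'(4), of "\<lambda>y. (x, y)"] by simp_all
  have "(LINT x|M1. V x) + (LINT x|M1. (m2 x - a2 x)\<^sup>2) = (LINT x|M1. V x + (m2 x - a2 x)\<^sup>2)"
    by (subst Bochner_Integration.integral_add) (auto intro!: bi b)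
  also have "\<dots> \<le> (LINT x|M1. d2 x + w x)"
    by (rule integral_mono) (auto intro!: bi b b' 2[folded d2_def w_def])
  also have "\<dots> = E D2 + (LINT x|M1. w x)"
    by (subst Bochner_Integration.integral_add) (auto intro!: bi b' simp: E_def simp flip: d2_def)
  finally have 4: "(LINT x|M1. V x) + (LINT x|M1. (m2 x - a2 x)\<^sup>2) \<le> E D2 + (LINT x|M1. w x)" .
  have "(E u - (LINT x|M1. LINT z|M3. A2 (x, z)))\<^sup>2 = (LINT x|M1. m2 x - a2 x)\<^sup>2"
    by (subst Bochner_Integration.integral_diff) (auto intro!: bi b simp: E_def simp flip: m2_def a2_def)
  also have "\<dots> \<le> (LINT x|M1. (m2 x - a2 x)\<^sup>2)"
    by (rule M1.square_expectation_le) (auto intro!: bi b)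
  finally have 5: "(E u - (LINT x|M1. LINT z|M3. A2 (x, z)))\<^sup>2 \<le> (LINT x|M1. (m2 x - a2 x)\<^sup>2)" .
  have me: "(LINT y|M2. e x y) = m2 x - (LINT y|M2. A3 (x, y))" if "x \<in> space M1" for x
    unfolding e_def using that
    by (subst Bochner_Integration.integral_diff)
       (auto intro!: bdd_fun_comp[OF bA(3)] bdd_fun_comp[OF b(5), of "\<lambda>y. (x, y)", simplified] simp: m2_def simp flip: m3_def)
  have "(E u - (LINT x|M1. LINT y|M2. A3 (x, y)))\<^sup>2 = (LINT x|M1. m2 x - (LINT y|M2. A3 (x, y)))\<^sup>2"
    by (subst Bochner_Integration.integral_diff) (auto intro!: bi b cs simp: E_def simp flip: m2_def)
  also have "\<dots> = (LINT x|M1. LINT y|M2. e x y)\<^sup>2"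
    by (intro arg_cong[where f = "\<lambda>t. t\<^sup>2"] Bochner_Integration.integral_cong refl me[symmetric])
  also have "\<dots> \<le> (LINT x|M1. (LINT y|M2. e x y)\<^sup>2)"
    by (rule M1.square_expectation_le) (auto intro!: bi b')
  also have "\<dots> \<le> (LINT x|M1. LINT y|M2. (e x y)\<^sup>2)"
    by (rule integral_mono) (auto intro!: bi b' bx M2.square_expectation_le)
  finally have 6: "(E u - (LINT x|M1. LINT y|M2. A3 (x, y)))\<^sup>2 \<le> (LINT x|M1. LINT y|M2. (e x y)\<^sup>2)" .
  have "(LINT x|M1. w x) + (LINT x|M1. LINT y|M2. (e x y)\<^sup>2) = (LINT x|M1. w x + (LINT y|M2. (e x y)\<^sup>2))"
    by (subst Bochner_Integration.integral_add) (auto intro!: bi b')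
  also have "\<dots> = (LINT x|M1. LINT y|M2. W x y + (e x y)\<^sup>2)"
    unfolding w_def by (intro Bochner_Integration.integral_cong refl Bochner_Integration.integral_add[symmetric])
      (auto intro!: bi bx)
  also have "\<dots> \<le> (LINT x|M1. LINT y|M2. d3 x y)"
    by (intro integral_mono) (auto intro!: bi b b' bx 3[folded d3_def e_def])
  finally have 7: "(LINT x|M1. w x) + (LINT x|M1. LINT y|M2. (e x y)\<^sup>2) \<le> E D3"
    by (simp add: E_def flip: d3_def)
  show ?thesis using 1[unfolded V] 4 5 6 7 by linarith
qed

section \<open>Averages over a box\<close>

definition unif :: "real \<Rightarrow> real measure" where
  "unif a = uniform_measure lborel {-a..a}"

lemma sets_unif [simp, measurable_cong]: "sets (unif a) = sets borel"
  by (simp add: unif_def)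

lemma space_unif [simp]: "space (unif a) = UNIV"
  by (simp add: unif_def)

lemma prob_space_unif: "a > 0 \<Longrightarrow> prob_space (unif a)"
  unfolding unif_def by (intro prob_space_uniform_measure) auto

lemma measure_unif: "a > 0 \<Longrightarrow> measure (unif a) UNIV = 1"
  using prob_space.prob_space[OF prob_space_unif] by simp

lemma AE_unif: "AE x in unif a. x \<in> {-a..a}"
  unfolding unif_def by (intro AE_uniform_measureI) auto

lemma unif_altdef:
  assumes "a > 0"
  shows "unif a = density lborel (\<lambda>x. ennreal (indicator {-a..a} x / (2 * a)))"
  unfolding unif_def uniform_measure_def using assms
  by (intro density_cong) (auto simp: divide_ennreal indicator_def simp flip: ennreal_1)

lemma integral_unif:
  assumes "a > 0" and [measurable]: "f \<in> borel_measurable borel"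
  shows "(LINT x|unif a. f x) = (LINT x:{-a..a}|lborel. f x) / (2 * a)"
proof -
  have "(LINT x|unif a. f x) = (LINT x|lborel. (indicator {-a..a} x / (2 * a)) *\<^sub>R f x)"
    unfolding unif_altdef[OF assms(1)] using assms(1) by (intro integral_density) auto
  also have "\<dots> = (LINT x|lborel. (indicator {-a..a} x *\<^sub>R f x) / (2 * a))"
    by simp
  finally show ?thesis by (simp add: set_lebesgue_integral_def)
qed

lemma integral_unif_continuous:
  assumes "a > 0" and f: "continuous_on UNIV f"
  shows "(LINT x|unif a. f x) = integral {-a..a} f / (2 * a)"
proof -
  have "set_integrable lborel {-a..a} f"
    by (intro borel_integrable_atLeastAtMost' continuous_on_subset[OF f]) auto
  then show ?thesis
    using assms by (simp add: integral_unif borel_measurable_continuous_onI set_borel_integral_eq_integral)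
qed

lemma integrable_unif_continuous:
  assumes "a > 0" and f: "continuous_on UNIV (f :: real \<Rightarrow> real)"
  shows "integrable (unif a) f"
proof -
  interpret prob_space "unif a" by (rule prob_space_unif[OF assms(1)])
  have [measurable]: "f \<in> borel_measurable borel"
    using f by (rule borel_measurable_continuous_onI)
  have "compact (f ` {-a..a})"
    by (intro compact_continuous_image continuous_on_subset[OF f]) auto
  then obtain B where "\<And>x. x \<in> {-a..a} \<Longrightarrow> norm (f x) \<le> B"
    by (meson bounded_iff compact_imp_bounded image_eqI)
  then show ?thesis
    by (intro integrable_const_bound[of _ B] AE_mp[OF AE_unif AE_I2]) auto
qed

text \<open>
  The inequality for antiperiodic functions, applied to \<open>F\<close> minus the mean \<open>A\<close> of its end values, in
  terms of the average \<open>e\<close> of \<open>F\<close>: the average of \<open>(F - A)\<^sup>2\<close> is the variance of \<open>F\<close> plus \<open>(e - A)\<^sup>2\<close>.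
\<close>

lemma line_inequality:
  fixes F F' :: "real \<Rightarrow> real"
  assumes "0 < a"
    and F: "\<And>x. (F has_real_derivative F' x) (at x)" and F': "continuous_on UNIV F'"
  shows "(LINT x|unif a. (F x)\<^sup>2) - (LINT x|unif a. F x)\<^sup>2
      + ((LINT x|unif a. F x) - (F a + F (- a)) / 2)\<^sup>2
    \<le> (LINT x|unif a. (2 * a / pi)\<^sup>2 * (F' x)\<^sup>2)"
proof -
  interpret prob_space "unif a" by (rule prob_space_unif[OF assms(1)])
  define A where "A = (F a + F (- a)) / 2"
  have cF: "continuous_on UNIV F"
    by (meson F DERIV_isCont continuous_at_imp_continuous_on)
  have "integral {-a..a} (\<lambda>x. (F x - A)\<^sup>2) \<le> (2 * a / pi)\<^sup>2 * integral {-a..a} (\<lambda>x. (F' x)\<^sup>2)"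
    by (rule wirtinger_antiperiodic[OF \<open>0 < a\<close> _ F'])
       (auto simp: A_def field_simps intro!: derivative_eq_intros F)
  then have "integral {-a..a} (\<lambda>x. (F x - A)\<^sup>2) / (2 * a)
      \<le> (2 * a / pi)\<^sup>2 * integral {-a..a} (\<lambda>x. (F' x)\<^sup>2) / (2 * a)"
    using \<open>0 < a\<close> by (intro divide_right_mono) auto
  moreover have "(LINT x|unif a. (F x - A)\<^sup>2) = integral {-a..a} (\<lambda>x. (F x - A)\<^sup>2) / (2 * a)"
    by (intro integral_unif_continuous continuous_intros cF \<open>0 < a\<close>)
  moreover have "(LINT x|unif a. (F' x)\<^sup>2) = integral {-a..a} (\<lambda>x. (F' x)\<^sup>2) / (2 * a)"
    by (intro integral_unif_continuous continuous_intros F' \<open>0 < a\<close>)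
  ultimately have "(LINT x|unif a. (F x - A)\<^sup>2) \<le> (LINT x|unif a. (2 * a / pi)\<^sup>2 * (F' x)\<^sup>2)"
    by simp
  moreover have "(LINT x|unif a. (F x - A)\<^sup>2) = (LINT x|unif a. (F x)\<^sup>2 - 2 * A * F x + A\<^sup>2)"
    by (simp add: power2_eq_square algebra_simps)
  moreover have "\<dots> = (LINT x|unif a. (F x)\<^sup>2) - 2 * A * (LINT x|unif a. F x) + A\<^sup>2"
    using \<open>0 < a\<close> cF
    by (simp add: integrable_unif_continuous continuous_intros prob_space[simplified])
  ultimately show ?thesis
    unfolding A_def[symmetric] by (simp add: power2_eq_square algebra_simps)
qed

type_synonym R3 = "real \<times> real \<times> real"

abbreviation box3 :: "real \<Rightarrow> real \<Rightarrow> real \<Rightarrow> R3 set" where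
  "box3 a b c \<equiv> {-a<..<a} \<times> {-b<..<b} \<times> {-c<..<c}"

abbreviation cbox3 :: "real \<Rightarrow> real \<Rightarrow> real \<Rightarrow> R3 set" where
  "cbox3 a b c \<equiv> {-a..a} \<times> {-b..b} \<times> {-c..c}"

text \<open>
  Clamping to the box turns a continuous function into one that is bounded everywhere and has the
  same averages over the box.
\<close>

definition clamp1 :: "real \<Rightarrow> real \<Rightarrow> real" where
  "clamp1 a x = max (- a) (min a x)"

lemma clamp1_id: "x \<in> {-a..a} \<Longrightarrow> clamp1 a x = x"
  by (auto simp: clamp1_def)

lemma clamp1_in: "a > 0 \<Longrightarrow> clamp1 a x \<in> {-a..a}"
  by (auto simp: clamp1_def)

lemma continuous_on_clamp1 [continuous_intros]:
  "continuous_on S f \<Longrightarrow> continuous_on S (\<lambda>x. clamp1 a (f x))"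
  unfolding clamp1_def by (intro continuous_intros)

lemma integral_unif_clamp:
  assumes "f \<in> borel_measurable borel"
  shows "(LINT x|unif a. f (clamp1 a x)) = (LINT x|unif a. (f x :: real))"
proof (rule Bochner_Integration.integral_cong_AE)
  have [measurable]: "clamp1 a \<in> borel_measurable borel"
    by (intro borel_measurable_continuous_onI continuous_intros continuous_on_id)
  show "(\<lambda>x. f (clamp1 a x)) \<in> borel_measurable (unif a)" "f \<in> borel_measurable (unif a)"
    using assms by measurable
  show "AE x in unif a. f (clamp1 a x) = f x"
    using AE_unif[of a] by eventually_elim (simp add: clamp1_id)
qed

definition clamp3 :: "real \<Rightarrow> real \<Rightarrow> real \<Rightarrow> R3 \<Rightarrow> R3" where
  "clamp3 a b c = (\<lambda>(x, y, z). (clamp1 a x, clamp1 b y, clamp1 c z))"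

definition avg3 :: "real \<Rightarrow> real \<Rightarrow> real \<Rightarrow> (R3 \<Rightarrow> real) \<Rightarrow> real" where
  "avg3 a b c f = (LINT x|unif a. LINT y|unif b. LINT z|unif c. f (x, y, z))"

definition avg2 :: "real \<Rightarrow> real \<Rightarrow> (real \<times> real \<Rightarrow> real) \<Rightarrow> real" where
  "avg2 a b f = (LINT x|unif a. LINT y|unif b. f (x, y))"

lemma pair_unif:
  assumes "a > 0" "b > 0"
  shows "unif a \<Otimes>\<^sub>M unif b
    = density lborel (\<lambda>q. ennreal (indicator ({-a..a} \<times> {-b..b}) q / (4 * a * b)))"
proof -
  interpret B: prob_space "unif b" by (rule prob_space_unif[OF assms(2)])
  have "unif a \<Otimes>\<^sub>M unif b = density (lborel \<Otimes>\<^sub>M lborel)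
      (\<lambda>(x, y). ennreal (indicator {-a..a} x / (2 * a)) * ennreal (indicator {-b..b} y / (2 * b)))"
    unfolding unif_altdef[OF assms(1)] unif_altdef[OF assms(2)]
    by (rule pair_measure_density) (use B.sigma_finite_measure_axioms in
        \<open>auto simp: unif_altdef[OF assms(2)] lborel.sigma_finite_measure_axioms\<close>)
  also have "\<dots> = density lborel (\<lambda>q. ennreal (indicator ({-a..a} \<times> {-b..b}) q / (4 * a * b)))"
    unfolding lborel_prod using assms
    by (intro arg_cong[where f = "density lborel"] ext) (auto simp: indicator_def ennreal_mult[symmetric] split: prod.splits)
  finally show ?thesis .
qed

lemma triple_unif:
  assumes "a > 0" "b > 0" "c > 0"
  shows "unif a \<Otimes>\<^sub>M unif b \<Otimes>\<^sub>M unif c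
    = density lborel (\<lambda>q. ennreal (indicator (cbox3 a b c) q / (8 * a * b * c)))"
proof -
  interpret B: prob_space "unif b" by (rule prob_space_unif[OF assms(2)])
  interpret C: prob_space "unif c" by (rule prob_space_unif[OF assms(3)])
  interpret BC: pair_prob_space "unif b" "unif c" ..
  have [measurable]: "{-b..b} \<times> {-c..c} \<in> sets borel" by (intro borel_closed closed_Times) auto
  have "unif a \<Otimes>\<^sub>M unif b \<Otimes>\<^sub>M unif c = density (lborel \<Otimes>\<^sub>M lborel)
      (\<lambda>(x, y). ennreal (indicator {-a..a} x / (2 * a)) * ennreal (indicator ({-b..b} \<times> {-c..c}) y / (4 * b * c)))"
    unfolding unif_altdef[OF assms(1)] pair_unif[OF assms(2,3)]
    by (rule pair_measure_density) (use BC.sigma_finite_measure_axioms in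
        \<open>auto simp: pair_unif[OF assms(2,3)] lborel.sigma_finite_measure_axioms\<close>)
  also have "\<dots> = density lborel (\<lambda>q. ennreal (indicator (cbox3 a b c) q / (8 * a * b * c)))"
    unfolding lborel_prod using assms
    by (intro arg_cong[where f = "density lborel"] ext) (auto simp: indicator_def ennreal_mult[symmetric] split: prod.splits)
  finally show ?thesis .
qed

lemma integrable_indicator_compact:
  fixes f :: "'a::euclidean_space \<Rightarrow> real"
  assumes "continuous_on UNIV f" "compact S"
  shows "integrable lborel (\<lambda>x. indicator S x * f x)"
  using borel_integrable_compact[OF assms(2), of f] continuous_on_subset[OF assms(1)]
  by (simp add: indicator_def of_bool_def if_distrib[of "\<lambda>t. t * _"] cong: if_cong)

lemma integrable_pair_unif:
  assumes pos: "a > 0" "b > 0" and f: "continuous_on UNIV f"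
  shows "integrable (unif a \<Otimes>\<^sub>M unif b) (f :: real \<times> real \<Rightarrow> real)"
proof -
  have S: "compact ({-a..a} \<times> {-b..b})" by (intro compact_Times) auto
  have [measurable]: "{-a..a} \<times> {-b..b} \<in> sets borel" using S by (intro borel_closed compact_imp_closed)
  have [measurable]: "f \<in> borel_measurable borel" using f by (rule borel_measurable_continuous_onI)
  show ?thesis
    unfolding pair_unif[OF pos] using pos integrable_indicator_compact[OF f S]
    by (subst integrable_density) (auto intro!: integrable_divide)
qed

lemma avg2_eq_lborel:
  assumes pos: "a > 0" "b > 0" and f: "continuous_on UNIV f"
  shows "4 * a * b * avg2 a b f = (LINT q|lborel. indicator ({-a..a} \<times> {-b..b}) q * f q)"
proof -
  interpret A: prob_space "unif a" by (rule prob_space_unif[OF pos(1)])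
  interpret B: prob_space "unif b" by (rule prob_space_unif[OF pos(2)])
  interpret AB: pair_prob_space "unif a" "unif b" ..
  let ?S = "{-a..a} \<times> {-b..b}"
  have [measurable]: "?S \<in> sets borel" by (intro borel_closed closed_Times) auto
  have [measurable]: "f \<in> borel_measurable borel" using f by (rule borel_measurable_continuous_onI)
  have "avg2 a b f = (LINT q|(unif a \<Otimes>\<^sub>M unif b). f q)"
    unfolding avg2_def by (rule AB.integral_fst'[OF integrable_pair_unif[OF pos f]])
  also have "\<dots> = (LINT q|lborel. indicator ?S q * f q / (4 * a * b))"
    unfolding pair_unif[OF pos] using pos by (subst integral_density) auto
  finally show ?thesis using pos by simp
qed

lemma avg3_eq_lborel:
  assumes pos: "a > 0" "b > 0" "c > 0" and f: "continuous_on UNIV f"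
  shows "8 * a * b * c * avg3 a b c f = (LINT q|lborel. indicator (cbox3 a b c) q * f q)"
proof -
  interpret A: prob_space "unif a" by (rule prob_space_unif[OF pos(1)])
  interpret B: prob_space "unif b" by (rule prob_space_unif[OF pos(2)])
  interpret C: prob_space "unif c" by (rule prob_space_unif[OF pos(3)])
  interpret BC: pair_prob_space "unif b" "unif c" ..
  interpret ABC: pair_prob_space "unif a" "unif b \<Otimes>\<^sub>M unif c" ..
  let ?S = "cbox3 a b c"
  have S: "compact ?S" by (intro compact_Times) auto
  have [measurable]: "?S \<in> sets borel" using S by (intro borel_closed compact_imp_closed)
  have [measurable]: "f \<in> borel_measurable borel" using f by (rule borel_measurable_continuous_onI)
  have int: "integrable (unif a \<Otimes>\<^sub>M unif b \<Otimes>\<^sub>M unif c) f"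
    unfolding triple_unif[OF pos] using pos integrable_indicator_compact[OF f S]
    by (subst integrable_density) (auto intro!: integrable_divide)
  have inner: "(LINT q|(unif b \<Otimes>\<^sub>M unif c). f (x, q)) = (LINT y|unif b. LINT z|unif c. f (x, y, z))" for x
  proof -
    have c: "continuous_on UNIV (\<lambda>q. f (x, q))"
      by (intro continuous_on_compose2[OF f] continuous_intros) auto
    from BC.integral_fst'[OF integrable_pair_unif[OF pos(2,3) c]] show ?thesis by simp
  qed
  have "avg3 a b c f = (LINT q|(unif a \<Otimes>\<^sub>M unif b \<Otimes>\<^sub>M unif c). f q)"
    unfolding avg3_def inner[symmetric] by (rule ABC.integral_fst'[OF int])
  also have "\<dots> = (LINT q|lborel. indicator ?S q * f q / (8 * a * b * c))"
    unfolding triple_unif[OF pos] using pos by (subst integral_density) auto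
  finally show ?thesis using pos by simp
qed

lemma avg2_cong:
  assumes pos: "a > 0" "b > 0" and f: "continuous_on UNIV f" and g: "continuous_on UNIV g"
    and eq: "\<And>x y. x \<in> {-a..a} \<Longrightarrow> y \<in> {-b..b} \<Longrightarrow> f (x, y) = g (x, y)"
  shows "avg2 a b f = avg2 a b g"
proof -
  have "4 * a * b * avg2 a b f = 4 * a * b * avg2 a b g"
    unfolding avg2_eq_lborel[OF pos f] avg2_eq_lborel[OF pos g]
    by (intro Bochner_Integration.integral_cong) (auto simp: indicator_def eq)
  then show ?thesis using pos by simp
qed

lemma avg3_cong:
  assumes pos: "a > 0" "b > 0" "c > 0" and f: "continuous_on UNIV f" and g: "continuous_on UNIV g"
    and eq: "\<And>x y z. x \<in> {-a..a} \<Longrightarrow> y \<in> {-b..b} \<Longrightarrow> z \<in> {-c..c} \<Longrightarrow> f (x, y, z) = g (x, y, z)"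
  shows "avg3 a b c f = avg3 a b c g"
proof -
  have "8 * a * b * c * avg3 a b c f = 8 * a * b * c * avg3 a b c g"
    unfolding avg3_eq_lborel[OF pos f] avg3_eq_lborel[OF pos g]
    by (intro Bochner_Integration.integral_cong) (auto simp: indicator_def eq)
  then show ?thesis using pos by simp
qed

lemma bdd_fun_clamp3:
  assumes "continuous_on UNIV (f :: R3 \<Rightarrow> real)" "a > 0" "b > 0" "c > 0"
  shows "bdd_fun (\<lambda>p. f (clamp3 a b c p))"
proof -
  have "compact (f ` (cbox3 a b c))"
    by (intro compact_continuous_image continuous_on_subset[OF assms(1)] compact_Times) auto
  then obtain B where "\<And>p. p \<in> cbox3 a b c \<Longrightarrow> norm (f p) \<le> B"
    by (meson bounded_iff compact_imp_bounded image_eqI)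
  moreover have "clamp3 a b c p \<in> cbox3 a b c" for p
    unfolding clamp3_def case_prod_unfold by (intro SigmaI clamp1_in assms)
  ultimately have "\<bar>f (clamp3 a b c p)\<bar> \<le> B" for p
    by (metis real_norm_def)
  then show ?thesis by (auto simp: bdd_fun_def)
qed

text \<open>
  The inequality on lines, in each of the three directions, supplies the hypotheses of the lemma on
  three factors. It is used for \<open>u\<close> composed with the clamping map, which fixes the closed box with its
  faces, so that neither the averages nor the boundary values change.
\<close>

theorem box_trace_inequality:
  fixes u ux uy uz :: "R3 \<Rightarrow> real"
  assumes pos: "0 < a" "0 < b" "0 < c"
    and dx: "\<And>x y z. ((\<lambda>x. u (x, y, z)) has_real_derivative ux (x, y, z)) (at x)"
    and dy: "\<And>x y z. ((\<lambda>y. u (x, y, z)) has_real_derivative uy (x, y, z)) (at y)"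
    and dz: "\<And>x y z. ((\<lambda>z. u (x, y, z)) has_real_derivative uz (x, y, z)) (at z)"
    and cont: "continuous_on UNIV u" "continuous_on UNIV ux" "continuous_on UNIV uy" "continuous_on UNIV uz"
  shows "avg3 a b c (\<lambda>p. (u p)\<^sup>2) - (avg3 a b c u)\<^sup>2
      + (avg3 a b c u - avg2 b c (\<lambda>(y, z). (u (a, y, z) + u (- a, y, z)) / 2))\<^sup>2
      + (avg3 a b c u - avg2 a c (\<lambda>(x, z). (u (x, b, z) + u (x, - b, z)) / 2))\<^sup>2
      + (avg3 a b c u - avg2 a b (\<lambda>(x, y). (u (x, y, c) + u (x, y, - c)) / 2))\<^sup>2
    \<le> avg3 a b c (\<lambda>p. (2 * a / pi)\<^sup>2 * (ux p)\<^sup>2) + avg3 a b c (\<lambda>p. (2 * b / pi)\<^sup>2 * (uy p)\<^sup>2)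
      + avg3 a b c (\<lambda>p. (2 * c / pi)\<^sup>2 * (uz p)\<^sup>2)"
proof -
  let ?cl = "clamp3 a b c"
  note ccont = continuous_on_compose2[OF cont(1)] continuous_on_compose2[OF cont(2)]
    continuous_on_compose2[OF cont(3)] continuous_on_compose2[OF cont(4)]
  have c_cl: "continuous_on UNIV ?cl"
    unfolding clamp3_def case_prod_unfold by (intro continuous_intros)
  have meas: "f \<in> borel_measurable (unif a \<Otimes>\<^sub>M unif b \<Otimes>\<^sub>M unif c)"
    if "continuous_on UNIV f" for f :: "R3 \<Rightarrow> real"
  proof -
    have "f \<in> borel_measurable (borel \<Otimes>\<^sub>M borel \<Otimes>\<^sub>M borel)"
      using that by (simp add: borel_prod borel_measurable_continuous_onI)
    then show ?thesis by measurable
  qed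
  have meas2: "f \<in> borel_measurable (unif r \<Otimes>\<^sub>M unif s)"
    if "continuous_on UNIV f" for f :: "real \<times> real \<Rightarrow> real" and r s
  proof -
    have "f \<in> borel_measurable (borel \<Otimes>\<^sub>M borel)"
      using that by (simp add: borel_prod borel_measurable_continuous_onI)
    then show ?thesis by measurable
  qed
  define v where "v p = u (?cl p)" for p
  define D1 where "D1 p = (2 * a / pi)\<^sup>2 * (ux (?cl p))\<^sup>2" for p
  define D2 where "D2 p = (2 * b / pi)\<^sup>2 * (uy (?cl p))\<^sup>2" for p
  define D3 where "D3 p = (2 * c / pi)\<^sup>2 * (uz (?cl p))\<^sup>2" for p
  define A1 where "A1 q = (v (a, q) + v (- a, q)) / 2" for q
  define A2 where "A2 q = (v (fst q, b, snd q) + v (fst q, - b, snd q)) / 2" for q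
  define A3 where "A3 q = (v (fst q, snd q, c) + v (fst q, snd q, - c)) / 2" for q
  have cv: "continuous_on UNIV v" and cD: "continuous_on UNIV D1" "continuous_on UNIV D2" "continuous_on UNIV D3"
    unfolding v_def D1_def D2_def D3_def by (intro continuous_intros ccont c_cl; simp)+
  have cA: "continuous_on UNIV A1" "continuous_on UNIV A2" "continuous_on UNIV A3"
    unfolding A1_def A2_def A3_def by (intro continuous_intros continuous_on_compose2[OF cv]; simp)+
  have bv: "bdd_fun v" and bD: "bdd_fun D1" "bdd_fun D2" "bdd_fun D3"
    unfolding v_def D1_def D2_def D3_def by (intro bdd_fun_intros bdd_fun_clamp3 cont pos)+
  have bA: "bdd_fun A1" "bdd_fun A2" "bdd_fun A3"
    unfolding A1_def A2_def A3_def divide_inverse by (intro bdd_fun_intros bdd_fun_comp[OF bv])+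
  have main: "avg3 a b c (\<lambda>p. (v p)\<^sup>2) - (avg3 a b c v)\<^sup>2
      + (avg3 a b c v - avg2 b c A1)\<^sup>2 + (avg3 a b c v - avg2 a c A2)\<^sup>2 + (avg3 a b c v - avg2 a b A3)\<^sup>2
    \<le> avg3 a b c D1 + avg3 a b c D2 + avg3 a b c D3"
    unfolding avg3_def avg2_def
  proof (rule variance_triple_trace_le[OF prob_space_unif prob_space_unif prob_space_unif meas[OF cv] bv
        meas[OF cD(1)] meas[OF cD(2)] meas[OF cD(3)] bD meas2[OF cA(1)] meas2[OF cA(2)] meas2[OF cA(3)] bA])
    fix x y z :: real
    let ?x = "clamp1 a x" and ?y = "clamp1 b y" and ?z = "clamp1 c z"
    have ends: "clamp1 a a = a" "clamp1 a (- a) = - a" "clamp1 b b = b" "clamp1 b (- b) = - b"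
      "clamp1 c c = c" "clamp1 c (- c) = - c"
      using pos by (auto simp: clamp1_def)
    have m: "f \<in> borel_measurable borel" if "continuous_on UNIV f" for f :: "real \<Rightarrow> real"
      using that by (rule borel_measurable_continuous_onI)
    have s: "(LINT x|unif a. v (x, y, z)) = (LINT x|unif a. u (x, ?y, ?z))"
      "(LINT x|unif a. (v (x, y, z))\<^sup>2) = (LINT x|unif a. (u (x, ?y, ?z))\<^sup>2)"
      "(LINT x|unif a. D1 (x, y, z)) = (LINT x|unif a. (2 * a / pi)\<^sup>2 * (ux (x, ?y, ?z))\<^sup>2)"
      "(LINT y|unif b. v (x, y, z)) = (LINT y|unif b. u (?x, y, ?z))"
      "(LINT y|unif b. (v (x, y, z))\<^sup>2) = (LINT y|unif b. (u (?x, y, ?z))\<^sup>2)"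
      "(LINT y|unif b. D2 (x, y, z)) = (LINT y|unif b. (2 * b / pi)\<^sup>2 * (uy (?x, y, ?z))\<^sup>2)"
      "(LINT z|unif c. v (x, y, z)) = (LINT z|unif c. u (?x, ?y, z))"
      "(LINT z|unif c. (v (x, y, z))\<^sup>2) = (LINT z|unif c. (u (?x, ?y, z))\<^sup>2)"
      "(LINT z|unif c. D3 (x, y, z)) = (LINT z|unif c. (2 * c / pi)\<^sup>2 * (uz (?x, ?y, z))\<^sup>2)"
      unfolding v_def D1_def D2_def D3_def clamp3_def split
      by (rule integral_unif_clamp, rule m, intro continuous_intros ccont; simp)+
    show "(LINT x|unif a. (v (x, y, z))\<^sup>2) - (LINT x|unif a. v (x, y, z))\<^sup>2
        + ((LINT x|unif a. v (x, y, z)) - A1 (y, z))\<^sup>2 \<le> (LINT x|unif a. D1 (x, y, z))"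
      unfolding s unfolding A1_def v_def clamp3_def split ends
      by (rule line_inequality[OF pos(1) dx]) (intro ccont continuous_intros; simp)
    show "(LINT y|unif b. (v (x, y, z))\<^sup>2) - (LINT y|unif b. v (x, y, z))\<^sup>2
        + ((LINT y|unif b. v (x, y, z)) - A2 (x, z))\<^sup>2 \<le> (LINT y|unif b. D2 (x, y, z))"
      unfolding s unfolding A2_def v_def clamp3_def split ends fst_conv snd_conv
      by (rule line_inequality[OF pos(2) dy]) (intro ccont continuous_intros; simp)
    show "(LINT z|unif c. (v (x, y, z))\<^sup>2) - (LINT z|unif c. v (x, y, z))\<^sup>2
        + ((LINT z|unif c. v (x, y, z)) - A3 (x, y))\<^sup>2 \<le> (LINT z|unif c. D3 (x, y, z))"
      unfolding s unfolding A3_def v_def clamp3_def split ends fst_conv snd_conv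
      by (rule line_inequality[OF pos(3) dz]) (intro ccont continuous_intros; simp)
  qed (use pos in auto)
  have cl: "?cl (x, y, z) = (x, y, z)" if "x \<in> {-a..a}" "y \<in> {-b..b}" "z \<in> {-c..c}" for x y z
    using that by (simp add: clamp3_def clamp1_id)
  have e3: "avg3 a b c (\<lambda>p. f (?cl p)) = avg3 a b c f" if "continuous_on UNIV f" for f
    by (rule avg3_cong) (use pos that cl in \<open>auto intro!: continuous_on_compose2[OF that c_cl]\<close>)
  have f3: "avg3 a b c (\<lambda>p. (v p)\<^sup>2) = avg3 a b c (\<lambda>p. (u p)\<^sup>2)" "avg3 a b c v = avg3 a b c u"
    "avg3 a b c D1 = avg3 a b c (\<lambda>p. (2 * a / pi)\<^sup>2 * (ux p)\<^sup>2)"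
    "avg3 a b c D2 = avg3 a b c (\<lambda>p. (2 * b / pi)\<^sup>2 * (uy p)\<^sup>2)"
    "avg3 a b c D3 = avg3 a b c (\<lambda>p. (2 * c / pi)\<^sup>2 * (uz p)\<^sup>2)"
    unfolding v_def[abs_def] D1_def[abs_def] D2_def[abs_def] D3_def[abs_def]
    by (rule e3, intro continuous_intros cont)+
  have f2: "avg2 b c A1 = avg2 b c (\<lambda>(y, z). (u (a, y, z) + u (- a, y, z)) / 2)"
    "avg2 a c A2 = avg2 a c (\<lambda>(x, z). (u (x, b, z) + u (x, - b, z)) / 2)"
    "avg2 a b A3 = avg2 a b (\<lambda>(x, y). (u (x, y, c) + u (x, y, - c)) / 2)"
    using pos
    by (intro avg2_cong cA;
        auto simp: case_prod_unfold A1_def A2_def A3_def v_def cl intro!: continuous_intros ccont)+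
  show ?thesis using main unfolding f3 f2 .
qed

lemma square_convex3:
  fixes t1 t2 t3 w1 w2 w3 :: real
  assumes "0 \<le> w1" "0 \<le> w2" "0 \<le> w3" "w1 + w2 + w3 = 1"
  shows "(w1 * t1 + w2 * t2 + w3 * t3)\<^sup>2 \<le> t1\<^sup>2 + t2\<^sup>2 + t3\<^sup>2"
proof -
  define m where "m = w1 * t1 + w2 * t2 + w3 * t3"
  have "0 \<le> w1 * (t1 - m)\<^sup>2 + w2 * (t2 - m)\<^sup>2 + w3 * (t3 - m)\<^sup>2"
    using assms by simp
  also have "\<dots> = w1 * t1\<^sup>2 + w2 * t2\<^sup>2 + w3 * t3\<^sup>2 - 2 * m * (w1 * t1 + w2 * t2 + w3 * t3) + (w1 + w2 + w3) * m\<^sup>2"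
    by (simp add: power2_eq_square algebra_simps)
  also have "\<dots> = w1 * t1\<^sup>2 + w2 * t2\<^sup>2 + w3 * t3\<^sup>2 - m\<^sup>2"
    unfolding assms(4) m_def[symmetric] by (simp add: power2_eq_square)
  also have "\<dots> \<le> 1 * t1\<^sup>2 + 1 * t2\<^sup>2 + 1 * t3\<^sup>2 - m\<^sup>2"
    using assms by (intro diff_right_mono add_mono mult_right_mono) auto
  finally show ?thesis by (simp add: m_def)
qed

section \<open>Metric outer measures\<close>

text \<open>
  Caratheodory's criterion. A set \<open>X\<close> is split into \<open>F \<inter> X\<close> and the parts of \<open>X - F\<close> at distance at
  least \<open>1 / (n + 1)\<close> from \<open>F\<close>, which are separated from \<open>F\<close>. The remainders consist of shells; every
  second shell is separated from the next, so their measures have a finite sum and the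
  remainders tend to zero.
\<close>

lemma closed_in_lambda_system:
  fixes \<mu> :: "'a::metric_space set \<Rightarrow> ennreal"
  assumes om: "outer_measure_space UNIV \<mu>"
    and met: "\<And>A B d. d > 0 \<Longrightarrow> (\<And>x y. x \<in> A \<Longrightarrow> y \<in> B \<Longrightarrow> d \<le> dist x y)
        \<Longrightarrow> \<mu> A + \<mu> B \<le> \<mu> (A \<union> B)"
    and F: "closed F"
  shows "F \<in> lambda_system UNIV UNIV \<mu>"
proof (cases "F = {}")
  case True
  then show ?thesis
    using om by (auto simp: lambda_system_def outer_measure_space_def positive_def)
next
  case False
  have empty: "\<mu> {} = 0" and mono: "\<And>A B. A \<subseteq> B \<Longrightarrow> \<mu> A \<le> \<mu> B"
    using om by (auto simp: outer_measure_space_def positive_def increasing_def)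
  have csub: "\<mu> (\<Union>i. A i) \<le> (\<Sum>i. \<mu> (A i))" if "disjoint_family A" for A :: "nat \<Rightarrow> 'a set"
    using om that by (auto simp: outer_measure_space_def countably_subadditive_def)
  have sub2: "\<mu> (A \<union> B) \<le> \<mu> A + \<mu> B" for A B
  proof -
    have "\<mu> (\<Union>i. binaryset A (B - A) i) \<le> (\<Sum>i. \<mu> (binaryset A (B - A) i))"
      by (rule csub) (auto simp: disjoint_family_on_def binaryset_def)
    also have "\<dots> = \<mu> A + \<mu> (B - A)"
      using suminf_binaryset_eq[of \<mu>] empty by auto
    also have "\<dots> \<le> \<mu> A + \<mu> B"
      by (intro add_left_mono mono) auto
    finally show ?thesis by (simp add: UN_binaryset_eq)
  qed
  have "\<mu> (F \<inter> X) + \<mu> ((UNIV - F) \<inter> X) = \<mu> X" for X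
  proof (rule antisym)
    show "\<mu> X \<le> \<mu> (F \<inter> X) + \<mu> ((UNIV - F) \<inter> X)"
      using sub2[of "F \<inter> X" "(UNIV - F) \<inter> X"] by (metis Compl_eq_Diff_UNIV Int_Un_distrib2 Un_UNIV_right Int_UNIV_left Compl_partition)
    show "\<mu> (F \<inter> X) + \<mu> ((UNIV - F) \<inter> X) \<le> \<mu> X"
    proof (cases "\<mu> X = top")
      case True then show ?thesis by simp
    next
      case fin: False
      define r where "r n = 1 / real (Suc n)" for n
      have r_pos: "r n > 0" for n by (simp add: r_def)
      have r_dec: "r n < r m" if "m < n" for m n
        using that by (simp add: r_def frac_less2)
      have r_le: "r n \<le> r m" if "m \<le> n" for m n
        using r_dec[of m n] that by (cases "m = n") auto
      define A where "A n = {x \<in> X. r n \<le> infdist x F}" for n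
      define R where "R n = {x \<in> X. r (Suc n) \<le> infdist x F \<and> infdist x F < r n}" for n
      have far: "r m - r n \<le> dist x y" if "r m \<le> infdist x F" "infdist y F < r n" for x y m n
        using that infdist_triangle[of x F y] by linarith
      have AF: "\<mu> (F \<inter> X) + \<mu> (A n) \<le> \<mu> X" for n
      proof -
        have "\<mu> (F \<inter> X) + \<mu> (A n) \<le> \<mu> ((F \<inter> X) \<union> A n)"
        proof (rule met[OF r_pos[of n]])
          fix x y assume "x \<in> F \<inter> X" "y \<in> A n"
          then show "r n \<le> dist x y"
            using infdist_le[of x F y] by (auto simp: A_def dist_commute)
        qed
        also have "\<dots> \<le> \<mu> X" by (rule mono) (auto simp: A_def)
        finally show ?thesis .
      qed
      \<comment> \<open>Shells whose indices have the same parity are pairwise separated.\<close>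
      have odd_even: "(\<Sum>i<n. \<mu> (R (2 * i + j))) \<le> \<mu> X" for n j
      proof -
        have "(\<Sum>i<n. \<mu> (R (2 * i + j))) \<le> \<mu> (\<Union>i<n. R (2 * i + j))"
        proof (induction n)
          case (Suc n)
          have "(\<Sum>i<Suc n. \<mu> (R (2 * i + j))) \<le> \<mu> (\<Union>i<n. R (2 * i + j)) + \<mu> (R (2 * n + j))"
            using Suc by (simp add: add_right_mono)
          also have "\<dots> \<le> \<mu> ((\<Union>i<n. R (2 * i + j)) \<union> R (2 * n + j))"
          proof (cases "n = 0")
            case True then show ?thesis by (simp add: empty)
          next
            case False
            show ?thesis
            proof (rule met)
              show "r (2 * n + j - 1) - r (2 * n + j) > 0"
                using r_dec[of "2 * n + j - 1" "2 * n + j"] False by simp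
              fix x y assume "x \<in> (\<Union>i<n. R (2 * i + j))" and y: "y \<in> R (2 * n + j)"
              then obtain i where i: "i < n" "x \<in> R (2 * i + j)" by auto
              have "r (2 * n + j - 1) \<le> r (Suc (2 * i + j))"
                using i by (intro r_le) linarith
              then show "r (2 * n + j - 1) - r (2 * n + j) \<le> dist x y"
                using i y far by (fastforce simp: R_def)
            qed
          qed
          also have "(\<Union>i<n. R (2 * i + j)) \<union> R (2 * n + j) = (\<Union>i<Suc n. R (2 * i + j))"
            by (auto simp: lessThan_Suc)
          finally show ?case .
        qed (simp add: empty)
        also have "\<dots> \<le> \<mu> X" by (rule mono) (auto simp: R_def)
        finally show ?thesis .
      qed
      have "(\<Sum>i<n. \<mu> (R i)) \<le> \<mu> X + \<mu> X" for n
      proof -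
        have "(\<Sum>i<n. \<mu> (R i)) \<le> (\<Sum>i<2 * n. \<mu> (R i))"
          by (intro sum_mono2) auto
        also have "\<dots> = (\<Sum>i<n. \<mu> (R (2 * i + 0))) + (\<Sum>i<n. \<mu> (R (2 * i + 1)))"
          by (induction n) (auto simp: ac_simps)
        also have "\<dots> \<le> \<mu> X + \<mu> X"
          by (intro add_mono odd_even)
        finally show ?thesis .
      qed
      then have "(\<Sum>i. \<mu> (R i)) \<le> \<mu> X + \<mu> X"
        by (intro suminf_le_const) auto
      then have finS: "(\<Sum>i. \<mu> (R i)) \<noteq> top"
        using fin by (metis ennreal_add_eq_top neq_top_trans)
      have disj: "disjoint_family (\<lambda>m. R (m + n))" for n
      proof -
        have "R m \<inter> R k = {}" if "m < k" for m k
        proof -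
          have "r k \<le> r (Suc m)" using that by (intro r_le) simp
          then show ?thesis by (auto simp: R_def)
        qed
        then show ?thesis
          by (auto simp: disjoint_family_on_def) (metis add_less_cancel_right disjoint_iff linorder_neqE_nat)
      qed
      have D: "(UNIV - F) \<inter> X \<subseteq> A n \<union> (\<Union>m. R (m + n))" for n
      proof
        fix x assume x: "x \<in> (UNIV - F) \<inter> X"
        then have pos: "infdist x F > 0"
          using infdist_pos_not_in_closed[OF F False] by auto
        obtain p where p: "r p < infdist x F"
          unfolding r_def using reals_Archimedean[OF pos] by (auto simp: inverse_eq_divide)
        show "x \<in> A n \<union> (\<Union>m. R (m + n))"
        proof (cases "r n \<le> infdist x F")
          case True then show ?thesis using x by (auto simp: A_def)
        next
          case f: False
          define m where "m = (LEAST m. r (m + n) \<le> infdist x F)"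
          have "r (p + n) \<le> r p"
            by (rule r_le) simp
          then have "r (p + n) \<le> infdist x F" using p by linarith
          then have m: "r (m + n) \<le> infdist x F" unfolding m_def by (rule LeastI)
          then obtain q where q: "m = Suc q" using f by (cases m) auto
          have "\<not> r (q + n) \<le> infdist x F"
            using not_less_Least[of q "\<lambda>m. r (m + n) \<le> infdist x F"] q unfolding m_def by simp
          then have "x \<in> R (q + n)" using x m q by (auto simp: R_def)
          then show ?thesis by blast
        qed
      qed
      \<comment> \<open>The sum over the first shells is added on both sides so that the tail of the series can be
        completed to its finite sum, which cancels in the limit.\<close>
      have "\<mu> (F \<inter> X) + \<mu> ((UNIV - F) \<inter> X) + (\<Sum>i<n. \<mu> (R i)) \<le> \<mu> X + (\<Sum>i. \<mu> (R i))" for n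
      proof -
        have "\<mu> ((UNIV - F) \<inter> X) \<le> \<mu> (A n \<union> (\<Union>m. R (m + n)))"
          by (rule mono[OF D])
        also have "\<dots> \<le> \<mu> (A n) + \<mu> (\<Union>m. R (m + n))"
          by (rule sub2)
        also have "\<dots> \<le> \<mu> (A n) + (\<Sum>m. \<mu> (R (m + n)))"
          by (intro add_left_mono csub disj)
        finally have "\<mu> (F \<inter> X) + \<mu> ((UNIV - F) \<inter> X) + (\<Sum>i<n. \<mu> (R i))
            \<le> (\<mu> (F \<inter> X) + \<mu> (A n)) + ((\<Sum>m. \<mu> (R (m + n))) + (\<Sum>i<n. \<mu> (R i)))"
          by (simp add: add_mono add.assoc)
        also have "\<dots> \<le> \<mu> X + ((\<Sum>m. \<mu> (R (m + n))) + (\<Sum>i<n. \<mu> (R i)))"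
          by (intro add_right_mono AF)
        also have "(\<Sum>m. \<mu> (R (m + n))) + (\<Sum>i<n. \<mu> (R i)) = (\<Sum>i. \<mu> (R i))"
          by (rule suminf_offset[symmetric]) simp
        finally show ?thesis .
      qed
      moreover have "(\<lambda>n. \<mu> (F \<inter> X) + \<mu> ((UNIV - F) \<inter> X) + (\<Sum>i<n. \<mu> (R i)))
          \<longlonglongrightarrow> \<mu> (F \<inter> X) + \<mu> ((UNIV - F) \<inter> X) + (\<Sum>i. \<mu> (R i))"
        by (intro tendsto_add tendsto_const summable_LIMSEQ) simp
      ultimately have "\<mu> (F \<inter> X) + \<mu> ((UNIV - F) \<inter> X) + (\<Sum>i. \<mu> (R i)) \<le> \<mu> X + (\<Sum>i. \<mu> (R i))"
        by (intro LIMSEQ_le_const2) auto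
      then show ?thesis
        using finS ennreal_add_left_cancel_le[of "\<Sum>i. \<mu> (R i)"
            "\<mu> (F \<inter> X) + \<mu> ((UNIV - F) \<inter> X)" "\<mu> X"]
        by (simp add: add.commute)
    qed
  qed
  then show ?thesis by (simp add: lambda_system_def)
qed

lemma metric_outer_measure_space:
  fixes \<mu> :: "'a::metric_space set \<Rightarrow> ennreal"
  assumes om: "outer_measure_space UNIV \<mu>"
    and met: "\<And>A B d. d > 0 \<Longrightarrow> (\<And>x y. x \<in> A \<Longrightarrow> y \<in> B \<Longrightarrow> d \<le> dist x y)
        \<Longrightarrow> \<mu> A + \<mu> B \<le> \<mu> (A \<union> B)"
  shows "measure_space UNIV (sets borel) \<mu>"
proof -
  interpret P: sigma_algebra "UNIV :: 'a set" UNIV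
    using sigma_algebra_Pow[of "UNIV :: 'a set"] by simp
  have ms: "measure_space UNIV (lambda_system UNIV UNIV \<mu>) \<mu>"
    by (rule P.caratheodory_lemma[OF om])
  have "sets borel = sigma_sets UNIV {S :: 'a set. closed S}"
    by (subst borel_eq_closed) simp
  also have "\<dots> \<subseteq> lambda_system UNIV UNIV \<mu>"
    using ms closed_in_lambda_system[OF om met]
    by (intro sigma_algebra.sigma_sets_subset) (auto simp: measure_space_def)
  finally have sub: "sets borel \<subseteq> lambda_system UNIV UNIV \<mu>" .
  show ?thesis
    by (rule measure_down[OF ms _ sub]) (metis sets.sigma_algebra_axioms space_borel)
qed

section \<open>Hausdorff measure\<close>

text \<open>
  The summand in the definition of \<^const>\<open>hausdorff_pre\<close>.
\<close>

definition hausdorff_cost :: "nat \<Rightarrow> 'a::euclidean_space set \<Rightarrow> ennreal" where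
  "hausdorff_cost k C =
     (if C = {} then 0 else ennreal (unit_ball_vol (real k) * (diameter C / 2) ^ k))"

definition fine_cover :: "real \<Rightarrow> 'a::euclidean_space set \<Rightarrow> (nat \<Rightarrow> 'a set) \<Rightarrow> bool" where
  "fine_cover \<delta> A C \<longleftrightarrow> A \<subseteq> (\<Union>n. C n) \<and> (\<forall>n. bounded (C n) \<and> diameter (C n) \<le> \<delta>)"

lemma hausdorff_pre_altdef:
  "hausdorff_pre k \<delta> A = (INF C \<in> Collect (fine_cover \<delta> A). \<Sum>n. hausdorff_cost k (C n))"
  unfolding hausdorff_pre_def hausdorff_cost_def fine_cover_def by simp

lemma hausdorff_pre_le: "fine_cover \<delta> A C \<Longrightarrow> hausdorff_pre k \<delta> A \<le> (\<Sum>n. hausdorff_cost k (C n))"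
  unfolding hausdorff_pre_altdef by (rule INF_lower) simp

lemma hausdorff_pre_ge:
  "(\<And>C. fine_cover \<delta> A C \<Longrightarrow> x \<le> (\<Sum>n. hausdorff_cost k (C n))) \<Longrightarrow> x \<le> hausdorff_pre k \<delta> A"
  unfolding hausdorff_pre_altdef by (rule INF_greatest) simp

lemma hausdorff_pre_mono: "A \<subseteq> B \<Longrightarrow> hausdorff_pre k \<delta> A \<le> hausdorff_pre k \<delta> B"
  by (rule hausdorff_pre_ge, rule hausdorff_pre_le) (auto simp: fine_cover_def)

lemma hausdorff_pre_antimono: "\<delta> \<le> \<epsilon> \<Longrightarrow> hausdorff_pre k \<epsilon> A \<le> hausdorff_pre k \<delta> A"
  by (rule hausdorff_pre_ge, rule hausdorff_pre_le) (auto simp: fine_cover_def intro: order_trans)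

lemma hausdorff_pre_empty: "0 \<le> \<delta> \<Longrightarrow> hausdorff_pre k \<delta> {} = 0"
  using hausdorff_pre_le[of \<delta> "{}" "\<lambda>_. {}" k] by (simp add: fine_cover_def hausdorff_cost_def)

lemma hausdorff_pre_UN:
  assumes "0 \<le> \<delta>"
  shows "hausdorff_pre k \<delta> (\<Union>i. A i) \<le> (\<Sum>i. hausdorff_pre k \<delta> (A i))"
proof (rule ennreal_le_epsilon)
  fix e :: real assume "0 < e" and fin: "(\<Sum>i. hausdorff_pre k \<delta> (A i)) < top"
  have ex: "\<exists>C. fine_cover \<delta> (A i) C \<and>
      (\<Sum>n. hausdorff_cost k (C n)) \<le> hausdorff_pre k \<delta> (A i) + ennreal (e * (1/2) ^ Suc i)" for i
  proof -
    have "hausdorff_pre k \<delta> (A i) \<noteq> top"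
      using fin by (metis ennreal_suminf_lessD less_irrefl top.not_eq_extremum)
    then have "hausdorff_pre k \<delta> (A i) < hausdorff_pre k \<delta> (A i) + ennreal (e * (1/2) ^ Suc i)"
      using \<open>0 < e\<close> ennreal_add_left_cancel_less[of "hausdorff_pre k \<delta> (A i)" 0 "ennreal (e * (1/2) ^ Suc i)"]
      by simp
    then obtain C where "fine_cover \<delta> (A i) C"
      "(\<Sum>n. hausdorff_cost k (C n)) < hausdorff_pre k \<delta> (A i) + ennreal (e * (1/2) ^ Suc i)"
      by (subst (asm) hausdorff_pre_altdef) (auto simp: INF_less_iff)
    then show ?thesis by (auto intro: less_imp_le)
  qed
  then obtain C where C: "\<And>i. fine_cover \<delta> (A i) (C i)"
    "\<And>i. (\<Sum>n. hausdorff_cost k (C i n)) \<le> hausdorff_pre k \<delta> (A i) + ennreal (e * (1/2) ^ Suc i)"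
    by metis
  define D where "D = (\<lambda>p. case prod_decode p of (i, n) \<Rightarrow> C i n)"
  have "fine_cover \<delta> (\<Union>i. A i) D"
    unfolding fine_cover_def
  proof (intro conjI allI subsetI)
    fix x assume "x \<in> (\<Union>i. A i)"
    then obtain i n where "x \<in> C i n" using C(1) unfolding fine_cover_def by blast
    then show "x \<in> (\<Union>p. D p)"
      by (intro UN_I[of "prod_encode (i, n)"]) (auto simp: D_def)
  next
    fix p show "bounded (D p)" "diameter (D p) \<le> \<delta>"
      using C(1) unfolding fine_cover_def D_def by (auto split: prod.split)
  qed
  then have "hausdorff_pre k \<delta> (\<Union>i. A i) \<le> (\<Sum>p. hausdorff_cost k (D p))"
    by (rule hausdorff_pre_le)
  also have "\<dots> = (\<Sum>i. \<Sum>n. hausdorff_cost k (C i n))"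
    using suminf_ennreal_2dimen[of "\<lambda>i. \<Sum>n. hausdorff_cost k (C i n)" "\<lambda>(i, n). hausdorff_cost k (C i n)"]
    by (simp add: D_def case_prod_unfold)
  also have "\<dots> \<le> (\<Sum>i. hausdorff_pre k \<delta> (A i) + ennreal (e * (1/2) ^ Suc i))"
    by (intro suminf_le C(2)) auto
  also have "\<dots> = (\<Sum>i. hausdorff_pre k \<delta> (A i)) + (\<Sum>i. ennreal (e * (1/2) ^ Suc i))"
    by (rule suminf_add[symmetric]) auto
  also have "(\<Sum>i. ennreal (e * (1/2) ^ Suc i)) = ennreal e"
  proof (rule suminf_ennreal_eq)
    show "(\<lambda>i. e * (1/2) ^ Suc i) sums e"
      using sums_mult[OF power_half_series, of e] by (simp only: mult_1_right)
    show "0 \<le> e * (1/2) ^ Suc i" for i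
      using \<open>0 < e\<close> by (intro mult_nonneg_nonneg) auto
  qed
  finally show "hausdorff_pre k \<delta> (\<Union>i. A i) \<le> (\<Sum>i. hausdorff_pre k \<delta> (A i)) + ennreal e" .
qed

lemma hausdorff_pre_le_outer: "0 < \<delta> \<Longrightarrow> hausdorff_pre k \<delta> A \<le> hausdorff_outer k A"
  unfolding hausdorff_outer_def by (rule SUP_upper) simp

lemma hausdorff_outer_le: "(\<And>\<delta>. 0 < \<delta> \<Longrightarrow> hausdorff_pre k \<delta> A \<le> x) \<Longrightarrow> hausdorff_outer k A \<le> x"
  unfolding hausdorff_outer_def by (rule SUP_least) simp

lemma outer_measure_space_hausdorff: "outer_measure_space UNIV (hausdorff_outer k)"
  unfolding outer_measure_space_def positive_def increasing_def countably_subadditive_def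
proof (intro conjI ballI allI impI)
  show "hausdorff_outer k {} = 0"
  proof -
    have "hausdorff_outer k {} \<le> (0 :: ennreal)"
      by (rule hausdorff_outer_le) (simp add: hausdorff_pre_empty)
    then show ?thesis by simp
  qed
  show "hausdorff_outer k A \<le> hausdorff_outer k B" if "A \<subseteq> B" for A B :: "'a set"
    unfolding hausdorff_outer_def using that by (intro SUP_mono) (auto intro: hausdorff_pre_mono)
  fix A :: "nat \<Rightarrow> 'a set"
  show "hausdorff_outer k (\<Union>i. A i) \<le> (\<Sum>i. hausdorff_outer k (A i))"
  proof (rule hausdorff_outer_le)
    fix \<delta> :: real assume "0 < \<delta>"
    then show "hausdorff_pre k \<delta> (\<Union>i. A i) \<le> (\<Sum>i. hausdorff_outer k (A i))"
      by (intro order_trans[OF hausdorff_pre_UN] suminf_le hausdorff_pre_le_outer) auto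
  qed
qed

text \<open>
  A set of diameter less than \<open>d\<close> meets at most one of two sets at distance \<open>d\<close>. A fine cover of the
  union therefore splits into a cover of each.
\<close>

lemma hausdorff_outer_separated:
  fixes A B :: "'a::euclidean_space set"
  assumes "d > 0" and sep: "\<And>x y. x \<in> A \<Longrightarrow> y \<in> B \<Longrightarrow> d \<le> dist x y"
  shows "hausdorff_outer k A + hausdorff_outer k B \<le> hausdorff_outer k (A \<union> B)"
proof -
  have *: "hausdorff_pre k \<delta> A + hausdorff_pre k \<delta> B \<le> hausdorff_outer k (A \<union> B)"
    if \<delta>: "0 < \<delta>" "\<delta> < d" for \<delta>
  proof -
    have "hausdorff_pre k \<delta> A + hausdorff_pre k \<delta> B \<le> hausdorff_pre k \<delta> (A \<union> B)"
    proof (rule hausdorff_pre_ge)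
      fix C assume C: "fine_cover \<delta> (A \<union> B) C"
      define CA where "CA n = (if C n \<inter> A = {} then {} else C n)" for n
      define CB where "CB n = (if C n \<inter> B = {} then {} else C n)" for n
      have "fine_cover \<delta> A CA" "fine_cover \<delta> B CB"
        using C \<delta> by (fastforce simp: fine_cover_def CA_def CB_def)+
      then have "hausdorff_pre k \<delta> A + hausdorff_pre k \<delta> B
          \<le> (\<Sum>n. hausdorff_cost k (CA n)) + (\<Sum>n. hausdorff_cost k (CB n))"
        by (intro add_mono hausdorff_pre_le)
      also have "\<dots> = (\<Sum>n. hausdorff_cost k (CA n) + hausdorff_cost k (CB n))"
        by (rule suminf_add) auto
      also have "\<dots> \<le> (\<Sum>n. hausdorff_cost k (C n))"
      proof (rule suminf_le)
        fix n
        have "C n \<inter> A = {} \<or> C n \<inter> B = {}"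
        proof (rule ccontr)
          assume "\<not> ?thesis"
          then obtain x y where xy: "x \<in> C n" "x \<in> A" "y \<in> C n" "y \<in> B" by blast
          then have "dist x y \<le> diameter (C n)"
            using C diameter_bounded_bound[of "C n" x y] by (simp add: fine_cover_def)
          then have "dist x y \<le> \<delta>"
            using C order_trans unfolding fine_cover_def by blast
          then show False using sep[of x y] xy \<delta> by simp
        qed
        then show "hausdorff_cost k (CA n) + hausdorff_cost k (CB n) \<le> hausdorff_cost k (C n)"
          by (auto simp: CA_def CB_def hausdorff_cost_def)
      qed auto
      finally show "hausdorff_pre k \<delta> A + hausdorff_pre k \<delta> B \<le> (\<Sum>n. hausdorff_cost k (C n))" .
    qed
    also have "\<dots> \<le> hausdorff_outer k (A \<union> B)"
      using \<delta> by (intro hausdorff_pre_le_outer)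
    finally show ?thesis .
  qed
  have "(SUP \<delta>\<in>{0<..}. hausdorff_pre k \<delta> A) + (SUP \<delta>\<in>{0<..}. hausdorff_pre k \<delta> B)
      \<le> hausdorff_outer k (A \<union> B)"
  proof (subst SUP_add_directed_ennreal[symmetric])
    fix \<delta> \<epsilon> :: real assume "\<delta> \<in> {0<..}" "\<epsilon> \<in> {0<..}"
    then show "\<exists>\<gamma>\<in>{0<..}. hausdorff_pre k \<delta> A + hausdorff_pre k \<epsilon> B
        \<le> hausdorff_pre k \<gamma> A + hausdorff_pre k \<gamma> B"
      by (intro bexI[of _ "min \<delta> \<epsilon>"] add_mono hausdorff_pre_antimono) auto
  next
    show "(SUP \<delta>\<in>{0<..}. hausdorff_pre k \<delta> A + hausdorff_pre k \<delta> B) \<le> hausdorff_outer k (A \<union> B)"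
    proof (rule SUP_least)
      fix \<delta> :: real assume "\<delta> \<in> {0<..}"
      then have "hausdorff_pre k \<delta> A + hausdorff_pre k \<delta> B
          \<le> hausdorff_pre k (min \<delta> (d / 2)) A + hausdorff_pre k (min \<delta> (d / 2)) B"
        by (intro add_mono hausdorff_pre_antimono) auto
      also have "\<dots> \<le> hausdorff_outer k (A \<union> B)"
        using \<open>\<delta> \<in> {0<..}\<close> \<open>d > 0\<close> by (intro *) auto
      finally show "hausdorff_pre k \<delta> A + hausdorff_pre k \<delta> B \<le> hausdorff_outer k (A \<union> B)" .
    qed
  qed
  then show ?thesis by (simp add: hausdorff_outer_def)
qed

lemma sets_hausdorff_measure [simp, measurable_cong]: "sets (hausdorff_measure k) = sets borel"
  unfolding hausdorff_measure_def
  by (metis sets.sigma_algebra_axioms sigma_algebra.sets_measure_of_eq space_borel)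

lemma space_hausdorff_measure [simp]: "space (hausdorff_measure k) = UNIV"
  by (metis sets_hausdorff_measure sets_eq_imp_space_eq space_borel)

text \<open>
  The outer measure is metric, hence countably additive on Borel sets; without this,
  \<^const>\<open>measure_of\<close> would return the zero measure.
\<close>

lemma emeasure_hausdorff_measure:
  assumes "A \<in> sets borel"
  shows "emeasure (hausdorff_measure k) A = hausdorff_outer k A"
proof -
  have "measure_space UNIV (sets borel) (hausdorff_outer k :: 'a set \<Rightarrow> ennreal)"
    by (rule metric_outer_measure_space[OF outer_measure_space_hausdorff hausdorff_outer_separated])
  then show ?thesis
    unfolding hausdorff_measure_def measure_space_def
    by (elim conjE) (rule emeasure_measure_of_sigma[OF _ _ _ assms])
qed

text \<open>
  Covers can be pushed forward, and pulled back, along an isometric embedding without enlarging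
  diameters: the outer measure is intrinsic. This reduces the faces of a box in space, whatever
  their position, to rectangles in the plane.
\<close>

lemma hausdorff_outer_isometric_image:
  fixes P :: "'a::euclidean_space \<Rightarrow> 'b::euclidean_space"
  assumes P: "\<And>x y. dist (P x) (P y) = dist x y"
  shows "hausdorff_outer k (P ` A) = hausdorff_outer k A"
proof -
  have bdd: "bounded (P ` C) \<longleftrightarrow> bounded C" for C
    unfolding bounded_two_points using P by auto
  have diam: "diameter (P ` C) = diameter C" for C
  proof -
    have "(\<lambda>(x, y). dist x y) ` (P ` C \<times> P ` C) = (\<lambda>(x, y). dist (P x) (P y)) ` (C \<times> C)"
      by force
    then show ?thesis by (simp add: diameter_def P)
  qed
  have "hausdorff_pre k \<delta> (P ` A) = hausdorff_pre k \<delta> A" if "0 < \<delta>" for \<delta>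
  proof (rule antisym)
    show "hausdorff_pre k \<delta> (P ` A) \<le> hausdorff_pre k \<delta> A"
    proof (rule hausdorff_pre_ge)
      fix C assume "fine_cover \<delta> A C"
      then have "fine_cover \<delta> (P ` A) (\<lambda>n. P ` C n)"
        unfolding fine_cover_def bdd diam by blast
      then have "hausdorff_pre k \<delta> (P ` A) \<le> (\<Sum>n. hausdorff_cost k (P ` C n))"
        by (rule hausdorff_pre_le)
      then show "hausdorff_pre k \<delta> (P ` A) \<le> (\<Sum>n. hausdorff_cost k (C n))"
        unfolding hausdorff_cost_def diam by simp
    qed
    show "hausdorff_pre k \<delta> A \<le> hausdorff_pre k \<delta> (P ` A)"
    proof (rule hausdorff_pre_ge)
      fix C assume C: "fine_cover \<delta> (P ` A) C"
      define D where "D n = P -` C n" for n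
      have DC: "P ` D n \<subseteq> C n" for n by (auto simp: D_def)
      have dD: "bounded (D n)" "diameter (D n) \<le> diameter (C n)" for n
      proof -
        have "bounded (C n)" using C by (simp add: fine_cover_def)
        then show "bounded (D n)" using DC[of n] bdd bounded_subset by blast
        show "diameter (D n) \<le> diameter (C n)"
          using diameter_subset[OF DC[of n] \<open>bounded (C n)\<close>] by (simp add: diam)
      qed
      have "fine_cover \<delta> A D"
        unfolding fine_cover_def
      proof (intro conjI allI subsetI)
        fix x assume "x \<in> A"
        then have "P x \<in> (\<Union>n. C n)" using C by (auto simp: fine_cover_def)
        then show "x \<in> (\<Union>n. D n)" by (auto simp: D_def)
      next
        fix n show "bounded (D n)" "diameter (D n) \<le> \<delta>"
          using C dD[of n] by (auto simp: fine_cover_def intro: order_trans)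
      qed
      then have "hausdorff_pre k \<delta> A \<le> (\<Sum>n. hausdorff_cost k (D n))"
        by (rule hausdorff_pre_le)
      also have "\<dots> \<le> (\<Sum>n. hausdorff_cost k (C n))"
      proof (rule suminf_le)
        fix n
        have "C n = {} \<Longrightarrow> D n = {}" by (simp add: D_def)
        then show "hausdorff_cost k (D n) \<le> hausdorff_cost k (C n)"
          using dD[of n] diameter_ge_0[OF dD(1)]
          by (auto simp: hausdorff_cost_def intro!: ennreal_leI mult_left_mono power_mono)
      qed auto
      finally show "hausdorff_pre k \<delta> A \<le> (\<Sum>n. hausdorff_cost k (C n))" .
    qed
  qed
  then show ?thesis
    by (simp add: hausdorff_outer_def)
qed

text \<open>
  Uniqueness of translation-invariant measures. With \<open>B\<close> the unit cube, the double integral of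
  \<open>1\<^sub>A x \<cdot> 1\<^sub>B (y - x)\<close> is \<open>\<mu> A\<close> when \<open>y\<close> is integrated first; substituting \<open>y + x\<close> for \<open>x\<close> and
  exchanging the order turns it into \<open>\<mu> (- B)\<close> times the Lebesgue measure of \<open>A\<close>.
\<close>

lemma translation_invariant_eq_lborel:
  fixes \<mu> :: "'a::euclidean_space measure"
  assumes "sigma_finite_measure \<mu>" and [measurable_cong, simp]: "sets \<mu> = sets borel"
    and inv: "\<And>c. distr \<mu> borel ((+) c) = \<mu>" and A[measurable]: "A \<in> sets borel"
  shows "emeasure \<mu> A = emeasure \<mu> (uminus -` cbox 0 One) * emeasure lborel A"
proof -
  interpret M: sigma_finite_measure \<mu> by fact
  interpret P: pair_sigma_finite \<mu> lborel ..
  define B :: "'a set" where "B = cbox 0 One"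
  have [measurable]: "B \<in> sets borel" by (simp add: B_def)
  have Bm: "uminus -` B \<in> sets \<mu>"
    using measurable_sets_borel[of uminus borel B] by simp
  have shiftL: "(\<integral>\<^sup>+y. f (c + y) \<partial>lborel) = (\<integral>\<^sup>+y. f y \<partial>lborel)"
    if [measurable]: "f \<in> borel_measurable borel" for f :: "'a \<Rightarrow> ennreal" and c
    using nn_integral_distr[of "(+) c" lborel borel f] by (simp add: lborel_distr_plus)
  have shiftM: "(\<integral>\<^sup>+y. f (c + y) \<partial>\<mu>) = (\<integral>\<^sup>+y. f y \<partial>\<mu>)"
    if [measurable]: "f \<in> borel_measurable borel" for f :: "'a \<Rightarrow> ennreal" and c
    using nn_integral_distr[of "(+) c" \<mu> borel f] by (simp add: inv)
  have B1: "(\<integral>\<^sup>+y. indicator B y \<partial>lborel) = 1"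
    by (simp add: B_def emeasure_lborel_cbox_eq inner_Basis)
  have "emeasure \<mu> A = (\<integral>\<^sup>+x. indicator A x * (\<integral>\<^sup>+y. indicator B (-x + y) \<partial>lborel) \<partial>\<mu>)"
    by (subst shiftL) (simp_all add: B1)
  also have "\<dots> = (\<integral>\<^sup>+x. (\<integral>\<^sup>+y. indicator A x * indicator B (-x + y) \<partial>lborel) \<partial>\<mu>)"
    by (subst nn_integral_cmult) auto
  also have "\<dots> = (\<integral>\<^sup>+y. (\<integral>\<^sup>+x. indicator A x * indicator B (-x + y) \<partial>\<mu>) \<partial>lborel)"
    by (rule P.Fubini'[symmetric]) measurable
  also have "\<dots> = (\<integral>\<^sup>+y. (\<integral>\<^sup>+x. indicator A (y + x) * indicator B (-(y + x) + y) \<partial>\<mu>) \<partial>lborel)"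
  proof (rule nn_integral_cong)
    fix y :: 'a
    show "(\<integral>\<^sup>+x. indicator A x * indicator B (-x + y) \<partial>\<mu>)
        = (\<integral>\<^sup>+x. indicator A (y + x) * indicator B (-(y + x) + y) \<partial>\<mu>)"
      by (rule shiftM[of "\<lambda>x. indicator A x * indicator B (-x + y)" y, symmetric]) measurable
  qed
  also have "\<dots> = (\<integral>\<^sup>+y. (\<integral>\<^sup>+x. indicator A (x + y) * indicator B (-x) \<partial>\<mu>) \<partial>lborel)"
    by (simp add: add.commute)
  also have "\<dots> = (\<integral>\<^sup>+x. (\<integral>\<^sup>+y. indicator A (x + y) * indicator B (-x) \<partial>lborel) \<partial>\<mu>)"
    by (rule P.Fubini') measurable
  also have "\<dots> = (\<integral>\<^sup>+x. (\<integral>\<^sup>+y. indicator A (x + y) \<partial>lborel) * indicator B (-x) \<partial>\<mu>)"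
    by (subst nn_integral_multc) auto
  also have "\<dots> = (\<integral>\<^sup>+x. emeasure lborel A * indicator (uminus -` B) x \<partial>\<mu>)"
    by (subst shiftL) (auto simp: indicator_def intro!: nn_integral_cong)
  also have "\<dots> = emeasure lborel A * emeasure \<mu> (uminus -` B)"
    by (subst nn_integral_cmult) (auto simp: nn_integral_indicator[OF Bm])
  finally show ?thesis by (simp add: B_def mult.commute)
qed

text \<open>
  A set of diameter \<open>d\<close> lies in a ball of radius \<open>d\<close>, whose volume is \<open>2 ^ DIM('a)\<close> times the
  contribution of the set. So the Hausdorff measure of full dimension is not zero.
\<close>

lemma lborel_le_hausdorff_outer:
  fixes A :: "'a::euclidean_space set"
  assumes "A \<in> sets borel"
  shows "ennreal ((1 / 2) ^ DIM('a)) * emeasure lborel A \<le> hausdorff_outer DIM('a) A"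
proof -
  have "ennreal ((1 / 2) ^ DIM('a)) * emeasure lborel A \<le> hausdorff_pre DIM('a) 1 A"
  proof (rule hausdorff_pre_ge)
      fix C :: "nat \<Rightarrow> 'a set" assume "fine_cover 1 A C"
      then have cov: "A \<subseteq> (\<Union>n. C n)" and bdd: "\<And>n. bounded (C n)"
        by (auto simp: fine_cover_def)
      define D where "D n = (if C n = {} then {} else cball (SOME x. x \<in> C n) (diameter (C n)))" for n
      have CD: "C n \<subseteq> D n" for n
      proof
        fix x assume "x \<in> C n"
        then have "(SOME x. x \<in> C n) \<in> C n" by (rule someI)
        then show "x \<in> D n"
          using diameter_bounded_bound[OF bdd[of n] _ \<open>x \<in> C n\<close>] \<open>x \<in> C n\<close> by (auto simp: D_def)
      qed
      have D: "D n \<in> sets borel" for n by (simp add: D_def)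
      have eD: "emeasure lborel (D n) = ennreal (2 ^ DIM('a)) * hausdorff_cost DIM('a) (C n)" for n
      proof (cases "C n = {}")
        case False
        have "emeasure lborel (D n) = ennreal (unit_ball_vol DIM('a) * diameter (C n) ^ DIM('a))"
          using False diameter_ge_0[OF bdd[of n]] by (simp add: D_def emeasure_cball)
        also have "unit_ball_vol DIM('a) * diameter (C n) ^ DIM('a)
            = 2 ^ DIM('a) * (unit_ball_vol DIM('a) * (diameter (C n) / 2) ^ DIM('a))"
          by (simp add: power_divide)
        also have "ennreal \<dots> = ennreal (2 ^ DIM('a)) * hausdorff_cost DIM('a) (C n)"
          using False by (simp add: hausdorff_cost_def ennreal_mult')
        finally show ?thesis .
      qed (simp add: D_def hausdorff_cost_def)
      have "emeasure lborel A \<le> emeasure lborel (\<Union>n. D n)"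
        using cov CD D by (intro emeasure_mono) (auto, blast)
      also have "\<dots> \<le> (\<Sum>n. emeasure lborel (D n))"
        using D by (intro emeasure_subadditive_countably) auto
      also have "\<dots> = ennreal (2 ^ DIM('a)) * (\<Sum>n. hausdorff_cost DIM('a) (C n))"
        by (simp add: eD)
      finally have "ennreal ((1 / 2) ^ DIM('a)) * emeasure lborel A
          \<le> ennreal ((1 / 2) ^ DIM('a)) * (ennreal (2 ^ DIM('a)) * (\<Sum>n. hausdorff_cost DIM('a) (C n)))"
        by (intro mult_left_mono) auto
      also have "\<dots> = ennreal ((1 / 2) ^ DIM('a) * 2 ^ DIM('a)) * (\<Sum>n. hausdorff_cost DIM('a) (C n))"
        by (simp add: ennreal_mult' mult.assoc)
      also have "(1 / 2) ^ DIM('a) * 2 ^ DIM('a) = (1 :: real)"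
        by (simp add: power_one_over)
      finally show "ennreal ((1 / 2) ^ DIM('a)) * emeasure lborel A \<le> (\<Sum>n. hausdorff_cost DIM('a) (C n))"
        by simp
  qed
  also have "\<dots> \<le> hausdorff_outer DIM('a) A"
    by (rule hausdorff_pre_le_outer) simp
  finally show ?thesis .
qed

text \<open>
  Finiteness: the grid of \<open>N \<times> N\<close> squares, each of diameter at most \<open>2 / N\<close>, has total contribution
  \<open>unit_ball_vol 2\<close> for every \<open>N\<close>.
\<close>

lemma hausdorff_outer_unit_square:
  "hausdorff_outer 2 ({0..1} \<times> {0..1} :: (real \<times> real) set) \<le> ennreal (unit_ball_vol 2)"
proof (rule hausdorff_outer_le)
  fix \<delta> :: real assume "0 < \<delta>"
  obtain N :: nat where N: "2 / \<delta> < N" using reals_Archimedean2 by blast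
  have N0: "N > 0" using N \<open>0 < \<delta>\<close> by (cases N) (auto simp: field_simps)
  define I where "I i = {real i / N .. (real i + 1) / N}" for i
  define C where "C n = (if n < N * N then I (n div N) \<times> I (n mod N) else {})" for n
  have I_dist: "\<bar>s - t\<bar> \<le> 1 / N" if "s \<in> I i" "t \<in> I i" for s t i
    using that unfolding I_def add_divide_distrib by (simp add: abs_le_iff)
  have diam: "diameter (C n) \<le> 2 / N" for n
  proof (rule diameter_le)
    show "C n \<noteq> {} \<or> 0 \<le> 2 / real N" by simp
    fix x y assume xy: "x \<in> C n" "y \<in> C n"
    have "norm (x - y) \<le> norm (fst (x - y)) + norm (snd (x - y))"
      by (metis norm_Pair_le prod.collapse)
    also have "\<dots> \<le> 1 / N + 1 / N"
      using xy by (intro add_mono) (auto simp: C_def I_dist split: if_splits)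
    finally show "norm (x - y) \<le> 2 / N" by simp
  qed
  have "fine_cover \<delta> ({0..1} \<times> {0..1}) C"
    unfolding fine_cover_def
  proof (intro conjI allI)
    have ex: "\<exists>i<N. x \<in> I i" if "x \<in> {0..1}" for x :: real
    proof (cases "x = 1")
      case True
      then show ?thesis using N0 by (intro exI[of _ "N - 1"]) (auto simp: I_def of_nat_diff)
    next
      case False
      define i where "i = nat \<lfloor>x * N\<rfloor>"
      have i: "real i \<le> x * N" "x * N < real i + 1"
        unfolding i_def using that by (auto simp: of_nat_floor)
      have "real i < N" using i(1) False that N0
        by (smt (verit) atLeastAtMost_iff mult_less_cancel_right2 of_nat_0_less_iff)
      then show ?thesis using i N0 by (intro exI[of _ i]) (auto simp: I_def field_simps)
    qed
    show "{0..1} \<times> {0..1} \<subseteq> (\<Union>n. C n)"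
    proof
      fix p :: "real \<times> real" assume "p \<in> {0..1} \<times> {0..1}"
      then obtain i j where ij: "i < N" "j < N" "fst p \<in> I i" "snd p \<in> I j"
        using ex[of "fst p"] ex[of "snd p"] by (auto simp: mem_Times_iff)
      have "i * N + j < (i + 1) * N" using ij by simp
      also have "\<dots> \<le> N * N" using ij by (intro mult_right_mono) auto
      finally have "p \<in> C (i * N + j)"
        using ij N0 by (auto simp: C_def mem_Times_iff)
      then show "p \<in> (\<Union>n. C n)" by blast
    qed
    fix n
    show "bounded (C n)" by (auto simp: C_def I_def intro: bounded_Times)
    have "2 / N \<le> \<delta>" using N N0 \<open>0 < \<delta>\<close> by (simp add: field_simps)
    then show "diameter (C n) \<le> \<delta>" using diam[of n] by linarith
  qed
  then have "hausdorff_pre 2 \<delta> ({0..1} \<times> {0..1} :: (real \<times> real) set) \<le> (\<Sum>n. hausdorff_cost 2 (C n))"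
    by (rule hausdorff_pre_le)
  also have "\<dots> = (\<Sum>n<N * N. hausdorff_cost 2 (C n))"
    by (rule suminf_finite) (auto simp: C_def hausdorff_cost_def)
  also have "\<dots> \<le> (\<Sum>n<N * N. ennreal (unit_ball_vol 2 * (1 / N)\<^sup>2))"
  proof (rule sum_mono)
    fix n
    have "bounded (C n)" by (auto simp: C_def I_def intro: bounded_Times)
    then show "hausdorff_cost 2 (C n) \<le> ennreal (unit_ball_vol 2 * (1 / N)\<^sup>2)"
      using diam[of n] diameter_ge_0[of "C n"]
      by (auto simp: hausdorff_cost_def intro!: ennreal_leI mult_left_mono power_mono)
  qed
  also have "\<dots> = ennreal (\<Sum>n<N * N. unit_ball_vol 2 * (1 / N)\<^sup>2)"
    by (rule sum_ennreal) simp
  also have "(\<Sum>n<N * N. unit_ball_vol 2 * (1 / N)\<^sup>2) = unit_ball_vol 2"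
    using N0 by (simp add: power2_eq_square)
  finally show "hausdorff_pre 2 \<delta> ({0..1} \<times> {0..1} :: (real \<times> real) set) \<le> ennreal (unit_ball_vol 2)" .
qed

lemma hausdorff_outer_translate:
  fixes A :: "'a::euclidean_space set"
  shows "hausdorff_outer k ((+) c ` A) = hausdorff_outer k A"
  by (rule hausdorff_outer_isometric_image) simp

text \<open>
  The two bounds above make the factor of proportionality positive and finite. A mean value over a
  surface is a quotient of two integrals, in which the factor cancels.
\<close>

lemma hausdorff_plane_eq_lborel:
  obtains c :: real where "c > 0"
    "\<And>A :: (real \<times> real) set. A \<in> sets borel \<Longrightarrow> hausdorff_outer 2 A = ennreal c * emeasure lborel A"
proof -
  let ?H = "hausdorff_measure 2 :: (real \<times> real) measure"
  let ?Q = "{0..1} \<times> {0..1} :: (real \<times> real) set"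
  have Qb: "?Q \<in> sets borel" by (intro borel_closed closed_Times) auto
  have im: "(+) c -` A = (+) (-c) ` A" for c :: "real \<times> real" and A
  proof (intro set_eqI iffI)
    fix x assume "x \<in> (+) c -` A"
    then show "x \<in> (+) (-c) ` A" by (intro image_eqI[of _ _ "c + x"]) auto
  qed auto
  have tr: "distr ?H borel ((+) c) = ?H" for c
  proof (rule measure_eqI)
    fix A assume "A \<in> sets (distr ?H borel ((+) c))"
    then have A[measurable]: "A \<in> sets borel" by simp
    have "emeasure (distr ?H borel ((+) c)) A = emeasure ?H ((+) c -` A)"
      by (subst emeasure_distr) auto
    also have "\<dots> = hausdorff_outer 2 ((+) c -` A)"
      using measurable_sets_borel[of "(+) c" borel A] by (intro emeasure_hausdorff_measure) simp
    also have "\<dots> = emeasure ?H A"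
      unfolding im hausdorff_outer_translate by (simp add: emeasure_hausdorff_measure)
    finally show "emeasure (distr ?H borel ((+) c)) A = emeasure ?H A" .
  qed simp
  have sf: "sigma_finite_measure ?H"
  proof
    let ?F = "(\<lambda>(i :: int, j :: int). (+) (real_of_int i, real_of_int j) ` ?Q) ` UNIV"
    have "p \<in> \<Union> ?F" for p :: "real \<times> real"
    proof -
      have "p = (real_of_int \<lfloor>fst p\<rfloor>, real_of_int \<lfloor>snd p\<rfloor>) + (frac (fst p), frac (snd p))"
        by (simp add: frac_def prod_eq_iff)
      moreover have "(frac (fst p), frac (snd p)) \<in> ?Q"
        using frac_lt_1[of "fst p"] frac_lt_1[of "snd p"] by simp
      ultimately have "p \<in> (+) (real_of_int \<lfloor>fst p\<rfloor>, real_of_int \<lfloor>snd p\<rfloor>) ` ?Q"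
        by (metis image_eqI)
      then show ?thesis by blast
    qed
    moreover have "hausdorff_outer 2 ?Q \<noteq> \<infinity>"
      using hausdorff_outer_unit_square by (metis ennreal_neq_top infinity_ennreal_def neq_top_trans)
    moreover have "(+) c ` ?Q \<in> sets borel" for c
      using closed_translation[of ?Q c] by (intro borel_closed) (auto intro: closed_Times)
    ultimately show "\<exists>A. countable A \<and> A \<subseteq> sets ?H \<and> \<Union> A = space ?H \<and> (\<forall>a\<in>A. emeasure ?H a \<noteq> \<infinity>)"
      by (intro exI[of _ ?F]) (auto simp: emeasure_hausdorff_measure hausdorff_outer_translate)
  qed
  define c where "c = emeasure ?H (uminus -` cbox 0 One)"
  have eq: "hausdorff_outer 2 A = c * emeasure lborel A" if "A \<in> sets borel" for A :: "(real \<times> real) set"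
    using translation_invariant_eq_lborel[OF sf _ tr that] that
    by (simp add: c_def emeasure_hausdorff_measure)
  have Q1: "emeasure lborel ?Q = 1"
    by (subst lborel_prod[symmetric], subst lborel.emeasure_pair_measure_Times) auto
  have "c \<le> ennreal (unit_ball_vol 2)"
    using hausdorff_outer_unit_square eq[OF Qb] Q1 by simp
  then obtain r where r: "c = ennreal r" "0 \<le> r"
    by (metis ennreal_cases ennreal_neq_top neq_top_trans)
  have "ennreal ((1 / 2)\<^sup>2) \<le> c"
    using lborel_le_hausdorff_outer[OF Qb] eq[OF Qb] Q1 by (simp add: numeral_2_eq_2)
  then have "r \<noteq> 0" using r by (intro notI) simp
  then show ?thesis using that[of r] eq r by simp
qed

text \<open>
  The formula for surface integrals over a flat piece \<open>P ` B\<close> with isometric parametrisation \<open>P\<close>,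
  stated as an equality of measures so that it applies to every integrand.
\<close>

lemma hausdorff_isometric_image:
  fixes P :: "'a::euclidean_space \<Rightarrow> 'b::euclidean_space"
  assumes P: "\<And>x y. dist (P x) (P y) = dist x y"
    and c: "c \<ge> 0" "\<And>A :: 'a set. A \<in> sets borel \<Longrightarrow> hausdorff_outer k A = ennreal c * emeasure lborel A"
    and B[measurable]: "B \<in> sets borel" and PB[measurable]: "P ` B \<in> sets borel"
  shows "density (hausdorff_measure k) (indicator (P ` B))
    = distr (density lborel (\<lambda>y. ennreal c * indicator B y)) borel P"
proof (rule measure_eqI)
  have "continuous_on UNIV P"
    unfolding continuous_on_iff using P by auto
  then have Pm[measurable]: "P \<in> borel_measurable borel"
    by (rule borel_measurable_continuous_onI)
  fix E assume "E \<in> sets (density (hausdorff_measure k) (indicator (P ` B)))"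
  then have E[measurable]: "E \<in> sets borel" by simp
  have PE[measurable]: "P -` E \<in> sets borel" using measurable_sets_borel[OF Pm E] .
  have "emeasure (density (hausdorff_measure k) (indicator (P ` B))) E
      = emeasure (hausdorff_measure k) (P ` B \<inter> E)"
    by (subst emeasure_density) (auto simp flip: indicator_inter_arith)
  also have "P ` B \<inter> E = P ` (P -` E \<inter> B)" by auto
  also have "emeasure (hausdorff_measure k) \<dots> = hausdorff_outer k (P ` (P -` E \<inter> B))"
    by (rule emeasure_hausdorff_measure) (metis E PB sets.Int \<open>P ` B \<inter> E = P ` (P -` E \<inter> B)\<close>)
  also have "\<dots> = ennreal c * emeasure lborel (P -` E \<inter> B)"
    by (subst hausdorff_outer_isometric_image[OF P]) (simp add: c)
  also have "\<dots> = emeasure (density lborel (\<lambda>y. ennreal c * indicator B y)) (P -` E)"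
    by (subst emeasure_density) (auto simp: mult.assoc nn_integral_cmult Int_commute simp flip: indicator_inter_arith)
  also have "\<dots> = emeasure (distr (density lborel (\<lambda>y. ennreal c * indicator B y)) borel P) E"
    by (subst emeasure_distr) auto
  finally show "emeasure (density (hausdorff_measure k) (indicator (P ` B))) E = \<dots>" .
qed simp

section \<open>The surface integral over the boundary of a box\<close>

lemma AE_box_eq_cbox: "AE q in lborel. q \<in> box u v \<longleftrightarrow> q \<in> cbox u v"
proof -
  have "cbox u v - box u v \<in> null_sets lborel"
    using negligible_frontier_interval[of u v]
    by (simp add: negligible_iff_null_sets null_sets_completion_iff)
  then have "AE q in lborel. q \<notin> cbox u v - box u v" by (rule AE_not_in)
  then show ?thesis
    by eventually_elim (use box_subset_cbox in auto)
qed

text \<open>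
  Faces of a box overlap in edges. A disjoint decomposition of the boundary uses rectangles that
  contain only part of their sides; the integrals do not see the difference.
\<close>

lemma integral_between_boxes:
  fixes f :: "'a::euclidean_space \<Rightarrow> real"
  assumes [measurable]: "f \<in> borel_measurable borel" "B \<in> sets borel" and "box u v \<subseteq> B" "B \<subseteq> cbox u v"
  shows "(LINT q|lborel. indicator B q * f q) = (LINT q|lborel. indicator (cbox u v) q * f q)"
proof (rule Bochner_Integration.integral_cong_AE)
  show "AE q in lborel. indicator B q * f q = indicator (cbox u v) q * f q"
    using AE_box_eq_cbox[of u v] by eventually_elim (use assms in \<open>auto simp: indicator_def\<close>)
qed measurable

lemma avg2_eq_lborel_between:
  assumes pos: "a > 0" "b > 0" and f: "continuous_on UNIV f"
    and B: "B \<in> sets borel" "{-a<..<a} \<times> {-b<..<b} \<subseteq> B" "B \<subseteq> {-a..a} \<times> {-b..b}"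
  shows "(LINT q|lborel. indicator B q * f q) = 4 * a * b * avg2 a b f"
proof -
  have "box (-a, -b) (a, b) = {-a<..<a} \<times> {-b<..<b}" "cbox (-a, -b) (a, b) = {-a..a} \<times> {-b..b}"
    by (auto simp: mem_box Basis_prod_def)
  then show ?thesis
    using integral_between_boxes[of f B "(-a, -b)" "(a, b)"] B f
    by (simp add: avg2_eq_lborel[OF pos f] borel_measurable_continuous_onI)
qed

lemma face_integral:
  fixes P :: "'a::euclidean_space \<Rightarrow> 'b::euclidean_space" and g :: "'b \<Rightarrow> real"
  assumes P: "\<And>x y. dist (P x) (P y) = dist x y"
    and k: "k \<ge> 0" "\<And>A :: 'a set. A \<in> sets borel \<Longrightarrow> hausdorff_outer n A = ennreal k * emeasure lborel A"
    and B[measurable]: "B \<in> sets borel" and PB[measurable]: "P ` B \<in> sets borel"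
    and g: "continuous_on UNIV g" and K: "compact K" "B \<subseteq> K"
  shows "integrable (hausdorff_measure n) (\<lambda>p. indicator (P ` B) p * g p)" (is ?I)
    and "(LINT p|hausdorff_measure n. indicator (P ` B) p * g p) = k * (LINT q|lborel. indicator B q * g (P q))" (is ?E)
proof -
  let ?H = "hausdorff_measure n :: 'b measure"
  have cP: "continuous_on UNIV P"
    unfolding continuous_on_iff using P by auto
  then have Pm[measurable]: "P \<in> borel_measurable borel"
    by (rule borel_measurable_continuous_onI)
  have cgP: "continuous_on UNIV (\<lambda>q. g (P q))"
    by (rule continuous_on_compose2[OF g cP]) auto
  have [measurable]: "g \<in> borel_measurable borel"
    using g by (rule borel_measurable_continuous_onI)
  have eq: "density ?H (\<lambda>p. ennreal (indicator (P ` B) p))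
      = distr (density lborel (\<lambda>q. ennreal (k * indicator B q))) borel P"
    using hausdorff_isometric_image[OF P k B PB] k(1) by (simp add: ennreal_mult ennreal_indicator)
  have "integrable lborel (\<lambda>q. indicator B q *\<^sub>R (indicator K q * g (P q)))"
    by (intro integrable_mult_indicator integrable_indicator_compact cgP K) auto
  also have "(\<lambda>q. indicator B q *\<^sub>R (indicator K q * g (P q))) = (\<lambda>q. indicator B q * g (P q))"
    using K(2) by (auto simp: indicator_def fun_eq_iff)
  finally have i1: "integrable lborel (\<lambda>q. indicator B q * g (P q))" .
  then have "integrable (density lborel (\<lambda>q. ennreal (k * indicator B q))) (\<lambda>q. g (P q))"
    using k(1) by (subst integrable_density) (auto simp: mult.assoc)
  then have "integrable (density ?H (\<lambda>p. ennreal (indicator (P ` B) p))) g"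
    unfolding eq by (subst integrable_distr_eq) auto
  then show ?I
    by (subst (asm) integrable_density) auto
  have "(LINT p|?H. indicator (P ` B) p * g p) = (LINT p|density ?H (\<lambda>p. ennreal (indicator (P ` B) p)). g p)"
    by (subst integral_density) auto
  also have "\<dots> = (LINT q|density lborel (\<lambda>q. ennreal (k * indicator B q)). g (P q))"
    unfolding eq by (subst integral_distr) auto
  also have "\<dots> = k * (LINT q|lborel. indicator B q * g (P q))"
    using k(1) by (subst integral_density) (auto simp: mult.assoc)
  finally show ?E .
qed

lemma frontier_box3:
  fixes a b c :: real
  assumes "a > 0" "b > 0" "c > 0"
  shows "frontier (box3 a b c)
    = (cbox3 a b c) - (box3 a b c)"
  using assms by (simp add: frontier_def closure_Times interior_open open_Times)

text \<open>
  One eighth of the integral of \<open>g\<close> over the boundary of the box with half edges \<open>a\<close>, \<open>b\<close>, \<open>c\<close>, taken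
  with respect to area; opposite faces are combined.
\<close>

definition face_sum :: "real \<Rightarrow> real \<Rightarrow> real \<Rightarrow> (R3 \<Rightarrow> real) \<Rightarrow> real" where
  "face_sum a b c g = b * c * avg2 b c (\<lambda>(y, z). (g (a, y, z) + g (- a, y, z)) / 2)
    + a * c * avg2 a c (\<lambda>(x, z). (g (x, b, z) + g (x, - b, z)) / 2)
    + a * b * avg2 a b (\<lambda>(x, y). (g (x, y, c) + g (x, y, - c)) / 2)"

text \<open>
  The boundary is the disjoint union of six rectangles: two closed ones, two that omit the
  edges shared with those, and two open ones.
\<close>

lemma surface_integral_box:
  fixes a b c :: real
  assumes pos: "a > 0" "b > 0" "c > 0"
  shows "\<exists>k>0. \<forall>g :: R3 \<Rightarrow> real. continuous_on UNIV g \<longrightarrow>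
      integrable (surface_measure (box3 a b c)) g \<and>
      (LINT p|surface_measure (box3 a b c). g p) = k * face_sum a b c g"
proof -
  obtain r where r: "r > 0" "\<And>A :: (real \<times> real) set. A \<in> sets borel \<Longrightarrow> hausdorff_outer 2 A = ennreal r * emeasure lborel A"
    using hausdorff_plane_eq_lborel by blast
  let ?O = "box3 a b c"
  let ?H = "hausdorff_measure 2 :: R3 measure"
  define P1 P2 P3 :: "real \<Rightarrow> real \<times> real \<Rightarrow> R3"
    where "P1 s = (\<lambda>(y, z). (s, y, z))" and "P2 s = (\<lambda>(x, z). (x, s, z))" and "P3 s = (\<lambda>(x, y). (x, y, s))" for s
  define B1 where "B1 = {-b..b} \<times> {-c..c}"
  define B2 where "B2 = {-a<..<a} \<times> {-c..c}"
  define B3 where "B3 = {-a<..<a} \<times> {-b<..<b}"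
  have isom: "dist (P1 s p) (P1 s q) = dist p q" "dist (P2 s p) (P2 s q) = dist p q"
     "dist (P3 s p) (P3 s q) = dist p q" for s p q
    by (simp_all add: P1_def P2_def P3_def dist_prod_def case_prod_unfold)
  have B: "B1 \<in> sets borel" "B2 \<in> sets borel" "B3 \<in> sets borel"
    unfolding B1_def B2_def B3_def by (intro borel_Times; simp)+
  have im: "P1 s ` B1 = {s} \<times> {-b..b} \<times> {-c..c}" "P2 s ` B2 = {-a<..<a} \<times> {s} \<times> {-c..c}"
    "P3 s ` B3 = {-a<..<a} \<times> {-b<..<b} \<times> {s}" for s
    by (auto simp: P1_def P2_def P3_def B1_def B2_def B3_def image_iff)
  have PB: "P1 s ` B1 \<in> sets borel" "P2 s ` B2 \<in> sets borel" "P3 s ` B3 \<in> sets borel" for s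
    unfolding im by (intro borel_Times; simp)+
  have cpt: "compact ({-s..s} \<times> {-t..t})" for s t :: real by (intro compact_Times) auto
  have sub: "B1 \<subseteq> {-b..b} \<times> {-c..c}" "B2 \<subseteq> {-a..a} \<times> {-c..c}" "B3 \<subseteq> {-a..a} \<times> {-b..b}"
    unfolding B1_def B2_def B3_def by auto
  have fr: "frontier ?O \<in> sets borel" by (intro borel_closed frontier_closed)
  have surf: "surface_measure ?O = restrict_space ?H (frontier ?O)"
    by (simp add: surface_measure_def numeral_2_eq_2)
  have split: "indicator (frontier ?O) p * g p =
      indicator (P1 a ` B1) p * g p + indicator (P1 (- a) ` B1) p * g p
      + indicator (P2 b ` B2) p * g p + indicator (P2 (- b) ` B2) p * g p
      + indicator (P3 c ` B3) p * g p + indicator (P3 (- c) ` B3) p * g p" for g :: "_ \<Rightarrow> real" and p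
  proof -
    obtain x y z where p: "p = (x, y, z)" by (metis prod.collapse)
    have "(indicator (frontier ?O) p :: real) =
      indicator (P1 a ` B1) p + indicator (P1 (- a) ` B1) p + indicator (P2 b ` B2) p
      + indicator (P2 (- b) ` B2) p + indicator (P3 c ` B3) p + indicator (P3 (- c) ` B3) p"
    proof -
      \<comment> \<open>With one-dimensional indicators the decomposition is the expansion of a product.\<close>
      have split1: "(indicator {-s..s} t :: real) = indicator {s} t + indicator {-s} t + indicator {-s<..<s} t"
        if "s > 0" for s t :: real
        using that by (auto simp: indicator_def)
      have "(indicator (frontier ?O) p :: real)
          = indicator (cbox3 a b c) p - indicator ?O p"
        unfolding frontier_box3[OF pos] by (auto simp: indicator_def)
      then show ?thesis
        unfolding im p indicator_times fst_conv snd_conv split1[OF pos(1)] split1[OF pos(2)] split1[OF pos(3)]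
        by (simp add: algebra_simps)
    qed
    then show ?thesis by (simp add: distrib_right)
  qed
  have I: "integrable ?H (\<lambda>p. indicator (frontier ?O) p * g p)"
    "(LINT p|?H. indicator (frontier ?O) p * g p) = 8 * r * face_sum a b c g"
    if g: "continuous_on UNIV g" for g
  proof -
    note F1 = face_integral[OF isom(1) less_imp_le[OF r(1)] r(2) B(1) PB(1) g cpt sub(1)]
    note F2 = face_integral[OF isom(2) less_imp_le[OF r(1)] r(2) B(2) PB(2) g cpt sub(2)]
    note F3 = face_integral[OF isom(3) less_imp_le[OF r(1)] r(2) B(3) PB(3) g cpt sub(3)]
    show "integrable ?H (\<lambda>p. indicator (frontier ?O) p * g p)"
      unfolding split by (intro Bochner_Integration.integrable_add F1(1) F2(1) F3(1))
    have cP: "continuous_on UNIV (\<lambda>q. g (P1 s q))" "continuous_on UNIV (\<lambda>q. g (P2 s q))" "continuous_on UNIV (\<lambda>q. g (P3 s q))" for s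
      unfolding P1_def P2_def P3_def case_prod_unfold
      by (intro continuous_on_compose2[OF g] continuous_intros; simp)+
    have A: "(LINT q|lborel. indicator B1 q * f q) = 4 * b * c * avg2 b c f"
      "(LINT q|lborel. indicator B2 q * f q) = 4 * a * c * avg2 a c f"
      "(LINT q|lborel. indicator B3 q * f q) = 4 * a * b * avg2 a b f" if "continuous_on UNIV f" for f
      by (rule avg2_eq_lborel_between; use pos that B in \<open>force simp: B1_def B2_def B3_def\<close>)+
    have add: "avg2 s t f + avg2 s t h = 2 * avg2 s t (\<lambda>q. (f q + h q) / 2)"
      if "s > 0" "t > 0" "continuous_on UNIV f" "continuous_on UNIV h" for s t f h
    proof -
      have "4 * s * t * (avg2 s t f + avg2 s t h) = 4 * s * t * (2 * avg2 s t (\<lambda>q. (f q + h q) / 2))"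
        using avg2_eq_lborel[OF that(1,2,3)] avg2_eq_lborel[OF that(1,2,4)]
          avg2_eq_lborel[OF that(1,2), of "\<lambda>q. (f q + h q) / 2"] that(3,4)
          integrable_indicator_compact[OF that(3) cpt] integrable_indicator_compact[OF that(4) cpt]
        by (simp add: continuous_intros distrib_left)
      then show ?thesis using that(1,2) by simp
    qed
    have "(LINT p|?H. indicator (frontier ?O) p * g p) =
      r * (4 * b * c * (avg2 b c (\<lambda>q. g (P1 a q)) + avg2 b c (\<lambda>q. g (P1 (- a) q)))
        + 4 * a * c * (avg2 a c (\<lambda>q. g (P2 b q)) + avg2 a c (\<lambda>q. g (P2 (- b) q)))
        + 4 * a * b * (avg2 a b (\<lambda>q. g (P3 c q)) + avg2 a b (\<lambda>q. g (P3 (- c) q))))"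
      unfolding split
      by (simp add: F1 F2 F3 A cP distrib_left)
    also have "\<dots> = r * (8 * b * c * avg2 b c (\<lambda>q. (g (P1 a q) + g (P1 (- a) q)) / 2)
        + 8 * a * c * avg2 a c (\<lambda>q. (g (P2 b q) + g (P2 (- b) q)) / 2)
        + 8 * a * b * avg2 a b (\<lambda>q. (g (P3 c q) + g (P3 (- c) q)) / 2))"
      by (simp add: add pos cP)
    finally show "(LINT p|?H. indicator (frontier ?O) p * g p) = 8 * r * face_sum a b c g"
      by (simp add: face_sum_def P1_def P2_def P3_def case_prod_unfold algebra_simps)
  qed
  show ?thesis
  proof (intro exI[of _ "8 * r"] conjI allI impI)
    fix g :: "R3 \<Rightarrow> real" assume g: "continuous_on UNIV g"
    show "integrable (surface_measure ?O) g"
      unfolding surf by (subst integrable_restrict_space) (use fr I(1)[OF g] in auto)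
    show "(LINT p|surface_measure ?O. g p) = 8 * r * face_sum a b c g"
      unfolding surf by (subst integral_restrict_space) (use fr I(2)[OF g] in auto)
  qed (use r in auto)
qed

section \<open>Smooth functions and uniqueness of weak gradients\<close>

lemma Ck_SucI:
  assumes "\<And>x. (f has_derivative f' x) (at x)" and "\<And>i. i \<in> Basis \<Longrightarrow> Ck k (\<lambda>x. f' x i)"
  shows "Ck (Suc k) f"
proof -
  have "frechet_derivative f (at x) = f' x" for x
    using frechet_derivative_at[OF assms(1)] by simp
  then show ?thesis
    using assms by (auto simp: differentiable_def)
qed

lemma Ck_SucD: "Ck (Suc k) f \<Longrightarrow> (f has_derivative frechet_derivative f (at x)) (at x)"
  by (simp add: frechet_derivative_works[symmetric])

lemma Ck_pred: "Ck (Suc k) f \<Longrightarrow> Ck k f"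
proof (induction k arbitrary: f)
  case 0
  then show ?case
    by (auto intro!: continuous_at_imp_continuous_on differentiable_imp_continuous_within)
next
  case (Suc k)
  then show ?case by (metis Ck.simps(2))
qed

lemma Ck_const: "Ck k (\<lambda>_. r)"
proof (induction k arbitrary: r)
  case (Suc k)
  show ?case by (rule Ck_SucI[of _ "\<lambda>_ _. 0"]) (auto intro: Suc)
qed simp

lemma Ck_add: "Ck k f \<Longrightarrow> Ck k g \<Longrightarrow> Ck k (\<lambda>x. f x + g x)"
proof (induction k arbitrary: f g)
  case (Suc k)
  show ?case
    by (rule Ck_SucI[OF has_derivative_add[OF Ck_SucD[OF Suc.prems(1)] Ck_SucD[OF Suc.prems(2)]]])
       (use Suc in auto)
qed (auto intro: continuous_on_add)

lemma Ck_mult: "Ck k f \<Longrightarrow> Ck k g \<Longrightarrow> Ck k (\<lambda>x. f x * g x)"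
proof (induction k arbitrary: f g)
  case (Suc k)
  show ?case
    by (rule Ck_SucI[OF has_derivative_mult[OF Ck_SucD[OF Suc.prems(1)] Ck_SucD[OF Suc.prems(2)]]])
       (use Suc Ck_pred[OF Suc.prems(1)] Ck_pred[OF Suc.prems(2)] in \<open>auto intro!: Ck_add\<close>)
qed (auto intro: continuous_on_mult)

lemma smooth_const: "smooth (\<lambda>_. r)"
  by (simp add: smooth_def Ck_const)

lemma smooth_add: "smooth f \<Longrightarrow> smooth g \<Longrightarrow> smooth (\<lambda>x. f x + g x)"
  by (simp add: smooth_def Ck_add)

lemma smooth_mult: "smooth f \<Longrightarrow> smooth g \<Longrightarrow> smooth (\<lambda>x. f x * g x)"
  by (simp add: smooth_def Ck_mult)

lemma smooth_diff: "smooth f \<Longrightarrow> smooth g \<Longrightarrow> smooth (\<lambda>x. f x - g x)"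
  using smooth_add[of f "\<lambda>x. (- 1) * g x"] smooth_mult[OF smooth_const, of g "- 1"] by simp

lemma smooth_power: "smooth f \<Longrightarrow> smooth (\<lambda>x. f x ^ n)"
  by (induction n) (auto intro: smooth_const smooth_mult)

lemma smooth_prod: "(\<And>i. i \<in> I \<Longrightarrow> smooth (f i)) \<Longrightarrow> smooth (\<lambda>x. \<Prod>i\<in>I. f i x)"
  by (induction I rule: infinite_finite_induct) (auto intro: smooth_const smooth_mult)

lemma smooth_has_derivative: "smooth f \<Longrightarrow> (f has_derivative frechet_derivative f (at x)) (at x)"
  using Ck_SucD smooth_def by blast

lemma smooth_continuous: "smooth f \<Longrightarrow> continuous_on S f"
  unfolding smooth_def by (metis Ck.simps(1) continuous_on_subset subset_UNIV)

lemma smooth_continuous_deriv: "smooth f \<Longrightarrow> i \<in> Basis \<Longrightarrow> continuous_on S (\<lambda>x. frechet_derivative f (at x) i)"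
  unfolding smooth_def
  by (metis Ck.simps(1) Ck.simps(2) continuous_on_subset subset_UNIV)

text \<open>
  If a family of functions of one real variable is closed under differentiation up to linear
  combinations, then all its members are smooth, and so are the ridge functions built from them.
  The induction needs the whole family at once.
\<close>

lemma smooth_ridge:
  fixes F :: "nat \<Rightarrow> real \<Rightarrow> real" and v :: "'a::euclidean_space"
  assumes "\<And>n t. (F n has_real_derivative a n * F (p n) t + b n * F (q n) t) (at t)"
  shows "smooth (\<lambda>x. F n (x \<bullet> v + r))"
proof -
  have "Ck k (\<lambda>x. F n (x \<bullet> v + r))" for k n
  proof (induction k arbitrary: n)
    case 0
    have "continuous_on UNIV (F n)"
      using assms DERIV_isCont by (blast intro: continuous_at_imp_continuous_on)
    then show ?case
      by (auto intro!: continuous_on_compose2[of UNIV "F n"] continuous_intros)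
  next
    case (Suc k)
    let ?D = "\<lambda>t. a n * F (p n) t + b n * F (q n) t"
    have "((\<lambda>x. F n (x \<bullet> v + r)) has_derivative (\<lambda>h. ?D (x \<bullet> v + r) * (h \<bullet> v))) (at x)" for x
      by (rule has_derivative_compose[OF _ assms[unfolded has_field_derivative_def]])
         (auto intro!: derivative_eq_intros)
    then show ?case
      by (rule Ck_SucI) (intro Ck_mult Ck_add Ck_const Suc)
  qed
  then show ?thesis by (simp add: smooth_def)
qed

text \<open>
  The functions \<open>t\<^sup>-\<^sup>n exp (- 1 / t)\<close>, extended by \<open>0\<close> to \<open>t \<le> 0\<close>. The power is carried along because
  differentiation raises it: it makes the family closed under differentiation.
\<close>

definition flat :: "nat \<Rightarrow> real \<Rightarrow> real" where
  "flat n t = (if t \<le> 0 then 0 else (1 / t) ^ n * exp (- (1 / t)))"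

lemma flat_derivative:
  "(flat n has_real_derivative (- real n) * flat (n + 1) t + 1 * flat (n + 2) t) (at t)"
proof -
  consider "t < 0" | "t > 0" | "t = 0" by linarith
  then show ?thesis
  proof cases
    case 1
    have "((\<lambda>_. 0) has_real_derivative 0) (at t)" by simp
    then have "(flat n has_real_derivative 0) (at t)"
      by (rule has_field_derivative_transform_within_open[of _ _ _ "{..<0}"]) (use 1 in \<open>auto simp: flat_def\<close>)
    then show ?thesis using 1 by (simp add: flat_def)
  next
    case 2
    have "((\<lambda>t. (1 / t) ^ n * exp (- (1 / t))) has_real_derivative
       (- real n) * flat (n + 1) t + 1 * flat (n + 2) t) (at t)" (is ?D)
    proof -
      define s where "s = 1 / t"
      have d: "((\<lambda>t. 1 / t) has_real_derivative - (s\<^sup>2)) (at t)"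
        using 2 by (auto intro!: derivative_eq_intros simp: power2_eq_square s_def)
      have fl: "flat m t = s ^ m * exp (- s)" for m
        using 2 by (simp add: flat_def s_def)
      show ?D
        by (rule DERIV_cong[OF DERIV_mult[OF DERIV_power[OF d] DERIV_fun_exp[OF DERIV_minus[OF d]]]],
            unfold fl, fold s_def, cases n) (simp_all add: power2_eq_square algebra_simps)
    qed
    then show ?thesis
      by (rule has_field_derivative_transform_within_open[of _ _ _ "{0<..}"]) (use 2 in \<open>auto simp: flat_def\<close>)
  next
    case 3
    have "((\<lambda>h. flat n h / h) \<longlongrightarrow> 0) (at 0)"
    proof (rule filterlim_split_at)
      have "\<forall>\<^sub>F h in at_left 0. flat n h / h = 0"
        by (auto simp: eventually_at_filter flat_def)
      then show "((\<lambda>h. flat n h / h) \<longlongrightarrow> 0) (at_left 0)"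
        by (rule tendsto_eventually)
      have "((\<lambda>h. inverse h ^ (n + 1) / exp (inverse h)) \<longlongrightarrow> 0) (at_right (0 :: real))"
        by (rule filterlim_compose[OF tendsto_power_div_exp_0 filterlim_inverse_at_top_right])
      moreover have "\<forall>\<^sub>F h in at_right 0. inverse h ^ (n + 1) / exp (inverse h) = flat n h / h"
        by (auto simp: eventually_at_filter flat_def exp_minus field_simps)
      ultimately show "((\<lambda>h. flat n h / h) \<longlongrightarrow> 0) (at_right 0)"
        by (rule Lim_transform_eventually)
    qed
    then show ?thesis
      using 3 by (simp add: has_field_derivative_iff flat_def)
  qed
qed

lemma smooth_flat: "smooth (\<lambda>x. flat 0 (x \<bullet> v + r))"
  by (rule smooth_ridge[OF flat_derivative])

lemma flat_0: "0 \<le> flat 0 t" "flat 0 t < 1" "0 < flat 0 t \<longleftrightarrow> 0 < t"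
  by (auto simp: flat_def)

definition bump :: "'a::euclidean_space \<Rightarrow> 'a \<Rightarrow> 'a \<Rightarrow> real" where
  "bump p q x = (\<Prod>i\<in>Basis. flat 0 (x \<bullet> i - p \<bullet> i) * flat 0 (q \<bullet> i - x \<bullet> i))"

lemma smooth_bump: "smooth (bump p q)"
proof -
  have "smooth (\<lambda>x. flat 0 (x \<bullet> i + (- p \<bullet> i)) * flat 0 (x \<bullet> (- i) + q \<bullet> i))" for i
    by (intro smooth_mult smooth_flat)
  then show ?thesis
    unfolding bump_def[abs_def] by (intro smooth_prod) (simp add: algebra_simps)
qed

lemma bump_bounds: "0 \<le> bump p q x" "bump p q x \<le> 1"
  unfolding bump_def
  by (auto intro!: prod_nonneg prod_le_1 mult_nonneg_nonneg mult_le_one simp: flat_0 less_imp_le)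

lemma bump_pos_iff: "0 < bump p q x \<longleftrightarrow> x \<in> box p q"
proof
  assume "x \<in> box p q"
  then show "0 < bump p q x"
    unfolding bump_def by (intro prod_pos mult_pos_pos) (auto simp: flat_0 mem_box)
next
  assume *: "0 < bump p q x"
  show "x \<in> box p q"
    unfolding mem_box
  proof
    fix i :: 'a assume i: "i \<in> Basis"
    have "flat 0 (x \<bullet> i - p \<bullet> i) * flat 0 (q \<bullet> i - x \<bullet> i) \<noteq> 0"
      using * i unfolding bump_def by (metis (no_types, lifting) finite_Basis less_irrefl prod_zero)
    then show "p \<bullet> i < x \<bullet> i \<and> x \<bullet> i < q \<bullet> i"
      by (auto simp: flat_def split: if_splits)
  qed
qed

text \<open>
  On the open box \<open>0 < bump \<le> 1\<close>, and outside it \<^const>\<open>bump\<close> vanishes. So these smooth functions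
  tend to the indicator function of the open box, with values in the unit interval.
\<close>

definition plateau :: "'a::euclidean_space \<Rightarrow> 'a \<Rightarrow> nat \<Rightarrow> 'a \<Rightarrow> real" where
  "plateau p q n x = 1 - (1 - bump p q x) ^ n"

lemma test_function_plateau:
  assumes "cbox p q \<subseteq> \<Omega>"
  shows "test_function \<Omega> (plateau p q n)"
proof -
  have "{x. plateau p q n x \<noteq> 0} \<subseteq> box p q"
    using bump_pos_iff[of p q] bump_bounds(1)[of p q] by (force simp: plateau_def less_le)
  then have "closure {x. plateau p q n x \<noteq> 0} \<subseteq> cbox p q"
    by (meson box_subset_cbox closed_cbox closure_minimal order_trans)
  moreover have "smooth (plateau p q n)"
    unfolding plateau_def[abs_def] by (intro smooth_diff smooth_power smooth_const smooth_bump)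
  ultimately show ?thesis
    using assms by (auto simp: test_function_def compact_closure intro: bounded_subset[OF bounded_cbox]
        dest: subset_trans[OF closure_subset])
qed

lemma plateau_bounds: "\<bar>plateau p q n x\<bar> \<le> 1"
  using bump_bounds[of p q x] power_le_one[of "1 - bump p q x" n] zero_le_power[of "1 - bump p q x" n]
  unfolding plateau_def by linarith

lemma plateau_tendsto: "(\<lambda>n. plateau p q n x) \<longlonglongrightarrow> indicator (box p q) x"
proof (cases "x \<in> box p q")
  case True
  then have "(\<lambda>n. (1 - bump p q x) ^ n) \<longlonglongrightarrow> 0"
    using bump_bounds(2)[of p q x] bump_pos_iff[of p q x] by (intro LIMSEQ_power_zero) (simp add: abs_less_iff)
  then have "(\<lambda>n. 1 - (1 - bump p q x) ^ n) \<longlonglongrightarrow> 1 - 0"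
    by (rule tendsto_diff[OF tendsto_const])
  then show ?thesis using True by (simp add: plateau_def)
next
  case False
  then have "bump p q x = 0"
    using bump_bounds(1)[of p q x] bump_pos_iff[of p q x] by linarith
  then show ?thesis using False by (simp add: plateau_def)
qed

text \<open>
  The fundamental lemma of the calculus of variations. Plateau functions show that the
  integral of \<open>f\<close> over every closed box inside \<open>\<Omega>\<close> is zero, and at almost every point \<open>f\<close> is the
  limit of its averages over small boxes.
\<close>

lemma test_function_null_imp_null:
  fixes f :: "'a::euclidean_space \<Rightarrow> real"
  assumes "open \<Omega>" and f: "integrable (lebesgue_on \<Omega>) f"
    and null: "\<And>\<phi>. test_function \<Omega> \<phi> \<Longrightarrow> (LINT x|lebesgue_on \<Omega>. f x * \<phi> x) = 0"
  shows "AE x in lebesgue_on \<Omega>. f x = 0"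
proof -
  have \<Omega>: "\<Omega> \<in> sets lebesgue" using \<open>open \<Omega>\<close> by simp
  define g where "g x = indicator \<Omega> x * f x" for x
  have g: "integrable lebesgue g"
    using f unfolding g_def by (subst (asm) integrable_restrict_space) (use \<Omega> in auto)
  have box0: "integral (cbox p q) g = 0" if pq: "cbox p q \<subseteq> \<Omega>" for p q
  proof -
    have "(\<lambda>n. LINT x|lebesgue. g x * plateau p q n x) \<longlonglongrightarrow> (LINT x|lebesgue. g x * indicator (box p q) x)"
    proof (rule integral_dominated_convergence[where w = "\<lambda>x. \<bar>g x\<bar>"])
      show "(\<lambda>x. g x * plateau p q n x) \<in> borel_measurable lebesgue" for n
      proof (rule borel_measurable_times)
        have "continuous_on UNIV (plateau p q n)"
          using test_function_plateau[OF pq] by (simp add: test_function_def smooth_continuous)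
        then show "plateau p q n \<in> borel_measurable lebesgue"
          by (intro measurable_completion) (simp add: borel_measurable_continuous_onI)
      qed (use g in auto)
      show "AE x in lebesgue. norm (g x * plateau p q n x) \<le> \<bar>g x\<bar>" for n
        using plateau_bounds[of p q n] by (auto simp: abs_mult mult_left_le)
      show "(\<lambda>x. g x * indicator (box p q) x) \<in> borel_measurable lebesgue"
        using g by (intro borel_measurable_times borel_measurable_indicator) auto
    qed (use g in \<open>auto intro!: tendsto_intros plateau_tendsto\<close>)
    moreover have "(LINT x|lebesgue. g x * plateau p q n x) = 0" for n
      using null[OF test_function_plateau[OF pq, of n]]
      by (subst (asm) integral_restrict_space) (use \<Omega> in \<open>auto simp: g_def mult.assoc\<close>)
    ultimately have 0: "(LINT x|lebesgue. g x * indicator (box p q) x) = 0"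
      by (simp add: LIMSEQ_const_iff)
    have "integrable lebesgue (\<lambda>x. g x * indicator (box p q) x)"
      using g by (intro integrable_real_mult_indicator) auto
    from has_integral_integral_lebesgue[OF this]
    have "((\<lambda>x. if x \<in> box p q then g x else 0) has_integral 0) UNIV"
      unfolding 0 by (rule has_integral_eq[rotated]) auto
    then show ?thesis
      by (simp add: has_integral_restrict_UNIV has_integral_open_interval integral_unique)
  qed
  have "g integrable_on cbox a b" for a b
    using g integrable_on_lebesgue integrable_on_subcbox by blast
  then obtain N where N: "negligible N"
    "\<And>x e. x \<notin> N \<Longrightarrow> 0 < e \<Longrightarrow> \<exists>d>0. \<forall>h. 0 < h \<and> h < d \<longrightarrow>
        norm (integral (cbox x (x + h *\<^sub>R One)) g /\<^sub>R h ^ DIM('a) - g x) < e"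
    by (rule integrable_ccontinuous_explicit[of g]) blast
  have g0: "g x = 0" if x: "x \<in> \<Omega>" "x \<notin> N" for x
  proof (rule ccontr)
    assume "g x \<noteq> 0"
    then obtain d where d: "d > 0" "\<And>h. 0 < h \<Longrightarrow> h < d \<Longrightarrow>
        norm (integral (cbox x (x + h *\<^sub>R One)) g /\<^sub>R h ^ DIM('a) - g x) < norm (g x)"
      using N(2)[OF x(2), of "norm (g x)"] by auto
    obtain r where r: "r > 0" "ball x r \<subseteq> \<Omega>"
      using \<open>open \<Omega>\<close> x(1) open_contains_ball by blast
    define h where "h = min (d / 2) (r / (2 * real DIM('a)))"
    have h: "0 < h" "h < d" using d(1) r(1) by (auto simp: h_def)
    have "cbox x (x + h *\<^sub>R One) \<subseteq> ball x r"
    proof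
      fix y assume y: "y \<in> cbox x (x + h *\<^sub>R One)"
      have "norm (y - x) \<le> (\<Sum>i\<in>Basis. \<bar>(y - x) \<bullet> i\<bar>)" by (rule norm_le_l1)
      also have "\<dots> \<le> (\<Sum>i\<in>(Basis :: 'a set). h)"
        using y by (intro sum_mono) (auto simp: mem_box inner_simps abs_le_iff)
      also have "\<dots> = DIM('a) * h" by simp
      also have "\<dots> \<le> DIM('a) * (r / (2 * real DIM('a)))"
        by (intro mult_left_mono) (auto simp: h_def)
      also have "\<dots> < r" using r(1) by simp
      finally show "y \<in> ball x r" by (simp add: dist_norm norm_minus_commute)
    qed
    then have "integral (cbox x (x + h *\<^sub>R One)) g = 0" using r(2) by (intro box0) auto
    then show False using d(2)[OF h] by simp
  qed
  have "AE x in lebesgue. x \<in> \<Omega> \<longrightarrow> f x = 0"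
    using N(1) g0 unfolding eventually_ae_filter negligible_iff_null_sets
    by (intro bexI[of _ N]) (auto simp: g_def)
  then show ?thesis
    using \<Omega> by (subst AE_restrict_space_iff) auto
qed

lemma integrable_of_square_integrable:
  fixes f :: "'a \<Rightarrow> 'b::euclidean_space"
  assumes "finite_measure M" "square_integrable M f"
  shows "integrable M f"
proof -
  interpret finite_measure M by fact
  have "integrable M (\<lambda>x. 1 + (norm (f x))\<^sup>2)"
    using assms(2) by (auto simp: square_integrable_def)
  then show ?thesis
  proof (rule Bochner_Integration.integrable_bound)
    show "f \<in> borel_measurable M" using assms(2) by (simp add: square_integrable_def)
    have "t \<le> 1 + t\<^sup>2" for t :: real
      using zero_le_power2[of "t - 1/2"] by (simp add: power2_eq_square algebra_simps)
    then show "AE x in M. norm (f x) \<le> norm (1 + (norm (f x))\<^sup>2)"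
      by (auto intro!: AE_I2 simp: abs_of_nonneg)
  qed
qed

lemma test_function_bounded:
  assumes "test_function \<Omega> \<phi>"
  obtains B where "\<And>x. \<bar>\<phi> x\<bar> \<le> B"
proof -
  let ?S = "closure {x. \<phi> x \<noteq> 0}"
  have "compact (\<phi> ` ?S)"
    using assms by (intro compact_continuous_image smooth_continuous) (auto simp: test_function_def)
  then obtain B where B: "\<And>x. x \<in> ?S \<Longrightarrow> norm (\<phi> x) \<le> B"
    by (meson bounded_iff compact_imp_bounded image_eqI)
  have "\<bar>\<phi> x\<bar> \<le> max B 0" for x
    using B[of x] closure_subset[of "{x. \<phi> x \<noteq> 0}"] by (cases "\<phi> x = 0") (auto simp: le_max_iff_disj)
  then show ?thesis by (rule that)
qed

lemma weak_grad_unique: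
  fixes \<Omega> :: "'a::euclidean_space set"
  assumes "open \<Omega>" and fin: "finite_measure (lebesgue_on \<Omega>)"
    and G: "has_L2_weak_grad \<Omega> w G" "has_L2_weak_grad \<Omega> w G'"
  shows "AE x in lebesgue_on \<Omega>. G x = G' x"
proof -
  have int: "integrable (lebesgue_on \<Omega>) G" "integrable (lebesgue_on \<Omega>) G'"
    using G fin by (auto simp: has_L2_weak_grad_def intro: integrable_of_square_integrable)
  have "AE x in lebesgue_on \<Omega>. (G x - G' x) \<bullet> i = 0" if i: "i \<in> Basis" for i
  proof (rule test_function_null_imp_null[OF \<open>open \<Omega>\<close>])
    show "integrable (lebesgue_on \<Omega>) (\<lambda>x. (G x - G' x) \<bullet> i)"
      using int by auto
    fix \<phi> assume \<phi>: "test_function \<Omega> \<phi>"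
    obtain B where B: "\<And>x. \<bar>\<phi> x\<bar> \<le> B" using test_function_bounded[OF \<phi>] by blast
    have \<phi>m: "\<phi> \<in> borel_measurable (lebesgue_on \<Omega>)"
      using \<phi> smooth_continuous[of \<phi> UNIV]
      by (intro measurable_restrict_space1 measurable_completion)
         (auto simp: test_function_def borel_measurable_continuous_onI)
    have I: "integrable (lebesgue_on \<Omega>) (\<lambda>x. (H x \<bullet> i) * \<phi> x)" if "integrable (lebesgue_on \<Omega>) H" for H
    proof (rule Bochner_Integration.integrable_bound)
      show "integrable (lebesgue_on \<Omega>) (\<lambda>x. B * norm (H x))" using that by auto
      show "AE x in lebesgue_on \<Omega>. norm ((H x \<bullet> i) * \<phi> x) \<le> norm (B * norm (H x))"
      proof (rule AE_I2)
        fix x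
        have "\<bar>H x \<bullet> i\<bar> * \<bar>\<phi> x\<bar> \<le> norm (H x) * B"
          using i B[of x] by (intro mult_mono Basis_le_norm) auto
        also have "\<dots> \<le> \<bar>B * norm (H x)\<bar>" by (simp add: mult.commute)
        finally show "norm ((H x \<bullet> i) * \<phi> x) \<le> norm (B * norm (H x))"
          by (simp add: abs_mult)
      qed
    qed (use that \<phi>m in measurable)
    have "(LINT x|lebesgue_on \<Omega>. ((G x - G' x) \<bullet> i) * \<phi> x)
        = (LINT x|lebesgue_on \<Omega>. (G x \<bullet> i) * \<phi> x - (G' x \<bullet> i) * \<phi> x)"
      by (simp add: inner_diff_left left_diff_distrib)
    also have "\<dots> = (LINT x|lebesgue_on \<Omega>. (G x \<bullet> i) * \<phi> x) - (LINT x|lebesgue_on \<Omega>. (G' x \<bullet> i) * \<phi> x)"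
      by (intro Bochner_Integration.integral_diff I int)
    also have "\<dots> = 0"
    proof -
      have "(LINT x|lebesgue_on \<Omega>. w x * frechet_derivative \<phi> (at x) i)
          = - (LINT x|lebesgue_on \<Omega>. (H x \<bullet> i) * \<phi> x)" if "has_L2_weak_grad \<Omega> w H" for H
        using that \<phi> i unfolding has_L2_weak_grad_def by blast
      from this[OF G(1)] this[OF G(2)] show ?thesis by linarith
    qed
    finally show "(LINT x|lebesgue_on \<Omega>. ((G x - G' x) \<bullet> i) * \<phi> x) = 0" .
  qed
  then have "AE x in lebesgue_on \<Omega>. \<forall>i\<in>Basis. (G x - G' x) \<bullet> i = 0"
    by (subst AE_ball_countable) (auto simp: countable_finite)
  then show ?thesis
    by eventually_elim (metis euclidean_all_zero_iff right_minus_eq)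
qed

section \<open>The norm of square-integrable functions\<close>

lemma square_integrable_add:
  fixes f g :: "'a \<Rightarrow> 'b::euclidean_space"
  assumes "square_integrable M f" "square_integrable M g"
  shows "square_integrable M (\<lambda>x. f x + g x)"
  unfolding square_integrable_def
proof
  show m: "(\<lambda>x. f x + g x) \<in> borel_measurable M"
    using assms by (auto simp: square_integrable_def)
  have "integrable M (\<lambda>x. 2 * (norm (f x))\<^sup>2 + 2 * (norm (g x))\<^sup>2)"
    using assms by (auto simp: square_integrable_def)
  then show "integrable M (\<lambda>x. (norm (f x + g x))\<^sup>2)"
  proof (rule Bochner_Integration.integrable_bound)
    show "(\<lambda>x. (norm (f x + g x))\<^sup>2) \<in> borel_measurable M" using m by measurable
    have "(norm (u + v))\<^sup>2 \<le> 2 * (norm u)\<^sup>2 + 2 * (norm v)\<^sup>2" for u v :: 'b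
    proof -
      have "(norm (u + v))\<^sup>2 \<le> (norm u + norm v)\<^sup>2"
        by (intro power_mono norm_triangle_ineq) auto
      also have "\<dots> \<le> 2 * (norm u)\<^sup>2 + 2 * (norm v)\<^sup>2"
        using zero_le_power2[of "norm u - norm v"] by (simp add: power2_eq_square algebra_simps)
      finally show ?thesis .
    qed
    then show "AE x in M. norm ((norm (f x + g x))\<^sup>2) \<le> norm (2 * (norm (f x))\<^sup>2 + 2 * (norm (g x))\<^sup>2)"
      by (auto intro!: AE_I2)
  qed
qed

lemma square_integrable_minus: "square_integrable M f \<Longrightarrow> square_integrable M (\<lambda>x. - f x)"
  by (simp add: square_integrable_def)

lemma square_integrable_diff:
  "square_integrable M f \<Longrightarrow> square_integrable M g \<Longrightarrow> square_integrable M (\<lambda>x. f x - g x)"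
  using square_integrable_add[OF _ square_integrable_minus, of M f g] by simp

lemma l2norm_nonneg: "0 \<le> l2norm M f"
  by (simp add: l2norm_def)

lemma l2norm_power2: "(l2norm M f)\<^sup>2 = (LINT x|M. (norm (f x))\<^sup>2)"
  by (simp add: l2norm_def)

lemma l2norm_minus_commute: "l2norm M (\<lambda>x. f x - g x) = l2norm M (\<lambda>x. g x - f x)"
  by (simp add: l2norm_def norm_minus_commute)

text \<open>
  Young's inequality in the form in which optimal \<open>a\<close> and \<open>b\<close> yield the triangle inequality.
\<close>

lemma young_square:
  fixes s t :: real
  assumes "a > 0" "b > 0"
  shows "(s + t)\<^sup>2 \<le> (1 + b / a) * s\<^sup>2 + (1 + a / b) * t\<^sup>2"
proof -
  have "0 \<le> (b * s - a * t)\<^sup>2 / (a * b)" using assms by simp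
  also have "\<dots> = (b / a) * s\<^sup>2 + (a / b) * t\<^sup>2 - 2 * s * t"
    using assms by (simp add: power2_eq_square field_simps)
  finally show ?thesis by (simp add: power2_eq_square algebra_simps)
qed

lemma l2norm_triangle:
  fixes f g :: "'a \<Rightarrow> 'b::euclidean_space"
  assumes f: "square_integrable M f" and g: "square_integrable M g"
  shows "l2norm M (\<lambda>x. f x + g x) \<le> l2norm M f + l2norm M g"
proof -
  \<comment> \<open>Young's inequality divides by the norms, which may vanish; so they are first enlarged.\<close>
  have *: "l2norm M (\<lambda>x. f x + g x) \<le> a + b" if a: "l2norm M f < a" and b: "l2norm M g < b" for a b
  proof -
    have pos: "a > 0" "b > 0" using a b l2norm_nonneg[of M f] l2norm_nonneg[of M g] by auto
    have i: "integrable M (\<lambda>x. (norm (f x))\<^sup>2)" "integrable M (\<lambda>x. (norm (g x))\<^sup>2)"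
      using f g by (auto simp: square_integrable_def)
    have "(l2norm M (\<lambda>x. f x + g x))\<^sup>2 = (LINT x|M. (norm (f x + g x))\<^sup>2)"
      by (rule l2norm_power2)
    also have "\<dots> \<le> (LINT x|M. (1 + b / a) * (norm (f x))\<^sup>2 + (1 + a / b) * (norm (g x))\<^sup>2)"
    proof (rule integral_mono)
      show "integrable M (\<lambda>x. (norm (f x + g x))\<^sup>2)"
        using square_integrable_add[OF f g] by (simp add: square_integrable_def)
      fix x
      have "(norm (f x + g x))\<^sup>2 \<le> (norm (f x) + norm (g x))\<^sup>2"
        by (intro power_mono norm_triangle_ineq) auto
      also have "\<dots> \<le> (1 + b / a) * (norm (f x))\<^sup>2 + (1 + a / b) * (norm (g x))\<^sup>2"
        by (rule young_square[OF pos])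
      finally show "(norm (f x + g x))\<^sup>2 \<le> \<dots>" .
    qed (use i in auto)
    also have "\<dots> = (1 + b / a) * (l2norm M f)\<^sup>2 + (1 + a / b) * (l2norm M g)\<^sup>2"
      using i by (simp add: l2norm_power2)
    also have "\<dots> \<le> (1 + b / a) * a\<^sup>2 + (1 + a / b) * b\<^sup>2"
      using pos a b by (intro add_mono mult_left_mono power_mono) (auto simp: l2norm_nonneg)
    also have "\<dots> = (a + b)\<^sup>2"
      using pos by (simp add: power2_eq_square field_simps)
    finally show ?thesis
      by (rule power2_le_imp_le) (use pos in auto)
  qed
  show ?thesis
  proof (rule field_le_epsilon)
    fix e :: real assume "e > 0"
    then show "l2norm M (\<lambda>x. f x + g x) \<le> l2norm M f + l2norm M g + e"
      using *[of "l2norm M f + e / 2" "l2norm M g + e / 2"] by simp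
  qed
qed

lemma l2norm_tendsto:
  fixes f :: "nat \<Rightarrow> 'a \<Rightarrow> 'b::euclidean_space"
  assumes f: "\<And>n. square_integrable M (f n)" and g: "square_integrable M g"
    and lim: "(\<lambda>n. l2norm M (\<lambda>x. f n x - g x)) \<longlonglongrightarrow> 0"
  shows "(\<lambda>n. l2norm M (f n)) \<longlonglongrightarrow> l2norm M g"
proof -
  have "\<bar>l2norm M (f n) - l2norm M g\<bar> \<le> l2norm M (\<lambda>x. f n x - g x)" for n
  proof -
    have "l2norm M (f n) \<le> l2norm M (\<lambda>x. f n x - g x) + l2norm M g"
      using l2norm_triangle[OF square_integrable_diff[OF f[of n] g] g] by simp
    moreover have "l2norm M g \<le> l2norm M (\<lambda>x. g x - f n x) + l2norm M (f n)"
      using l2norm_triangle[OF square_integrable_diff[OF g f[of n]] f[of n]] by simp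
    ultimately show ?thesis
      by (simp add: l2norm_minus_commute[of M g] abs_le_iff)
  qed
  then have "(\<lambda>n. l2norm M (f n) - l2norm M g) \<longlonglongrightarrow> 0"
    by (intro tendsto_rabs_zero_cancel[OF tendsto_sandwich[OF _ _ tendsto_const lim]]) auto
  then show ?thesis by (simp add: LIM_zero_iff)
qed

text \<open>
  The Cauchy-Schwarz inequality against the constant \<open>1\<close>: expand the integral of \<open>(m f - s)\<^sup>2\<close>.
\<close>

lemma abs_integral_le_l2norm:
  assumes "finite_measure M" and f: "square_integrable M (f :: 'a \<Rightarrow> real)"
  shows "\<bar>LINT x|M. f x\<bar> \<le> sqrt (measure M (space M)) * l2norm M f"
proof -
  interpret finite_measure M by fact
  define m where "m = measure M (space M)"
  have i1: "integrable M f" by (rule integrable_of_square_integrable[OF assms])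
  have i2: "integrable M (\<lambda>x. (f x)\<^sup>2)" using f by (simp add: square_integrable_def)
  define s where "s = (LINT x|M. f x)"
  define q where "q = (LINT x|M. (f x)\<^sup>2)"
  have "s\<^sup>2 \<le> m * q"
  proof (cases "m = 0")
    case True
    then have "AE x in M. f x = 0"
      by (intro AE_I[of _ _ "space M"]) (auto simp: m_def emeasure_eq_measure)
    then have "s = 0" unfolding s_def by (simp add: integral_eq_zero_AE)
    then show ?thesis using True by simp
  next
    case False
    then have m: "m > 0" by (simp add: m_def measure_nonneg less_le)
    have "0 \<le> (LINT x|M. (m * f x - s)\<^sup>2)" by simp
    also have "(\<lambda>x. (m * f x - s)\<^sup>2) = (\<lambda>x. m\<^sup>2 * (f x)\<^sup>2 - 2 * m * s * f x + s\<^sup>2)"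
      by (simp add: power2_eq_square algebra_simps)
    also have "integral\<^sup>L M \<dots> = m\<^sup>2 * q - 2 * m * s * s + s\<^sup>2 * m"
      using i1 i2 by (simp add: s_def q_def m_def)
    also have "\<dots> = m * (m * q - s\<^sup>2)" by (simp add: power2_eq_square algebra_simps)
    finally show ?thesis using m by (simp add: zero_le_mult_iff)
  qed
  then have "sqrt (s\<^sup>2) \<le> sqrt (m * q)" by (rule real_sqrt_le_mono)
  then show ?thesis by (simp add: s_def q_def m_def l2norm_def real_sqrt_mult)
qed

lemma integral_box3_lebesgue:
  assumes pos: "a > 0" "b > 0" "c > 0" and f: "continuous_on UNIV f"
  shows "integrable (lebesgue_on (box3 a b c)) f"
    and "(LINT p|lebesgue_on (box3 a b c). f p) = 8 * a * b * c * avg3 a b c f"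
proof -
  let ?O = "box3 a b c"
  let ?K = "cbox3 a b c"
  have op: "open ?O" by (intro open_Times) auto
  then have Ob[measurable]: "?O \<in> sets borel" by (rule borel_open)
  have fm[measurable]: "f \<in> borel_measurable borel" using f by (rule borel_measurable_continuous_onI)
  have K: "compact ?K" by (intro compact_Times) auto
  have "integrable lborel (\<lambda>p. indicator ?O p *\<^sub>R (indicator ?K p * f p))"
    by (intro integrable_mult_indicator integrable_indicator_compact f K) auto
  also have "(\<lambda>p. indicator ?O p *\<^sub>R (indicator ?K p * f p)) = (\<lambda>p. indicator ?O p * f p)"
    by (auto simp: indicator_def fun_eq_iff)
  finally have i: "integrable lborel (\<lambda>p. indicator ?O p * f p)" .
  then show "integrable (lebesgue_on ?O) f"
    using op by (subst integrable_restrict_space) (auto intro: integrable_completion[THEN iffD2])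
  have bx: "box (-a, -b, -c) (a, b, c) = ?O" "cbox (-a, -b, -c) (a, b, c) = ?K"
    by (auto simp: mem_box Basis_prod_def)
  have "(LINT p|lebesgue_on ?O. f p) = (LINT p|lebesgue. indicator ?O p * f p)"
    using op by (subst integral_restrict_space) auto
  also have "\<dots> = (LINT p|lborel. indicator ?O p * f p)"
    by (rule integral_completion) measurable
  also have "\<dots> = (LINT p|lborel. indicator ?K p * f p)"
    using integral_between_boxes[of f ?O "(-a, -b, -c)" "(a, b, c)"] unfolding bx by fastforce
  also have "\<dots> = 8 * a * b * c * avg3 a b c f"
    by (rule avg3_eq_lborel[OF pos f, symmetric])
  finally show "(LINT p|lebesgue_on ?O. f p) = 8 * a * b * c * avg3 a b c f" .
qed

section \<open>The upper bound\<close>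

lemma Basis_triple: "(Basis :: R3 set) = {(1, 0, 0), (0, 1, 0), (0, 0, 1)}"
  by (auto simp: Basis_prod_def zero_prod_def)

lemma classical_grad_inner:
  "i \<in> Basis \<Longrightarrow> classical_grad u x \<bullet> i = frechet_derivative u (at x) i"
  by (simp add: classical_grad_def inner_sum_left inner_Basis if_distrib cong: if_cong)

lemma norm_classical_grad:
  fixes u :: "R3 \<Rightarrow> real"
  shows "(norm (classical_grad u x))\<^sup>2 = (frechet_derivative u (at x) (1, 0, 0))\<^sup>2
    + (frechet_derivative u (at x) (0, 1, 0))\<^sup>2 + (frechet_derivative u (at x) (0, 0, 1))\<^sup>2"
proof -
  have "(norm (classical_grad u x))\<^sup>2 = (\<Sum>i\<in>Basis. (frechet_derivative u (at x) i)\<^sup>2)"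
    unfolding power2_norm_eq_inner euclidean_inner[of "classical_grad u x" "classical_grad u x"]
    by (intro sum.cong refl) (simp add: classical_grad_inner power2_eq_square)
  then show ?thesis by (simp add: Basis_triple)
qed

lemma continuous_classical_grad: "smooth u \<Longrightarrow> continuous_on S (classical_grad u)"
  unfolding classical_grad_def[abs_def]
  by (intro continuous_on_sum continuous_on_scaleR continuous_on_const smooth_continuous_deriv)

lemma square_integrable_box3:
  fixes f :: "R3 \<Rightarrow> 'b::euclidean_space"
  assumes pos: "a > 0" "b > 0" "c > 0" and f: "continuous_on UNIV f"
  shows "square_integrable (lebesgue_on (box3 a b c)) f"
  unfolding square_integrable_def
proof
  show "f \<in> borel_measurable (lebesgue_on (box3 a b c))"
    using f by (intro measurable_restrict_space1 measurable_completion) (simp add: borel_measurable_continuous_onI)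
  show "integrable (lebesgue_on (box3 a b c)) (\<lambda>x. (norm (f x))\<^sup>2)"
    by (intro integral_box3_lebesgue pos continuous_intros f)
qed

lemma square_integrable_surface:
  fixes f :: "R3 \<Rightarrow> real"
  assumes pos: "a > 0" "b > 0" "c > 0" and f: "continuous_on UNIV f"
  shows "square_integrable (surface_measure (box3 a b c)) f"
proof -
  have int: "integrable (surface_measure (box3 a b c)) g" if "continuous_on UNIV g"
    for g :: "R3 \<Rightarrow> real"
    using surface_integral_box[OF pos] that by blast
  show ?thesis
    using borel_measurable_integrable[OF int[OF f]] int[of "\<lambda>x. (f x)\<^sup>2"] f
    by (auto simp: square_integrable_def intro!: continuous_intros)
qed

lemma smooth_partials:
  fixes u :: "R3 \<Rightarrow> real"
  assumes "smooth u"
  shows "((\<lambda>x. u (x, y, z)) has_real_derivative frechet_derivative u (at (x, y, z)) (1, 0, 0)) (at x)"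
    and "((\<lambda>y. u (x, y, z)) has_real_derivative frechet_derivative u (at (x, y, z)) (0, 1, 0)) (at y)"
    and "((\<lambda>z. u (x, y, z)) has_real_derivative frechet_derivative u (at (x, y, z)) (0, 0, 1)) (at z)"
proof -
  let ?D = "frechet_derivative u (at (x, y, z))"
  have D: "(u has_derivative ?D) (at (x, y, z))" by (rule smooth_has_derivative[OF assms])
  then interpret bounded_linear ?D by (rule has_derivative_bounded_linear)
  have lin: "?D (h, 0, 0) = ?D (1, 0, 0) * h" "?D (0, h, 0) = ?D (0, 1, 0) * h" "?D (0, 0, h) = ?D (0, 0, 1) * h" for h
    using scaleR[of h "(1, 0, 0)"] scaleR[of h "(0, 1, 0)"] scaleR[of h "(0, 0, 1)"] by (simp_all add: mult.commute)
  show "((\<lambda>x. u (x, y, z)) has_real_derivative ?D (1, 0, 0)) (at x)"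
    unfolding has_field_derivative_def lin(1)[symmetric]
    by (rule has_derivative_compose[of "\<lambda>x. (x, y, z)", OF _ D]) (auto intro!: derivative_eq_intros simp: zero_prod_def)
  show "((\<lambda>y. u (x, y, z)) has_real_derivative ?D (0, 1, 0)) (at y)"
    unfolding has_field_derivative_def lin(2)[symmetric]
    by (rule has_derivative_compose[of "\<lambda>y. (x, y, z)", OF _ D]) (auto intro!: derivative_eq_intros)
  show "((\<lambda>z. u (x, y, z)) has_real_derivative ?D (0, 0, 1)) (at z)"
    unfolding has_field_derivative_def lin(3)[symmetric]
    by (rule has_derivative_compose[of "\<lambda>z. (x, y, z)", OF _ D]) (auto intro!: derivative_eq_intros)
qed

text \<open>
  Vanishing surface mean says that \<open>b c S1 + a c S2 + a b S3 = 0\<close>, so \<open>E\<close> is a convex combination of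
  the differences \<open>E - Si\<close>, and the boundary terms of the trace inequality absorb \<open>E\<^sup>2\<close>.
\<close>

lemma poincare_smooth_box:
  fixes u :: "R3 \<Rightarrow> real"
  assumes pos: "a > 0" "b > 0" "c > 0" and u: "smooth u"
    and mean: "(LINT p|surface_measure (box3 a b c). u p) = 0"
    and L: "a \<le> L" "b \<le> L" "c \<le> L"
  shows "l2norm (lebesgue_on (box3 a b c)) u
    \<le> 2 * L / pi * l2norm (lebesgue_on (box3 a b c)) (classical_grad u)"
proof -
  let ?O = "box3 a b c"
  define ux uy uz where "ux p = frechet_derivative u (at p) (1, 0, 0)"
    and "uy p = frechet_derivative u (at p) (0, 1, 0)" and "uz p = frechet_derivative u (at p) (0, 0, 1)" for p
  have cu: "continuous_on UNIV u" by (rule smooth_continuous[OF u])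
  have cd: "continuous_on UNIV ux" "continuous_on UNIV uy" "continuous_on UNIV uz"
    unfolding ux_def uy_def uz_def by (intro smooth_continuous_deriv[OF u]; simp add: Basis_triple)+
  define E where "E = avg3 a b c u"
  define S1 S2 S3 where "S1 = avg2 b c (\<lambda>(y, z). (u (a, y, z) + u (- a, y, z)) / 2)"
    and "S2 = avg2 a c (\<lambda>(x, z). (u (x, b, z) + u (x, - b, z)) / 2)"
    and "S3 = avg2 a b (\<lambda>(x, y). (u (x, y, c) + u (x, y, - c)) / 2)"
  define s where "s = b * c + a * c + a * b"
  have s: "s > 0" using pos by (simp add: s_def add_pos_pos)
  obtain k where k: "k > 0" and surf: "\<And>g :: R3 \<Rightarrow> real. continuous_on UNIV g \<Longrightarrow>
      (LINT p|surface_measure ?O. g p) = k * face_sum a b c g"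
    using surface_integral_box[OF pos] by blast
  have mean0: "b * c * S1 + a * c * S2 + a * b * S3 = 0"
    using mean k unfolding surf[OF cu] face_sum_def S1_def S2_def S3_def by simp
  have "s * E = b * c * (E - S1) + a * c * (E - S2) + a * b * (E - S3)"
    using mean0 by (simp add: s_def algebra_simps)
  then have "E = b * c / s * (E - S1) + a * c / s * (E - S2) + a * b / s * (E - S3)"
    using s by (simp add: eq_divide_eq mult.commute flip: add_divide_distrib)
  then have "E\<^sup>2 = (b * c / s * (E - S1) + a * c / s * (E - S2) + a * b / s * (E - S3))\<^sup>2" by simp
  also have "\<dots> \<le> (E - S1)\<^sup>2 + (E - S2)\<^sup>2 + (E - S3)\<^sup>2"
    using pos s by (intro square_convex3) (auto simp: s_def simp flip: add_divide_distrib)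
  finally have E: "E\<^sup>2 \<le> (E - S1)\<^sup>2 + (E - S2)\<^sup>2 + (E - S3)\<^sup>2" .
  have "avg3 a b c (\<lambda>p. (u p)\<^sup>2) - E\<^sup>2 + (E - S1)\<^sup>2 + (E - S2)\<^sup>2 + (E - S3)\<^sup>2
      \<le> avg3 a b c (\<lambda>p. (2 * a / pi)\<^sup>2 * (ux p)\<^sup>2) + avg3 a b c (\<lambda>p. (2 * b / pi)\<^sup>2 * (uy p)\<^sup>2)
      + avg3 a b c (\<lambda>p. (2 * c / pi)\<^sup>2 * (uz p)\<^sup>2)"
    unfolding E_def S1_def S2_def S3_def
    by (rule box_trace_inequality[OF pos _ _ _ cu cd]) (unfold ux_def uy_def uz_def, (rule smooth_partials[OF u])+)
  with E have main: "avg3 a b c (\<lambda>p. (u p)\<^sup>2)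
      \<le> avg3 a b c (\<lambda>p. (2 * a / pi)\<^sup>2 * (ux p)\<^sup>2) + avg3 a b c (\<lambda>p. (2 * b / pi)\<^sup>2 * (uy p)\<^sup>2)
      + avg3 a b c (\<lambda>p. (2 * c / pi)\<^sup>2 * (uz p)\<^sup>2)"
    by linarith
  let ?M = "lebesgue_on ?O"
  note int = integral_box3_lebesgue(1)[OF pos]
  note val = integral_box3_lebesgue(2)[OF pos, symmetric]
  have "(LINT p|?M. (u p)\<^sup>2) = 8 * a * b * c * avg3 a b c (\<lambda>p. (u p)\<^sup>2)"
    by (rule val[symmetric]) (intro continuous_intros cu)
  also have "\<dots> \<le> 8 * a * b * c * (avg3 a b c (\<lambda>p. (2 * a / pi)\<^sup>2 * (ux p)\<^sup>2)
      + avg3 a b c (\<lambda>p. (2 * b / pi)\<^sup>2 * (uy p)\<^sup>2) + avg3 a b c (\<lambda>p. (2 * c / pi)\<^sup>2 * (uz p)\<^sup>2))"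
    using main pos by (intro mult_left_mono) auto
  also have "\<dots> = (LINT p|?M. (2 * a / pi)\<^sup>2 * (ux p)\<^sup>2) + (LINT p|?M. (2 * b / pi)\<^sup>2 * (uy p)\<^sup>2)
      + (LINT p|?M. (2 * c / pi)\<^sup>2 * (uz p)\<^sup>2)"
    unfolding distrib_left by (intro arg_cong2[where f = "(+)"] val continuous_intros cd)
  also have "\<dots> = (LINT p|?M. (2 * a / pi)\<^sup>2 * (ux p)\<^sup>2 + (2 * b / pi)\<^sup>2 * (uy p)\<^sup>2 + (2 * c / pi)\<^sup>2 * (uz p)\<^sup>2)"
    by (subst Bochner_Integration.integral_add Bochner_Integration.integral_add,
        (intro int continuous_intros cd)+)+ simp
  also have "\<dots> \<le> (LINT p|?M. (2 * L / pi)\<^sup>2 * (norm (classical_grad u p))\<^sup>2)"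
  proof (rule integral_mono)
    fix p
    have "(2 * t / pi)\<^sup>2 \<le> (2 * L / pi)\<^sup>2" if "0 < t" "t \<le> L" for t
      using that by (intro power_mono divide_right_mono) auto
    then have "(2 * a / pi)\<^sup>2 * (ux p)\<^sup>2 + (2 * b / pi)\<^sup>2 * (uy p)\<^sup>2 + (2 * c / pi)\<^sup>2 * (uz p)\<^sup>2
        \<le> (2 * L / pi)\<^sup>2 * (ux p)\<^sup>2 + (2 * L / pi)\<^sup>2 * (uy p)\<^sup>2 + (2 * L / pi)\<^sup>2 * (uz p)\<^sup>2"
      using pos L by (intro add_mono mult_right_mono) auto
    then show "(2 * a / pi)\<^sup>2 * (ux p)\<^sup>2 + (2 * b / pi)\<^sup>2 * (uy p)\<^sup>2 + (2 * c / pi)\<^sup>2 * (uz p)\<^sup>2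
        \<le> (2 * L / pi)\<^sup>2 * (norm (classical_grad u p))\<^sup>2"
      by (simp only: norm_classical_grad ux_def uy_def uz_def distrib_left)
  qed (intro int continuous_intros cd continuous_classical_grad[OF u])+
  finally have "(l2norm ?M u)\<^sup>2 \<le> (2 * L / pi * l2norm ?M (classical_grad u))\<^sup>2"
    unfolding power_mult_distrib[of "2 * L / pi" "l2norm ?M (classical_grad u)"] l2norm_power2 by simp
  then show ?thesis
    by (rule power2_le_imp_le)
       (intro mult_nonneg_nonneg divide_nonneg_nonneg l2norm_nonneg; use pos L in simp)
qed

lemma open_box3: "open (box3 a b c)"
  by (intro open_Times) auto

lemma finite_measure_box3:
  fixes a b c :: real
  assumes "a > 0" "b > 0" "c > 0"
  shows "finite_measure (lebesgue_on (box3 a b c))"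
  using integral_box3_lebesgue(1)[OF assms, of "\<lambda>_. 1"]
  by (intro finite_measureI) (simp add: integrable_iff_bounded top.not_eq_extremum)

lemma has_L2_weak_grad_weak_grad: "w \<in> H1 \<Omega> \<Longrightarrow> has_L2_weak_grad \<Omega> w (weak_grad \<Omega> w)"
  unfolding H1_def weak_grad_def using someI_ex[of "has_L2_weak_grad \<Omega> w"] by blast

text \<open>
  The smooth functions that approximate \<open>w\<close> up to the boundary need not have surface mean zero
  themselves. Their surface means \<open>\<mu> n\<close> tend to that of the trace, hence to zero, so subtracting
  them affects neither limit.
\<close>

theorem poincare_bound_box:
  assumes pos: "a > 0" "b > 0" "c > 0" and L: "a \<le> L" "b \<le> L" "c \<le> L"
    and O: "\<Omega> = box3 a b c"
  shows "poincare_bound \<Omega> (frontier \<Omega>) (2 * L / pi)"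
  unfolding poincare_bound_def
proof
  let ?M = "lebesgue_on \<Omega>" and ?\<sigma> = "surface_measure \<Omega>"
  interpret M: finite_measure ?M using finite_measure_box3[OF pos] by (simp add: O)
  obtain k where k: "k > 0" and surf_int: "\<And>g :: R3 \<Rightarrow> real. continuous_on UNIV g \<Longrightarrow> integrable ?\<sigma> g"
    and surf: "\<And>g :: R3 \<Rightarrow> real. continuous_on UNIV g \<Longrightarrow> (LINT p|?\<sigma>. g p) = k * face_sum a b c g"
    using surface_integral_box[OF pos] unfolding O by blast
  have "integrable ?\<sigma> (\<lambda>_. 1 :: real)" by (rule surf_int) simp
  then interpret S: finite_measure ?\<sigma>
    by (intro finite_measureI) (simp add: integrable_iff_bounded top.not_eq_extremum)
  have sp: "space ?\<sigma> = frontier \<Omega>"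
    by (simp add: surface_measure_def space_restrict_space)
  have sq\<sigma>: "square_integrable ?\<sigma> f" if f: "continuous_on UNIV f" for f :: "R3 \<Rightarrow> real"
    unfolding O by (rule square_integrable_surface[OF pos f])
  define m where "m = measure ?\<sigma> (frontier \<Omega>)"
  have avg2_1: "avg2 s t (\<lambda>_. 1) = 1" if "s > 0" "t > 0" for s t
    using that by (simp add: avg2_def measure_unif)
  have "m = (LINT p|?\<sigma>. 1)" by (simp add: m_def sp[symmetric])
  also have "\<dots> = k * (b * c + a * c + a * b)"
    using surf[of "\<lambda>_. 1"] pos by (simp add: face_sum_def avg2_1 case_prod_unfold)
  finally have m: "m > 0" using k pos by (simp add: add_pos_pos)
  fix w assume "w \<in> H1_mean_zero \<Omega> (frontier \<Omega>)"
  then obtain g where w: "w \<in> H1 \<Omega>" and tr: "has_trace \<Omega> w g" and mv: "mean_value ?\<sigma> (frontier \<Omega>) g = 0"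
    by (auto simp: H1_mean_zero_def)
  have sqw: "square_integrable ?M w" using w by (simp add: H1_def)
  have sqG: "square_integrable ?M (weak_grad \<Omega> w)"
    using has_L2_weak_grad_weak_grad[OF w] by (simp add: has_L2_weak_grad_def)
  have sqg: "square_integrable ?\<sigma> g" using tr by (simp add: has_trace_def)
  obtain u where us: "\<And>n. smooth (u n)"
    and l1: "(\<lambda>n. l2norm ?M (\<lambda>x. u n x - w x)) \<longlonglongrightarrow> 0"
    and l2: "(\<lambda>n. l2norm ?M (\<lambda>x. classical_grad (u n) x - weak_grad \<Omega> w x)) \<longlonglongrightarrow> 0"
    and l3: "(\<lambda>n. l2norm ?\<sigma> (\<lambda>x. u n x - g x)) \<longlonglongrightarrow> 0"
    using tr by (auto simp: has_trace_def)
  have cu: "continuous_on UNIV (u n)" for n by (rule smooth_continuous[OF us])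
  have g0: "(LINT x|?\<sigma>. g x) = 0"
  proof -
    have "(LINT x|?\<sigma>. g x) = (LINT x:frontier \<Omega>|?\<sigma>. g x)"
      unfolding set_lebesgue_integral_def
      by (intro Bochner_Integration.integral_cong refl) (simp add: sp)
    then show ?thesis using mv m by (simp add: mean_value_def m_def)
  qed
  define \<mu> where "\<mu> n = (LINT x|?\<sigma>. u n x) / m" for n
  have \<mu>0: "\<mu> \<longlonglongrightarrow> 0"
  proof -
    have "\<bar>\<mu> n\<bar> \<le> sqrt m / m * l2norm ?\<sigma> (\<lambda>x. u n x - g x)" for n
    proof -
      have "(LINT x|?\<sigma>. u n x) = (LINT x|?\<sigma>. u n x - g x)"
        using g0 by (subst Bochner_Integration.integral_diff)
          (auto intro: surf_int cu integrable_of_square_integrable[OF S.finite_measure_axioms sqg])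
      then have "\<bar>LINT x|?\<sigma>. u n x\<bar> \<le> sqrt m * l2norm ?\<sigma> (\<lambda>x. u n x - g x)"
        using abs_integral_le_l2norm[OF S.finite_measure_axioms square_integrable_diff[OF sq\<sigma>[OF cu[of n]] sqg]]
        by (simp add: m_def sp)
      then show ?thesis using m by (simp add: \<mu>_def abs_divide divide_right_mono)
    qed
    moreover have "(\<lambda>n. sqrt m / m * l2norm ?\<sigma> (\<lambda>x. u n x - g x)) \<longlonglongrightarrow> 0"
      using tendsto_mult_left[OF l3, of "sqrt m / m"] by simp
    ultimately show ?thesis
      by (intro Lim_null_comparison[of \<mu>] always_eventually allI) (simp_all only: real_norm_def)
  qed
  define v where "v n x = u n x - \<mu> n" for n x
  have vs: "smooth (v n)" for n
    unfolding v_def[abs_def] by (intro smooth_diff us smooth_const)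
  have gv: "classical_grad (v n) = classical_grad (u n)" for n
  proof -
    have "((v n) has_derivative frechet_derivative (u n) (at x)) (at x)" for x
      unfolding v_def[abs_def]
      by (rule has_derivative_eq_rhs[OF has_derivative_diff[OF smooth_has_derivative[OF us] has_derivative_const]]) simp
    from frechet_derivative_at[OF this]
    have "frechet_derivative (v n) (at x) = frechet_derivative (u n) (at x)" for x
      by (rule sym)
    then show ?thesis
      by (simp add: classical_grad_def[abs_def])
  qed
  have sqc: "square_integrable ?M f" if "continuous_on UNIV f" for f :: "R3 \<Rightarrow> 'b::euclidean_space"
    unfolding O by (rule square_integrable_box3[OF pos that])
  have bound: "l2norm ?M (v n) \<le> 2 * L / pi * l2norm ?M (classical_grad (u n))" for n
  proof -
    have "(LINT x|?\<sigma>. v n x) = (LINT x|?\<sigma>. u n x) - \<mu> n * m"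
      unfolding v_def using surf_int[OF cu]
      by (subst Bochner_Integration.integral_diff) (auto simp: m_def sp)
    also have "\<dots> = 0" using m by (simp add: \<mu>_def)
    finally show ?thesis
      using poincare_smooth_box[OF pos vs _ L, of n] by (simp add: gv O)
  qed
  have lv: "(\<lambda>n. l2norm ?M (v n)) \<longlonglongrightarrow> l2norm ?M w"
  proof (rule l2norm_tendsto[OF sqc sqw])
    show "continuous_on UNIV (v n)" for n by (rule smooth_continuous[OF vs])
    have const: "l2norm ?M (\<lambda>_. - t) = \<bar>t\<bar> * sqrt (measure ?M (space ?M))" for t :: real
      by (simp add: l2norm_def real_sqrt_mult)
    have le: "l2norm ?M (\<lambda>x. v n x - w x) \<le> l2norm ?M (\<lambda>x. u n x - w x) + \<bar>\<mu> n\<bar> * sqrt (measure ?M (space ?M))" for n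
    proof -
      have "l2norm ?M (\<lambda>x. (u n x - w x) + - \<mu> n) \<le> l2norm ?M (\<lambda>x. u n x - w x) + l2norm ?M (\<lambda>_. - \<mu> n)"
        by (intro l2norm_triangle square_integrable_diff sqc cu sqw continuous_on_const)
      then show ?thesis by (simp only: const v_def) (simp add: algebra_simps)
    qed
    have lim: "(\<lambda>n. l2norm ?M (\<lambda>x. u n x - w x) + \<bar>\<mu> n\<bar> * sqrt (measure ?M (space ?M))) \<longlonglongrightarrow> 0"
      using tendsto_add[OF l1 tendsto_mult_right[OF tendsto_rabs_zero[OF \<mu>0], of "sqrt (measure ?M (space ?M))"]] by simp
    show "(\<lambda>n. l2norm ?M (\<lambda>x. v n x - w x)) \<longlonglongrightarrow> 0"
    proof (rule Lim_null_comparison[OF _ lim])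
      show "\<forall>\<^sub>F n in sequentially. norm (l2norm ?M (\<lambda>x. v n x - w x))
          \<le> l2norm ?M (\<lambda>x. u n x - w x) + \<bar>\<mu> n\<bar> * sqrt (measure ?M (space ?M))"
        unfolding real_norm_def abs_of_nonneg[OF l2norm_nonneg] by (intro always_eventually allI le)
    qed
  qed
  have lg: "(\<lambda>n. l2norm ?M (classical_grad (u n))) \<longlonglongrightarrow> l2norm ?M (weak_grad \<Omega> w)"
    by (rule l2norm_tendsto[OF sqc sqG l2]) (rule continuous_classical_grad[OF us])
  show "l2norm ?M w \<le> 2 * L / pi * l2norm ?M (weak_grad \<Omega> w)"
    by (rule LIMSEQ_le[OF lv tendsto_mult_left[OF lg]]) (use bound in auto)
qed

section \<open>The lower bound\<close>

text \<open>
  Translation invariance makes the integral of every difference quotient zero; the quotients are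
  bounded and live on a common compact set, so dominated convergence applies.
\<close>

lemma integral_derivative_compact_support:
  fixes \<psi> :: "'a::euclidean_space \<Rightarrow> real"
  assumes "smooth \<psi>" and K: "compact K" "\<And>x. x \<notin> K \<Longrightarrow> \<psi> x = 0" and i: "i \<in> Basis"
  shows "(LINT x|lborel. frechet_derivative \<psi> (at x) i) = 0"
proof -
  let ?D = "\<lambda>x. frechet_derivative \<psi> (at x) i"
  have c\<psi>: "continuous_on UNIV \<psi>" by (rule smooth_continuous[OF assms(1)])
  have cD: "continuous_on UNIV ?D" by (rule smooth_continuous_deriv[OF assms(1) i])
  have [measurable]: "\<psi> \<in> borel_measurable borel" "?D \<in> borel_measurable borel"
    using c\<psi> cD by (auto intro: borel_measurable_continuous_onI)
  \<comment> \<open>Outside \<open>K'\<close>, translates by at most \<open>1\<close> stay outside the support; \<open>K2\<close> contains the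
    intermediate points at which the mean value theorem evaluates the derivative.\<close>
  define K' where "K' = (\<lambda>(x, t). x - t *\<^sub>R i) ` (K \<times> {0..1})"
  have K': "compact K'"
    unfolding K'_def case_prod_unfold
    by (intro compact_continuous_image compact_Times K continuous_intros) auto
  define K2 where "K2 = (\<lambda>(x, t). x + t *\<^sub>R i) ` (K' \<times> {0..1})"
  have K2: "compact K2"
    unfolding K2_def case_prod_unfold
    by (intro compact_continuous_image compact_Times K' continuous_intros) auto
  have "compact (?D ` K2)"
    by (intro compact_continuous_image continuous_on_subset[OF cD] K2) auto
  then obtain C where C: "\<And>x. x \<in> K2 \<Longrightarrow> norm (?D x) \<le> C"
    by (meson bounded_iff compact_imp_bounded image_eqI)
  have der: "((\<lambda>t. \<psi> (x + t *\<^sub>R i)) has_real_derivative ?D (x + t *\<^sub>R i)) (at t)" for x t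
  proof -
    interpret D: bounded_linear "frechet_derivative \<psi> (at (x + t *\<^sub>R i))"
      by (rule has_derivative_bounded_linear[OF smooth_has_derivative[OF assms(1)]])
    have "((\<lambda>t. \<psi> (x + t *\<^sub>R i)) has_derivative (\<lambda>h. frechet_derivative \<psi> (at (x + t *\<^sub>R i)) (h *\<^sub>R i))) (at t)"
      by (rule has_derivative_compose[of "\<lambda>t. x + t *\<^sub>R i", OF _ smooth_has_derivative[OF assms(1)]])
         (auto intro!: derivative_eq_intros)
    then show ?thesis
      unfolding has_field_derivative_def by (simp add: D.scaleR mult.commute[of _ "?D (x + t *\<^sub>R i)"])
  qed
  define q where "q n x = (\<psi> (x + (1 / real (Suc n)) *\<^sub>R i) - \<psi> x) / (1 / real (Suc n))" for n x
  have [measurable]: "q n \<in> borel_measurable borel" for n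
    unfolding q_def by measurable
  have \<psi>int: "integrable lborel \<psi>"
  proof -
    have "integrable lborel (\<lambda>x. indicator K x * \<psi> x)"
      by (rule integrable_indicator_compact[OF c\<psi> K(1)])
    also have "(\<lambda>x. indicator K x * \<psi> x) = \<psi>"
      using K(2) by (auto simp: indicator_def fun_eq_iff)
    finally show ?thesis .
  qed
  have shift: "integrable lborel (\<lambda>x. \<psi> (x + c))" "(LINT x|lborel. \<psi> (x + c)) = (LINT x|lborel. \<psi> x)" for c
  proof -
    have "integrable (distr lborel borel ((+) c)) \<psi>" using \<psi>int by (simp add: lborel_distr_plus)
    then show "integrable lborel (\<lambda>x. \<psi> (x + c))"
      by (subst (asm) integrable_distr_eq) (auto simp: add.commute)
    show "(LINT x|lborel. \<psi> (x + c)) = (LINT x|lborel. \<psi> x)"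
      using integral_distr[of "(+) c" lborel borel \<psi>] by (simp add: lborel_distr_plus add.commute)
  qed
  have q0: "(LINT x|lborel. q n x) = 0" for n
    unfolding q_def using shift \<psi>int by simp
  have "(\<lambda>n. LINT x|lborel. q n x) \<longlonglongrightarrow> (LINT x|lborel. ?D x)"
  proof (rule integral_dominated_convergence[where w = "\<lambda>x. indicator K' x * C"])
    show "integrable lborel (\<lambda>x. indicator K' x * C)"
      using integrable_indicator_compact[OF continuous_on_const K'] by simp
    have "(\<lambda>n. q n x) \<longlonglongrightarrow> ?D x" for x
    proof -
      have "((\<lambda>h. (\<psi> (x + h *\<^sub>R i) - \<psi> x) / h) \<longlongrightarrow> ?D x) (at 0)"
        using der[of x 0] unfolding has_field_derivative_iff by simp
      moreover have "filterlim (\<lambda>n. 1 / real (Suc n)) (at 0) sequentially"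
        unfolding filterlim_at using LIMSEQ_inverse_real_of_nat by (auto simp: inverse_eq_divide)
      ultimately show ?thesis
        unfolding q_def by (rule filterlim_compose)
    qed
    then show "AE x in lborel. (\<lambda>n. q n x) \<longlonglongrightarrow> ?D x" by simp
    have "norm (q n x) \<le> indicator K' x * C" for n x
    proof -
      let ?h = "1 / real (Suc n)"
      have h: "0 < ?h" "?h \<le> 1" by auto
      obtain s where s: "0 < s" "s < ?h" "\<psi> (x + ?h *\<^sub>R i) - \<psi> (x + 0 *\<^sub>R i) = (?h - 0) * ?D (x + s *\<^sub>R i)"
        using MVT2[of 0 ?h "\<lambda>t. \<psi> (x + t *\<^sub>R i)" "\<lambda>t. ?D (x + t *\<^sub>R i)"] der h by blast
      then have q: "q n x = ?D (x + s *\<^sub>R i)" using h by (simp add: q_def)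
      show ?thesis
      proof (cases "x \<in> K'")
        case True
        have "s \<le> 1" using s(2) h(2) by linarith
        with True have "x + s *\<^sub>R i \<in> K2"
          unfolding K2_def using s(1) by (intro image_eqI[of _ _ "(x, s)"]) auto
        then show ?thesis using C True by (simp add: q)
      next
        case False
        then have "x \<notin> K" "x + ?h *\<^sub>R i \<notin> K"
          unfolding K'_def using h by (force intro: image_eqI[of _ _ "(x, 0)"] image_eqI[of _ _ "(x + ?h *\<^sub>R i, ?h)"])+
        then have "q n x = 0" using K(2) by (simp add: q_def)
        then show ?thesis using False by simp
      qed
    qed
    then show "AE x in lborel. norm (q n x) \<le> indicator K' x * C" for n by simp
  qed auto
  then show ?thesis by (simp add: q0 LIMSEQ_const_iff)
qed

lemma frechet_derivative_smooth_mult: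
  assumes "smooth f" "smooth g"
  shows "frechet_derivative (\<lambda>x. f x * g x) (at x) i
    = f x * frechet_derivative g (at x) i + frechet_derivative f (at x) i * g x"
  using frechet_derivative_at[OF has_derivative_mult[OF smooth_has_derivative[OF assms(1)] smooth_has_derivative[OF assms(2)]]]
  by (metis)

text \<open>
  Integration by parts: the product of \<open>w\<close> with a test function is smooth with compact support, so
  its derivatives have integral zero.
\<close>

lemma smooth_weak_grad:
  fixes w :: "'a::euclidean_space \<Rightarrow> real"
  assumes w: "smooth w" and "open \<Omega>" and sq: "square_integrable (lebesgue_on \<Omega>) (classical_grad w)"
  shows "has_L2_weak_grad \<Omega> w (classical_grad w)"
  unfolding has_L2_weak_grad_def
proof (intro conjI allI impI ballI sq)
  fix \<phi> :: "'a \<Rightarrow> real" and i :: 'a assume \<phi>: "test_function \<Omega> \<phi>" and i: "i \<in> Basis"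
  define K where "K = closure {x. \<phi> x \<noteq> 0}"
  have K: "compact K" "K \<subseteq> \<Omega>" and s\<phi>: "smooth \<phi>" using \<phi> by (auto simp: test_function_def K_def)
  have \<phi>0: "\<phi> x = 0" if "x \<notin> K" for x
    using that closure_subset[of "{x. \<phi> x \<noteq> 0}"] unfolding K_def by blast
  have d\<phi>0: "frechet_derivative \<phi> (at x) i = 0" if x: "x \<notin> K" for x
  proof -
    have "open (- K)" using K(1) by (simp add: compact_imp_closed open_Compl)
    then have "(\<phi> has_derivative (\<lambda>_. 0)) (at x)"
      using has_derivative_transform_within_open[OF has_derivative_const[of 0], of "- K" x \<phi>] x \<phi>0 by auto
    from frechet_derivative_at[OF this] show ?thesis by metis
  qed
  have cts: "continuous_on UNIV (\<lambda>x. w x * frechet_derivative \<phi> (at x) i)"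
      "continuous_on UNIV (\<lambda>x. frechet_derivative w (at x) i * \<phi> x)"
    by (intro continuous_on_mult smooth_continuous smooth_continuous_deriv w s\<phi> i)+
  have red: "(LINT x|lebesgue_on \<Omega>. f x) = (LINT x|lborel. f x)" "integrable lborel f"
    if f: "continuous_on UNIV f" and f0: "\<And>x. x \<notin> K \<Longrightarrow> f x = 0" for f :: "'a \<Rightarrow> real"
  proof -
    have [measurable]: "f \<in> borel_measurable borel" using f by (rule borel_measurable_continuous_onI)
    have "(LINT x|lebesgue_on \<Omega>. f x) = (LINT x|lebesgue. indicator \<Omega> x *\<^sub>R f x)"
      using \<open>open \<Omega>\<close> by (subst integral_restrict_space) auto
    also have "\<dots> = (LINT x|lebesgue. f x)"
      using f0 K(2) by (intro Bochner_Integration.integral_cong) (auto simp: indicator_def)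
    also have "\<dots> = (LINT x|lborel. f x)"
      by (rule integral_completion) measurable
    finally show "(LINT x|lebesgue_on \<Omega>. f x) = (LINT x|lborel. f x)" .
    have "integrable lborel (\<lambda>x. indicator K x * f x)"
      by (rule integrable_indicator_compact[OF f K(1)])
    also have "(\<lambda>x. indicator K x * f x) = f"
      using f0 by (auto simp: indicator_def fun_eq_iff)
    finally show "integrable lborel f" .
  qed
  have "0 = (LINT x|lborel. frechet_derivative (\<lambda>x. w x * \<phi> x) (at x) i)"
    by (rule integral_derivative_compact_support[OF smooth_mult[OF w s\<phi>] K(1) _ i, symmetric]) (simp add: \<phi>0)
  also have "\<dots> = (LINT x|lborel. w x * frechet_derivative \<phi> (at x) i + frechet_derivative w (at x) i * \<phi> x)"
    by (simp add: frechet_derivative_smooth_mult[OF w s\<phi>])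
  also have "\<dots> = (LINT x|lborel. w x * frechet_derivative \<phi> (at x) i) + (LINT x|lborel. frechet_derivative w (at x) i * \<phi> x)"
    by (intro Bochner_Integration.integral_add red cts) (auto simp: \<phi>0 d\<phi>0)
  also have "\<dots> = (LINT x|lebesgue_on \<Omega>. w x * frechet_derivative \<phi> (at x) i)
      + (LINT x|lebesgue_on \<Omega>. frechet_derivative w (at x) i * \<phi> x)"
    using red(1)[OF cts(1)] red(1)[OF cts(2)] by (simp add: \<phi>0 d\<phi>0)
  finally show "(LINT x|lebesgue_on \<Omega>. w x * frechet_derivative \<phi> (at x) i)
      = - (LINT x|lebesgue_on \<Omega>. (classical_grad w x \<bullet> i) * \<phi> x)"
    using i by (simp add: classical_grad_inner)
qed

text \<open>
  Reflection in the origin is an isometry, so it preserves Hausdorff measure.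
\<close>

lemma hausdorff_integral_odd:
  fixes g :: "'a::euclidean_space \<Rightarrow> real"
  assumes S[measurable]: "S \<in> sets borel" and sym: "\<And>x. - x \<in> S \<longleftrightarrow> x \<in> S"
    and g[measurable]: "g \<in> borel_measurable borel" and odd: "\<And>x. g (- x) = - g x"
  shows "(LINT x|hausdorff_measure k. indicator S x * g x) = 0"
proof -
  let ?H = "hausdorff_measure k :: 'a measure"
  have tr: "distr ?H borel uminus = ?H"
  proof (rule measure_eqI)
    fix A assume "A \<in> sets (distr ?H borel uminus)"
    then have A[measurable]: "A \<in> sets borel" by simp
    have "uminus -` A = uminus ` A" by (auto simp: image_iff) (metis minus_minus)
    moreover have "uminus -` A \<in> sets borel"
      using measurable_sets_borel[of uminus borel A] by simp
    moreover have "hausdorff_outer k (uminus ` A) = hausdorff_outer k A"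
      by (rule hausdorff_outer_isometric_image) (simp add: dist_minus)
    ultimately show "emeasure (distr ?H borel uminus) A = emeasure ?H A"
      by (subst emeasure_distr) (auto simp: emeasure_hausdorff_measure)
  qed simp
  have "(LINT x|?H. indicator S x * g x) = (LINT x|distr ?H borel uminus. indicator S x * g x)"
    by (simp only: tr)
  also have "\<dots> = (LINT x|?H. indicator S (- x) * g (- x))"
    by (subst integral_distr) auto
  also have "\<dots> = - (LINT x|?H. indicator S x * g x)"
    by (simp add: odd indicator_def sym)
  finally show ?thesis by simp
qed

text \<open>
  Sine and cosine alternate under differentiation; parity of the index encodes this two-element
  family.
\<close>

lemma smooth_sin_inner: "smooth (\<lambda>x. sin (x \<bullet> v))"
proof -
  define F :: "nat \<Rightarrow> real \<Rightarrow> real" where "F n = (if even n then sin else cos)" for n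
  have "(F n has_real_derivative (if even n then 1 else - 1) * F (Suc n) t + 0 * F n t) (at t)" for n t
    by (auto simp: F_def intro!: derivative_eq_intros)
  from smooth_ridge[of F "\<lambda>n. if even n then 1 else - 1" Suc "\<lambda>_. 0" "\<lambda>n. n", OF this, of 0 v 0]
  show ?thesis by (simp add: F_def)
qed

lemma classical_grad_sin_inner:
  fixes v :: "'a::euclidean_space"
  shows "classical_grad (\<lambda>x. sin (x \<bullet> v)) x = cos (x \<bullet> v) *\<^sub>R v"
proof -
  have "((\<lambda>x. sin (x \<bullet> v)) has_derivative (\<lambda>h. cos (x \<bullet> v) * (h \<bullet> v))) (at x)"
    by (auto intro!: derivative_eq_intros)
  from frechet_derivative_at[OF this]
  have D: "frechet_derivative (\<lambda>x. sin (x \<bullet> v)) (at x) = (\<lambda>h. cos (x \<bullet> v) * (h \<bullet> v))"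
    by (rule sym)
  have "classical_grad (\<lambda>x. sin (x \<bullet> v)) x = cos (x \<bullet> v) *\<^sub>R (\<Sum>j\<in>Basis. (v \<bullet> j) *\<^sub>R j)"
    by (simp add: classical_grad_def D scaleR_sum_right inner_commute)
  then show ?thesis by (simp add: euclidean_representation)
qed

text \<open>
  The function is smooth on the whole space, so the constant sequence shows that it is its own trace.
  The weak gradient is a choice among functions that agree almost everywhere, one of which is the
  classical gradient.
\<close>

lemma sine_in_H1_mean_zero:
  fixes v :: "R3"
  assumes pos: "a > 0" "b > 0" "c > 0" and O: "\<Omega> = box3 a b c"
  defines "w \<equiv> \<lambda>p. sin (p \<bullet> v)"
  shows "w \<in> H1_mean_zero \<Omega> (frontier \<Omega>)"
    and "AE p in lebesgue_on \<Omega>. weak_grad \<Omega> w p = cos (p \<bullet> v) *\<^sub>R v"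
    and "weak_grad \<Omega> w \<in> borel_measurable (lebesgue_on \<Omega>)"
proof -
  have w: "smooth w" unfolding w_def by (rule smooth_sin_inner)
  have cw: "continuous_on UNIV w" by (rule smooth_continuous[OF w])
  have op: "open \<Omega>" unfolding O by (rule open_box3)
  have sqc: "square_integrable (lebesgue_on \<Omega>) f" if "continuous_on UNIV f" for f :: "R3 \<Rightarrow> 'b::euclidean_space"
    unfolding O by (rule square_integrable_box3[OF pos that])
  have G: "has_L2_weak_grad \<Omega> w (classical_grad w)"
    by (intro smooth_weak_grad w op sqc continuous_classical_grad)
  have H1: "w \<in> H1 \<Omega>" using G sqc[OF cw] by (auto simp: H1_def)
  have W: "has_L2_weak_grad \<Omega> w (weak_grad \<Omega> w)" by (rule has_L2_weak_grad_weak_grad[OF H1])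
  then show m: "weak_grad \<Omega> w \<in> borel_measurable (lebesgue_on \<Omega>)"
    by (simp add: has_L2_weak_grad_def square_integrable_def)
  have fin: "finite_measure (lebesgue_on \<Omega>)" unfolding O by (rule finite_measure_box3[OF pos])
  have ae: "AE p in lebesgue_on \<Omega>. weak_grad \<Omega> w p = classical_grad w p"
    by (rule weak_grad_unique[OF op fin W G])
  then show "AE p in lebesgue_on \<Omega>. weak_grad \<Omega> w p = cos (p \<bullet> v) *\<^sub>R v"
    unfolding w_def classical_grad_sin_inner .
  have sq\<sigma>: "square_integrable (surface_measure \<Omega>) w"
    unfolding O by (rule square_integrable_surface[OF pos cw])
  have zero: "l2norm (lebesgue_on \<Omega>) (\<lambda>x. classical_grad w x - weak_grad \<Omega> w x) = 0"
  proof -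
    have "AE x in lebesgue_on \<Omega>. (norm (classical_grad w x - weak_grad \<Omega> w x))\<^sup>2 = 0"
      using ae by eventually_elim simp
    then show ?thesis unfolding l2norm_def by (simp add: integral_eq_zero_AE)
  qed
  have tr: "has_trace \<Omega> w w"
    unfolding has_trace_def
    by (intro conjI sq\<sigma> exI[of _ "\<lambda>_. w"] allI w) (simp_all add: zero, simp_all add: l2norm_def)
  have fr: "frontier \<Omega> \<in> sets borel" by (intro borel_closed frontier_closed)
  have sym: "- x \<in> frontier \<Omega> \<longleftrightarrow> x \<in> frontier \<Omega>" for x
    unfolding O frontier_box3[OF pos] by (cases x) auto
  have "(LINT p:frontier \<Omega>|surface_measure \<Omega>. w p)
      = (LINT p|hausdorff_measure 2. indicator (frontier \<Omega>) p * w p)"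
    unfolding set_lebesgue_integral_def surface_measure_def
    using fr by (subst integral_restrict_space) (auto simp: numeral_2_eq_2 mult.assoc[symmetric] simp flip: indicator_inter_arith)
  also have "\<dots> = 0"
    by (rule hausdorff_integral_odd[OF fr sym])
       (auto simp: w_def intro!: borel_measurable_continuous_onI continuous_intros)
  finally have "mean_value (surface_measure \<Omega>) (frontier \<Omega>) w = 0"
    by (simp add: mean_value_def)
  then show "w \<in> H1_mean_zero \<Omega> (frontier \<Omega>)"
    using H1 tr by (auto simp: H1_mean_zero_def)
qed

text \<open>
  The hypothesis on \<open>cos (2 (p \<bullet> v))\<close> says that the squares of \<open>sin (p \<bullet> v)\<close> and \<open>cos (p \<bullet> v)\<close> have
  the same average over the box. The gradient is \<open>cos (p \<bullet> v)\<close> times \<open>v\<close>, so its norm is exactly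
  \<open>norm v\<close> times the norm of the function.
\<close>

lemma poincare_bound_ge_sine:
  fixes v :: "R3"
  assumes pos: "a > 0" "b > 0" "c > 0" and O: "\<Omega> = box3 a b c"
    and avg: "avg3 a b c (\<lambda>p. cos (2 * (p \<bullet> v))) = 0"
    and bound: "poincare_bound \<Omega> (frontier \<Omega>) C"
  shows "1 \<le> C * norm v"
proof -
  let ?M = "lebesgue_on \<Omega>"
  define w where "w p = sin (p \<bullet> v)" for p
  define V where "V = 8 * a * b * c"
  have V: "V > 0" using pos by (simp add: V_def)
  note sine = sine_in_H1_mean_zero[OF pos O, of v, folded w_def[abs_def]]
  have int: "integrable ?M f" "(LINT p|?M. f p) = V * avg3 a b c f" if "continuous_on UNIV f" for f
    using integral_box3_lebesgue[OF pos that] by (simp_all add: O V_def)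
  have cts: "continuous_on UNIV (\<lambda>p. (sin (p \<bullet> v))\<^sup>2)" "continuous_on UNIV (\<lambda>p. (cos (p \<bullet> v))\<^sup>2)"
     "continuous_on UNIV (\<lambda>p. cos (2 * (p \<bullet> v)))"
    by (intro continuous_intros)+
  define s where "s = (LINT p|?M. (sin (p \<bullet> v))\<^sup>2)"
  define t where "t = (LINT p|?M. (cos (p \<bullet> v))\<^sup>2)"
  have "t - s = (LINT p|?M. (cos (p \<bullet> v))\<^sup>2 - (sin (p \<bullet> v))\<^sup>2)"
    unfolding s_def t_def by (intro Bochner_Integration.integral_diff[symmetric] int cts)
  also have "\<dots> = (LINT p|?M. cos (2 * (p \<bullet> v)))"
    by (simp add: cos_double)
  also have "\<dots> = 0" using int(2)[OF cts(3)] avg by simp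
  finally have st: "t = s" by simp
  have "s + t = (LINT p|?M. (sin (p \<bullet> v))\<^sup>2 + (cos (p \<bullet> v))\<^sup>2)"
    unfolding s_def t_def by (intro Bochner_Integration.integral_add[symmetric] int cts)
  also have "\<dots> = V * avg3 a b c (\<lambda>_. 1)"
    using int(2)[of "\<lambda>_. 1"] by simp
  also have "\<dots> = V"
    using pos by (simp add: avg3_def measure_unif)
  finally have s: "s > 0" using st V by simp
  have nw: "l2norm ?M w = sqrt s"
    by (simp add: l2norm_def s_def w_def)
  have "(LINT p|?M. (norm (weak_grad \<Omega> w p))\<^sup>2) = (LINT p|?M. (norm v)\<^sup>2 * (cos (p \<bullet> v))\<^sup>2)"
  proof (rule Bochner_Integration.integral_cong_AE)
    show "(\<lambda>p. (norm (weak_grad \<Omega> w p))\<^sup>2) \<in> borel_measurable ?M"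
      using sine(3) by measurable
    show "(\<lambda>p. (norm v)\<^sup>2 * (cos (p \<bullet> v))\<^sup>2) \<in> borel_measurable ?M"
      using borel_measurable_integrable[OF int(1)[OF cts(2)]] by measurable
    show "AE p in ?M. (norm (weak_grad \<Omega> w p))\<^sup>2 = (norm v)\<^sup>2 * (cos (p \<bullet> v))\<^sup>2"
      using sine(2) by eventually_elim (simp add: power_mult_distrib)
  qed
  also have "\<dots> = (norm v)\<^sup>2 * s"
    using st by (simp add: t_def)
  finally have nG: "l2norm ?M (weak_grad \<Omega> w) = norm v * sqrt s"
    by (simp add: l2norm_def real_sqrt_mult)
  have "l2norm ?M w \<le> C * l2norm ?M (weak_grad \<Omega> w)"
    using bound sine(1) unfolding poincare_bound_def by blast
  then have "sqrt s \<le> C * (norm v * sqrt s)"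
    unfolding nw nG .
  then show ?thesis using s by simp
qed

lemma integral_unif_cos:
  assumes "a > 0"
  shows "(LINT x|unif a. cos (pi / a * x)) = 0"
proof -
  have "((\<lambda>x. cos (pi / a * x)) has_integral (a / pi * sin (pi / a * a) - a / pi * sin (pi / a * (- a)))) {-a..a}"
  proof (rule fundamental_theorem_of_calculus)
    fix x assume "x \<in> {-a..a}"
    show "((\<lambda>x. a / pi * sin (pi / a * x)) has_vector_derivative cos (pi / a * x)) (at x within {-a..a})"
      unfolding has_real_derivative_iff_has_vector_derivative[symmetric]
      using assms by (auto intro!: derivative_eq_intros)
  qed (use assms in auto)
  then have "integral {-a..a} (\<lambda>x. cos (pi / a * x)) = 0"
    using assms by (simp add: integral_unique)
  then show ?thesis
    using assms by (subst integral_unif_continuous) (auto intro!: continuous_intros)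
qed

theorem theorem2p3:
  fixes h1 h2 h3 :: real
    and \<Omega> \<Gamma> :: "(real \<times> real \<times> real) set"
  assumes "h1 > 0" and "h2 > 0" and "h3 > 0"
    and "\<Omega> = {- h1 / 2 <..< h1 / 2} \<times> {- h2 / 2 <..< h2 / 2} \<times> {- h3 / 2 <..< h3 / 2}"
    and "\<Gamma> = frontier \<Omega>"
  shows "poincare_bound \<Omega> \<Gamma> (C1 \<Omega> \<Gamma>) \<and> C1 \<Omega> \<Gamma> = 1 / pi * Max {h1, h2, h3}"
proof -
  define a b c where "a = h1 / 2" and "b = h2 / 2" and "c = h3 / 2"
  have pos: "a > 0" "b > 0" "c > 0" using assms(1-3) by (auto simp: a_def b_def c_def)
  have O: "\<Omega> = box3 a b c" by (simp add: assms(4) a_def b_def c_def)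
  define L where "L = Max {a, b, c}"
  have L: "a \<le> L" "b \<le> L" "c \<le> L" by (auto simp: L_def)
  have "L \<in> {a, b, c}" unfolding L_def by (rule Max_in) auto
  have HL: "1 / pi * Max {h1, h2, h3} = 2 * L / pi"
    by (simp add: L_def a_def b_def c_def max_def)
  have upper: "poincare_bound \<Omega> \<Gamma> (2 * L / pi)"
    unfolding assms(5) by (rule poincare_bound_box[OF pos L O])
  have lower: "2 * L / pi \<le> C" if C: "poincare_bound \<Omega> \<Gamma> C" for C
  proof -
    have ge: "2 * l / pi \<le> C" if l: "l > 0" and i: "norm i = 1"
      and avg: "avg3 a b c (\<lambda>p. cos (pi / l * (p \<bullet> i))) = 0" for l and i :: "R3"
    proof -
      have "1 \<le> C * norm ((pi / (2 * l)) *\<^sub>R i)"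
        by (rule poincare_bound_ge_sine[OF pos O _ C[unfolded assms(5)]]) (use avg in simp)
      then show ?thesis using l i by (simp add: field_simps)
    qed
    have "2 * a / pi \<le> C"
      by (rule ge[of _ "(1, 0, 0)"])
         (use pos integral_unif_cos[OF pos(1)] in \<open>simp_all add: avg3_def measure_unif norm_prod_def\<close>)
    moreover have "2 * b / pi \<le> C"
      by (rule ge[of _ "(0, 1, 0)"])
         (use pos integral_unif_cos[OF pos(2)] in \<open>simp_all add: avg3_def measure_unif norm_prod_def\<close>)
    moreover have "2 * c / pi \<le> C"
      by (rule ge[of _ "(0, 0, 1)"])
         (use pos integral_unif_cos[OF pos(3)] in \<open>simp_all add: avg3_def measure_unif norm_prod_def\<close>)
    ultimately show ?thesis using \<open>L \<in> {a, b, c}\<close> by auto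
  qed
  have "C1 \<Omega> \<Gamma> = 2 * L / pi"
    unfolding C1_def by (rule Least_equality) (rule upper, rule lower)
  then show ?thesis using upper HL by simp
qed

end
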